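(* Let $u_1<u_2$ and let $\psi^{dat}$ be a smooth function on $\mathcal I\cap\{u\in(u_1,u_2)\}=(u_1,u_2)\times S^2$, smooth up to the endpoints. Then there exists $d$ sufficiently large such that the equation $\Box\phi=-\phi^5$ admits a solution $\phi=W+\psi$ in $\{v>d,\ u<u_2+1\}$ such that, for all $u_\star\in(u_1,u_2)$ and $\omega\in S^2$, $$\lim_{\substack{r\to\infty\\ t-r=2u_\star}} r\psi=\psi^{dat}(u_\star,\omega).$$
   Context: $(t,x)\in\mathbb R^{1+3}$, $r=|x|$, $\omega=x/|x|$, $\Box=-\partial_t^2+\Delta$, $u=\frac{t-r}2$, $v=\frac{t+r}2$. $W(x)=(1+|x|^2/3)^{-1/2}$ is the ground state soliton, a stationary solution of $\Box\phi=-\phi^5$. $\mathcal I=\mathbb R_u\times S^2$ is (idealised) future null infinity, reached along $t-r=2u$ and $\omega$ fixed, $r\to\infty$. *)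

theory Defs
  imports "HOL-Analysis.Analysis"
begin

text \<open>A spacetime point is a pair \<open>(t, x)\<close>; a point of future null infinity is a pair
  \<open>(u, \<omega>)\<close> whose second component lies on the unit sphere of \<open>real ^ 3\<close>.\<close>

type_synonym spacetime = "real \<times> (real ^ 3)"

definition ucoord :: "spacetime \<Rightarrow> real" where
  "ucoord z = (fst z - norm (snd z)) / 2"

definition vcoord :: "spacetime \<Rightarrow> real" where
  "vcoord z = (fst z + norm (snd z)) / 2"

definition soliton :: "real ^ 3 \<Rightarrow> real" where
  "soliton x = (1 + (norm x)\<^sup>2 / 3) powr (- 1 / 2)"

definition ddir :: "'a::real_normed_vector \<Rightarrow> ('a \<Rightarrow> real) \<Rightarrow> 'a \<Rightarrow> real" where
  "ddir e f z = frechet_derivative f (at z) e"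

text \<open>\<open>diff_on k f U\<close> is meant for open \<open>U\<close>, where it says that \<open>f\<close> is of class \<open>C\<^sup>k\<close>: the
  derivative exists at each point, and all iterated directional derivatives of order at most
  \<open>k\<close> are continuous.\<close>

primrec diff_on :: "nat \<Rightarrow> ('a::real_normed_vector \<Rightarrow> real) \<Rightarrow> 'a set \<Rightarrow> bool" where
  "diff_on 0 f U \<longleftrightarrow> continuous_on U f"
| "diff_on (Suc k) f U \<longleftrightarrow>
     (\<forall>z\<in>U. f differentiable (at z)) \<and> (\<forall>e. diff_on k (ddir e f) U)"

definition smooth_on_open :: "('a::real_normed_vector \<Rightarrow> real) \<Rightarrow> 'a set \<Rightarrow> bool" where
  "smooth_on_open f U \<longleftrightarrow> open U \<and> (\<forall>k. diff_on k f U)"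

text \<open>Smoothness on an arbitrary subset \<open>A\<close> of a Euclidean space: near each point of \<open>A\<close>, the
  function is the restriction of a smooth function on an open set. For an embedded submanifold
  with boundary such as \<open>[u\<^sub>1, u\<^sub>2] \<times> S\<^sup>2\<close> this is smoothness on the manifold, up to its
  boundary.\<close>

definition smooth_on :: "('a::real_normed_vector \<Rightarrow> real) \<Rightarrow> 'a set \<Rightarrow> bool" where
  "smooth_on f A \<longleftrightarrow>
     (\<forall>p\<in>A. \<exists>U F. p \<in> U \<and> smooth_on_open F U \<and> (\<forall>q\<in>U \<inter> A. F q = f q))"

text \<open>Only the values of \<open>f\<close> on \<open>(u\<^sub>1, u\<^sub>2) \<times> S\<^sup>2\<close> matter here.\<close>

definition smooth_up_to_endpoints :: "real \<Rightarrow> real \<Rightarrow> (real \<times> (real ^ 3) \<Rightarrow> real) \<Rightarrow> bool" where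
  "smooth_up_to_endpoints u1 u2 f \<longleftrightarrow>
     (\<exists>F. smooth_on F ({u1..u2} \<times> sphere 0 1) \<and>
          (\<forall>u\<in>{u1<..<u2}. \<forall>\<omega>\<in>sphere 0 1. F (u, \<omega>) = f (u, \<omega>)))"

definition wave_op :: "(spacetime \<Rightarrow> real) \<Rightarrow> spacetime \<Rightarrow> real" where
  "wave_op f z =
     - ddir (1, 0) (ddir (1, 0) f) z
     + (\<Sum>b\<in>Basis. ddir (0, b) (ddir (0, b) f) z)"

definition solves_quintic_on :: "(spacetime \<Rightarrow> real) \<Rightarrow> spacetime set \<Rightarrow> bool" where
  "solves_quintic_on \<phi> U \<longleftrightarrow>
     smooth_on_open \<phi> U \<and> (\<forall>z\<in>U. wave_op \<phi> z = - (\<phi> z ^ 5))"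

end

theory Submission
  imports Defs "HOL-Real_Asymp.Real_Asymp"
begin

text \<open>The soliton enters only through its radiation field. On \<open>v > d\<close>,
  \<open>u < u2 + 1\<close> the radius exceeds \<open>d - u2 - 1\<close>, so for large
  \<open>d\<close> the quintic term perturbs the free wave equation only slightly and no
  linearisation about the soliton is inverted: it suffices to add \<open>sqrt 3\<close>, the limit
  of \<open>r * soliton\<close>, to the data. The full field is a fixed point of
  \<open>\<phi> = lin + adv (chi * \<phi> ^ 5)\<close>, where \<open>lin\<close> is a free wave with
  the shifted data and \<open>adv\<close> integrates over forward light cones, which leaves the
  radiation field unchanged. The cutoff \<open>chi\<close> makes the problem global. A source
  supported in radius at least \<open>D\<close> gains a factor \<open>1 / (1 + D)\<close> under
  \<open>adv\<close>; the size of \<open>lin\<close> is fixed by the data, so \<open>d\<close> is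
  chosen last and the data may be large. The obstacle is smoothness: one \<open>d\<close> must serve
  derivatives of every order. Differentiating the iteration keeps the small coefficient
  \<open>5 * chi * \<phi> ^ 4\<close> in front of the highest derivative and puts all other terms
  into the inhomogeneity, so convergence rises in order without further smallness.\<close>

lemma ddir_eq: "(f has_derivative f') (at z) \<Longrightarrow> ddir e f z = f' e"
  unfolding ddir_def using frechet_derivative_at by metis

lemma has_derivative_ddir:
  "f differentiable (at z) \<Longrightarrow> (f has_derivative (\<lambda>e. ddir e f z)) (at z)"
  unfolding ddir_def using frechet_derivative_works by blast

lemma ddir_const [simp]: "ddir e (\<lambda>_. c) = (\<lambda>_. 0)"
  by (rule ext, rule ddir_eq[THEN trans], rule has_derivative_const) simp

lemma ddir_add_at:
  assumes "f differentiable (at z)" "g differentiable (at z)"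
  shows "ddir e (\<lambda>z. f z + g z) z = ddir e f z + ddir e g z"
  by (rule ddir_eq[THEN trans], rule has_derivative_add[OF has_derivative_ddir has_derivative_ddir, OF assms]) simp

lemma ddir_add:
  assumes "\<And>z. f differentiable (at z)" "\<And>z. g differentiable (at z)"
  shows "ddir e (\<lambda>z. f z + g z) = (\<lambda>z. ddir e f z + ddir e g z)"
  by (rule ext, rule ddir_add_at[OF assms])

lemma ddir_cmult:
  assumes "\<And>z. f differentiable (at z)"
  shows "ddir e (\<lambda>z. c * f z) = (\<lambda>z. c * ddir e f z)"
  by (rule ext, rule ddir_eq[THEN trans],
      rule has_derivative_mult_right[OF has_derivative_ddir, OF assms]) simp

lemma ddir_mult_at:
  assumes "f differentiable (at z)" "g differentiable (at z)"
  shows "ddir e (\<lambda>z. f z * g z) z = f z * ddir e g z + ddir e f z * g z"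
  by (rule ddir_eq[THEN trans],
      rule has_derivative_mult[OF has_derivative_ddir has_derivative_ddir, OF assms]) simp

lemma ddir_mult:
  assumes "\<And>z. f differentiable (at z)" "\<And>z. g differentiable (at z)"
  shows "ddir e (\<lambda>z. f z * g z) = (\<lambda>z. f z * ddir e g z + ddir e f z * g z)"
  by (rule ext, rule ddir_mult_at[OF assms])

lemma ddir_linear_at:
  fixes f :: "'a::euclidean_space \<Rightarrow> real"
  assumes "f differentiable (at z)"
  shows "ddir h f z = (\<Sum>b\<in>Basis. (h \<bullet> b) * ddir b f z)"
proof -
  interpret bounded_linear "\<lambda>h. ddir h f z"
    using has_derivative_ddir[OF assms] has_derivative_bounded_linear by blast
  have "ddir h f z = ddir (\<Sum>b\<in>Basis. (h \<bullet> b) *\<^sub>R b) f z" by (simp add: euclidean_representation)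
  also have "\<dots> = (\<Sum>b\<in>Basis. (h \<bullet> b) * ddir b f z)" by (simp add: sum scaleR)
  finally show ?thesis .
qed

text \<open>\<open>wcauchy k w f\<close> controls the derivatives of order at most \<open>k\<close> of a sequence relative to the weight
  \<open>w\<close>. Bounds are the case \<open>wbdd\<close> of constant sequences, so that one calculus serves for both. A weight
  may vanish on a region, which then encodes a support condition.\<close>

definition cauchy_wrt :: "('a::real_normed_vector \<Rightarrow> real) \<Rightarrow> (nat \<Rightarrow> 'a \<Rightarrow> real) \<Rightarrow> bool" where
  "cauchy_wrt w f \<longleftrightarrow> (\<forall>n. continuous_on UNIV (f n)) \<and> (\<exists>C. \<forall>n z. \<bar>f n z\<bar> \<le> C * w z) \<and>
     (\<forall>\<epsilon>>0. \<exists>N. \<forall>m\<ge>N. \<forall>n\<ge>N. \<forall>z. \<bar>f m z - f n z\<bar> \<le> \<epsilon> * w z)"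

primrec wcauchy :: "nat \<Rightarrow> ('a::real_normed_vector \<Rightarrow> real) \<Rightarrow> (nat \<Rightarrow> 'a \<Rightarrow> real) \<Rightarrow> bool" where
  "wcauchy 0 w f \<longleftrightarrow> cauchy_wrt w f"
| "wcauchy (Suc k) w f \<longleftrightarrow> cauchy_wrt w f \<and> (\<forall>n z. f n differentiable (at z)) \<and>
     (\<forall>e. wcauchy k w (\<lambda>n. ddir e (f n)))"

abbreviation wbdd :: "nat \<Rightarrow> ('a::real_normed_vector \<Rightarrow> real) \<Rightarrow> ('a \<Rightarrow> real) \<Rightarrow> bool" where
  "wbdd k w f \<equiv> wcauchy k w (\<lambda>_. f)"

section \<open>Algebra of weighted Cauchy sequences\<close>

lemma cauchy_wrt_bound:
  assumes "cauchy_wrt w f" "\<And>z. 0 \<le> w z"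
  obtains C where "C > 0" "\<And>n z. \<bar>f n z\<bar> \<le> C * w z"
proof -
  obtain C where C: "\<And>n z. \<bar>f n z\<bar> \<le> C * w z" using assms unfolding cauchy_wrt_def by blast
  have "\<bar>f n z\<bar> \<le> (\<bar>C\<bar> + 1) * w z" for n z
    by (rule order_trans[OF C]) (intro mult_right_mono, use assms in auto)
  then show ?thesis by (intro that[of "\<bar>C\<bar> + 1"]) auto
qed

lemma cauchy_wrt_const_bound:
  assumes "cauchy_wrt w (\<lambda>_. f)" "\<And>z. 0 \<le> w z"
  obtains C where "C > 0" "\<And>z. \<bar>f z\<bar> \<le> C * w z"
  by (rule cauchy_wrt_bound[OF assms]) (rule that, auto)

lemma cauchy_wrt_const:
  assumes "continuous_on UNIV f" "\<And>z. \<bar>f z\<bar> \<le> C * w z" "\<And>z. 0 \<le> w z"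
  shows "cauchy_wrt w (\<lambda>_. f)"
  using assms unfolding cauchy_wrt_def by auto

lemma wcauchy_imp_cauchy_wrt: "wcauchy k w f \<Longrightarrow> cauchy_wrt w f"
  by (cases k) auto

lemma wcauchy_SucD: "wcauchy (Suc k) w f \<Longrightarrow> wcauchy k w f"
proof (induction k arbitrary: f)
  case (Suc k)
  then show ?case by (metis wcauchy.simps(2))
qed simp

lemma wcauchy_le: "wcauchy k w f \<Longrightarrow> j \<le> k \<Longrightarrow> wcauchy j w f"
proof (induction k)
  case (Suc k)
  then show ?case using wcauchy_SucD le_Suc_eq by metis
qed simp

lemma wcauchy_diff: "wcauchy (Suc k) w f \<Longrightarrow> f n differentiable (at z)"
  by simp

lemma wcauchy_ddir: "wcauchy (Suc k) w f \<Longrightarrow> wcauchy k w (\<lambda>n. ddir e (f n))"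
  by simp

lemma wbdd_bound:
  assumes "wbdd k w f" "\<And>z. 0 \<le> w z"
  obtains C where "C > 0" "\<And>z. \<bar>f z\<bar> \<le> C * w z"
  by (rule cauchy_wrt_const_bound[OF wcauchy_imp_cauchy_wrt[OF assms(1)] assms(2)]) (rule that, auto)

lemma cauchy_wrt_nth:
  assumes "cauchy_wrt w f" "\<And>z. 0 \<le> w z"
  shows "cauchy_wrt w (\<lambda>_. f n)"
proof -
  obtain C where "\<And>n z. \<bar>f n z\<bar> \<le> C * w z" using assms unfolding cauchy_wrt_def by blast
  then show ?thesis by (intro cauchy_wrt_const[of _ C]) (use assms in \<open>auto simp: cauchy_wrt_def\<close>)
qed

lemma wbdd_of_wcauchy: "wcauchy k w f \<Longrightarrow> (\<And>z. 0 \<le> w z) \<Longrightarrow> wbdd k w (f n)"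
proof (induction k arbitrary: f)
  case 0
  then show ?case using cauchy_wrt_nth by auto
next
  case (Suc k)
  have "cauchy_wrt w (\<lambda>_. f n)" using cauchy_wrt_nth wcauchy_imp_cauchy_wrt[OF Suc.prems(1)] Suc.prems(2) by blast
  moreover have "wbdd k w (ddir e (f n))" for e
    using Suc.IH[of "\<lambda>n. ddir e (f n)"] Suc.prems by simp
  ultimately show ?case using Suc.prems by simp
qed

lemma cauchy_wrt_mono:
  assumes "cauchy_wrt w f" "\<And>z. 0 \<le> w z" "\<And>z. w z \<le> A * w' z" "A > 0"
  shows "cauchy_wrt w' f"
proof -
  obtain C where C: "C > 0" "\<And>n z. \<bar>f n z\<bar> \<le> C * w z" using cauchy_wrt_bound assms by metis
  have "\<bar>f n z\<bar> \<le> (C * A) * w' z" for n z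
    using order_trans[OF C(2) mult_left_mono[OF assms(3)]] C(1) by (simp add: mult.assoc)
  moreover have "\<exists>N. \<forall>m\<ge>N. \<forall>n\<ge>N. \<forall>z. \<bar>f m z - f n z\<bar> \<le> e * w' z" if "e > 0" for e
  proof -
    have "e / A > 0" using that assms by simp
    then obtain N where N: "\<forall>m\<ge>N. \<forall>n\<ge>N. \<forall>z. \<bar>f m z - f n z\<bar> \<le> e / A * w z"
      using assms(1) unfolding cauchy_wrt_def by blast
    have "e / A * w z \<le> e * w' z" for z
      using mult_left_mono[OF assms(3)[of z], of "e / A"] \<open>e / A > 0\<close> assms(4) by simp
    then show ?thesis using N order_trans by blast
  qed
  ultimately show ?thesis using assms(1) unfolding cauchy_wrt_def by blast
qed

lemma wcauchy_mono:
  assumes "wcauchy k w f" "\<And>z. 0 \<le> w z" "\<And>z. w z \<le> A * w' z" "A > 0"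
  shows "wcauchy k w' f"
  using assms(1)
proof (induction k arbitrary: f)
  case 0 then show ?case using cauchy_wrt_mono assms by auto
next
  case (Suc k) then show ?case using cauchy_wrt_mono[of w _ A w'] assms by auto
qed

lemma cauchy_wrt_add:
  assumes "cauchy_wrt w f" "cauchy_wrt w g"
  shows "cauchy_wrt w (\<lambda>n z. f n z + g n z)"
proof -
  obtain C D where CD: "\<And>n z. \<bar>f n z\<bar> \<le> C * w z" "\<And>n z. \<bar>g n z\<bar> \<le> D * w z"
    using assms unfolding cauchy_wrt_def by blast
  have "\<bar>f n z + g n z\<bar> \<le> (C + D) * w z" for n z
    using CD(1)[of n z] CD(2)[of n z] by (simp add: algebra_simps)
  moreover have "\<exists>N. \<forall>m\<ge>N. \<forall>n\<ge>N. \<forall>z. \<bar>(f m z + g m z) - (f n z + g n z)\<bar> \<le> e * w z" if "e > 0" for e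
  proof -
    have "e/2 > 0" using that by simp
    then obtain N M where N: "\<forall>m\<ge>N. \<forall>n\<ge>N. \<forall>z. \<bar>f m z - f n z\<bar> \<le> e/2 * w z"
      and M: "\<forall>m\<ge>M. \<forall>n\<ge>M. \<forall>z. \<bar>g m z - g n z\<bar> \<le> e/2 * w z"
      using assms unfolding cauchy_wrt_def by meson
    show ?thesis
    proof (intro exI[of _ "max N M"] allI impI)
      fix m n z assume mn: "max N M \<le> m" "max N M \<le> n"
      have "\<bar>f m z - f n z\<bar> \<le> e/2 * w z" "\<bar>g m z - g n z\<bar> \<le> e/2 * w z" using mn N M by auto
      then show "\<bar>(f m z + g m z) - (f n z + g n z)\<bar> \<le> e * w z" by linarith
    qed
  qed
  ultimately show ?thesis using assms unfolding cauchy_wrt_def by (blast intro: continuous_intros)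
qed

lemma wcauchy_add:
  "wcauchy k w f \<Longrightarrow> wcauchy k w g \<Longrightarrow> wcauchy k w (\<lambda>n z. f n z + g n z)"
proof (induction k arbitrary: f g)
  case 0 then show ?case using cauchy_wrt_add by auto
next
  case (Suc k)
  have "ddir e (\<lambda>z. f n z + g n z) = (\<lambda>z. ddir e (f n) z + ddir e (g n) z)" for e n
    using Suc by (intro ddir_add) auto
  then show ?case using Suc cauchy_wrt_add by auto
qed

lemma cauchy_wrt_mult:
  assumes "cauchy_wrt w f" "cauchy_wrt v g" "\<And>z. 0 \<le> w z" "\<And>z. 0 \<le> v z"
  shows "cauchy_wrt (\<lambda>z. w z * v z) (\<lambda>n z. f n z * g n z)"
proof -
  obtain C where C: "C > 0" "\<And>n z. \<bar>f n z\<bar> \<le> C * w z" using cauchy_wrt_bound assms by metis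
  obtain D where D: "D > 0" "\<And>n z. \<bar>g n z\<bar> \<le> D * v z" using cauchy_wrt_bound assms by metis
  have "\<bar>f n z * g n z\<bar> \<le> (C * D) * (w z * v z)" for n z
    using mult_mono[OF C(2)[of n z] D(2)[of n z]] C(1) assms(3)[of z] by (simp add: abs_mult mult_ac)
  moreover have "\<exists>N. \<forall>m\<ge>N. \<forall>n\<ge>N. \<forall>z. \<bar>f m z * g m z - f n z * g n z\<bar> \<le> e * (w z * v z)" if "e > 0" for e
  proof -
    have e: "e/(2*D) > 0" "e/(2*C) > 0" using that C D by auto
    then obtain N M where N: "\<forall>m\<ge>N. \<forall>n\<ge>N. \<forall>z. \<bar>f m z - f n z\<bar> \<le> e/(2*D) * w z"
      and M: "\<forall>m\<ge>M. \<forall>n\<ge>M. \<forall>z. \<bar>g m z - g n z\<bar> \<le> e/(2*C) * v z"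
      using assms unfolding cauchy_wrt_def by meson
    show ?thesis
    proof (intro exI[of _ "max N M"] allI impI)
      fix m n z assume mn: "max N M \<le> m" "max N M \<le> n"
      have f: "\<bar>f m z - f n z\<bar> \<le> e/(2*D) * w z" and g: "\<bar>g m z - g n z\<bar> \<le> e/(2*C) * v z" using mn N M by auto
      have "\<bar>(f m z - f n z) * g m z\<bar> \<le> (e/(2*D) * w z) * (D * v z)"
        unfolding abs_mult by (intro mult_mono f D mult_nonneg_nonneg order_less_imp_le[OF e(1)] assms) auto
      moreover have "\<bar>f n z * (g m z - g n z)\<bar> \<le> (C * w z) * (e/(2*C) * v z)"
        unfolding abs_mult by (intro mult_mono g C(2)) (use C assms in auto)
      moreover have "f m z * g m z - f n z * g n z = (f m z - f n z) * g m z + f n z * (g m z - g n z)"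
        by (simp add: algebra_simps)
      moreover have "(e/(2*D) * w z) * (D * v z) + (C * w z) * (e/(2*C) * v z) = e * (w z * v z)"
        using C(1) D(1) by (simp add: field_simps)
      ultimately show "\<bar>f m z * g m z - f n z * g n z\<bar> \<le> e * (w z * v z)" by linarith
    qed
  qed
  ultimately show ?thesis using assms unfolding cauchy_wrt_def by (blast intro: continuous_intros)
qed

lemma wcauchy_mult:
  assumes "wcauchy k w f" "wcauchy k v g" "\<And>z. 0 \<le> w z" "\<And>z. 0 \<le> v z"
  shows "wcauchy k (\<lambda>z. w z * v z) (\<lambda>n z. f n z * g n z)"
  using assms(1,2)
proof (induction k arbitrary: f g)
  case 0 then show ?case using cauchy_wrt_mult assms by auto
next
  case (Suc k)
  have "ddir e (\<lambda>z. f n z * g n z) = (\<lambda>z. f n z * ddir e (g n) z + ddir e (f n) z * g n z)" for e n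
    using Suc by (intro ddir_mult) auto
  moreover have "wcauchy k w f" "wcauchy k v g" using Suc.prems wcauchy_SucD by auto
  ultimately show ?case using Suc cauchy_wrt_mult[OF _ _ assms(3,4)] by (auto intro!: wcauchy_add)
qed

lemma wbdd_const: "wbdd k (\<lambda>_. 1) (\<lambda>_. c)"
proof (induction k arbitrary: c)
  case 0 show ?case unfolding wcauchy.simps by (rule cauchy_wrt_const[of _ "\<bar>c\<bar>"]) auto
next
  case (Suc k)
  have "cauchy_wrt (\<lambda>_. 1) (\<lambda>_ _. c)" by (rule cauchy_wrt_const[of _ "\<bar>c\<bar>"]) auto
  then show ?case using Suc by auto
qed

lemma wcauchy_cmult:
  assumes "wcauchy k w f" "\<And>z. 0 \<le> w z"
  shows "wcauchy k w (\<lambda>n z. c * f n z)"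
  using wcauchy_mult[OF wbdd_const assms(1), of c] assms(2) by simp

lemma wcauchy_minus:
  assumes "wcauchy k w f" "wcauchy k w g" "\<And>z. 0 \<le> w z"
  shows "wcauchy k w (\<lambda>n z. f n z - g n z)"
  using wcauchy_add[OF assms(1) wcauchy_cmult[OF assms(2), of "-1"]] assms(3) by simp

lemma wbdd_zero: "(\<And>z. 0 \<le> w z) \<Longrightarrow> wbdd k w (\<lambda>_. 0)"
proof (induction k)
  case 0 then show ?case by (auto simp: cauchy_wrt_def intro!: exI[of _ 0])
next
  case (Suc k)
  then have "cauchy_wrt w (\<lambda>_ _. 0)" by (auto simp: cauchy_wrt_def intro!: exI[of _ 0])
  with Suc show ?case by auto
qed

lemma wcauchy_sum:
  assumes "\<And>i. i \<in> I \<Longrightarrow> wcauchy k w (f i)" "\<And>z. 0 \<le> w z"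
  shows "wcauchy k w (\<lambda>n z. \<Sum>i\<in>I. f i n z)"
  using assms(1)
proof (induction I rule: infinite_finite_induct)
  case (insert x F)
  then show ?case by (auto intro!: wcauchy_add)
qed (auto intro!: wbdd_zero assms)

section \<open>Limits of weighted Cauchy sequences\<close>

lemma wcauchy_tendsto:
  assumes "cauchy_wrt w f"
  shows "(\<lambda>n. f n z) \<longlonglongrightarrow> lim (\<lambda>n. f n z)"
proof -
  have "Cauchy (\<lambda>n. f n z)"
  proof (rule metric_CauchyI)
    fix e :: real assume e: "e > 0"
    \<comment> \<open>The summand 1 keeps the quotient meaningful at points where the weight
      vanishes.\<close>
    then have "e / (\<bar>w z\<bar> + 1) > 0" by simp
    then obtain N where N: "\<forall>m\<ge>N. \<forall>n\<ge>N. \<forall>z'. \<bar>f m z' - f n z'\<bar> \<le> e / (\<bar>w z\<bar> + 1) * w z'"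
      using assms unfolding cauchy_wrt_def by blast
    have "e / (\<bar>w z\<bar> + 1) * w z < e" using e by (simp add: field_simps) (smt (verit) mult_nonneg_nonneg mult_left_mono abs_ge_self)
    then show "\<exists>M. \<forall>m\<ge>M. \<forall>n\<ge>M. dist (f m z) (f n z) < e"
      using N by (metis dist_real_def order.strict_trans1)
  qed
  then show ?thesis using real_Cauchy_convergent convergent_LIMSEQ_iff by blast
qed

lemma cauchy_wrt_lim_close:
  assumes "cauchy_wrt w f" "e > 0"
  shows "\<exists>N. \<forall>n\<ge>N. \<forall>z. \<bar>f n z - lim (\<lambda>n. f n z)\<bar> \<le> e * w z"
proof -
  obtain N where N: "\<forall>m\<ge>N. \<forall>n\<ge>N. \<forall>z. \<bar>f m z - f n z\<bar> \<le> e * w z"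
    using assms unfolding cauchy_wrt_def by blast
  show ?thesis
  proof (intro exI[of _ N] allI impI)
    fix n z assume "N \<le> n"
    then have "\<forall>m\<ge>N. \<bar>f n z - f m z\<bar> \<le> e * w z" using N by blast
    moreover have "(\<lambda>m. \<bar>f n z - f m z\<bar>) \<longlonglongrightarrow> \<bar>f n z - lim (\<lambda>n. f n z)\<bar>"
      by (intro tendsto_intros wcauchy_tendsto[OF assms(1)])
    ultimately show "\<bar>f n z - lim (\<lambda>n. f n z)\<bar> \<le> e * w z"
      by (meson LIMSEQ_le_const2)
  qed
qed

text \<open>Boundedness of the weight turns weighted convergence into uniform convergence, which is
  what carries continuity over to the limit.\<close>

lemma cauchy_wrt_lim:
  assumes f: "cauchy_wrt w f" and w: "\<And>z. 0 \<le> w z" "\<And>z. w z \<le> B"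
  shows "cauchy_wrt w (\<lambda>_ z. lim (\<lambda>n. f n z))"
proof -
  obtain C where C: "\<And>n z. \<bar>f n z\<bar> \<le> C * w z" using f unfolding cauchy_wrt_def by blast
  have "\<bar>lim (\<lambda>n. f n z)\<bar> \<le> C * w z" for z
    by (rule tendsto_upperbound[OF tendsto_rabs[OF wcauchy_tendsto[OF f]]]) (use C in auto)
  moreover have "continuous_on UNIV (\<lambda>z. lim (\<lambda>n. f n z))"
  proof (rule uniform_limit_theorem[of _ f sequentially])
    show "\<forall>\<^sub>F n in sequentially. continuous_on UNIV (f n)" using f unfolding cauchy_wrt_def by auto
    show "uniform_limit UNIV f (\<lambda>z. lim (\<lambda>n. f n z)) sequentially"
    proof (rule uniform_limitI)
      fix e :: real assume e: "e > 0"
      define d where "d = e / (\<bar>B\<bar> + 1)"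
      have "d > 0" using e unfolding d_def by simp
      from cauchy_wrt_lim_close[OF f this] obtain N
        where N: "\<forall>n\<ge>N. \<forall>z. \<bar>f n z - lim (\<lambda>n. f n z)\<bar> \<le> d * w z" by blast
      have "d * w z < e" for z
      proof -
        have "d * w z \<le> d * \<bar>B\<bar>" using w(2)[of z] \<open>d > 0\<close> by (intro mult_left_mono) auto
        also have "\<dots> < e" using e unfolding d_def by (simp add: field_simps)
        finally show ?thesis .
      qed
      then have "\<forall>n\<ge>N. \<forall>z. dist (f n z) (lim (\<lambda>n. f n z)) < e"
        using N by (metis dist_real_def order.strict_trans1)
      then show "\<forall>\<^sub>F n in sequentially. \<forall>z\<in>UNIV. dist (f n z) (lim (\<lambda>n. f n z)) < e"
        unfolding eventually_sequentially by blast
    qed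
  qed auto
  ultimately show ?thesis by (intro cauchy_wrt_const[of _ C]) (use w in auto)
qed

text \<open>Termwise differentiation requires the derivatives to converge uniformly in operator
  norm, whereas the hypotheses control each direction separately. Expansion in the finite basis
  bridges the two.\<close>

lemma has_derivative_lim:
  fixes f :: "nat \<Rightarrow> 'a::euclidean_space \<Rightarrow> real"
  assumes f: "cauchy_wrt w f" "\<And>n z. f n differentiable (at z)"
    and d: "\<And>e. cauchy_wrt w (\<lambda>n. ddir e (f n))"
    and w: "\<And>z. 0 \<le> w z" "\<And>z. w z \<le> B"
  shows "((\<lambda>z. lim (\<lambda>n. f n z)) has_derivative (\<lambda>h. \<Sum>b\<in>Basis. (h \<bullet> b) * lim (\<lambda>n. ddir b (f n) z))) (at z)"
proof -
  define g' where "g' = (\<lambda>z h. \<Sum>b\<in>Basis. (h \<bullet> b) * lim (\<lambda>n. ddir b (f n) z))"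
  note lin = ddir_linear_at[OF f(2)]
  have "\<exists>g. \<forall>x\<in>UNIV. (\<lambda>n. f n x) \<longlonglongrightarrow> g x \<and> (g has_derivative g' x) (at x within UNIV)"
  proof (rule has_derivative_sequence[where f' = "\<lambda>n z h. ddir h (f n) z", OF convex_UNIV _ _ UNIV_I wcauchy_tendsto[OF f(1)]])
    fix e :: real assume e: "e > 0"
    \<comment> \<open>The dimension counts the basis directions and \<open>\<bar>B\<bar> + 1\<close>
      absorbs the weight, so that the errors add up to \<open>e * norm h\<close>.\<close>
    define d where "d = e / (DIM('a) * (\<bar>B\<bar> + 1))"
    have "d > 0" using e unfolding d_def by simp
    have "\<forall>\<^sub>F n in sequentially. \<forall>b\<in>Basis. \<forall>z. \<bar>ddir b (f n) z - lim (\<lambda>n. ddir b (f n) z)\<bar> \<le> d * w z"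
    proof (rule eventually_ball_finite)
      show "\<forall>b\<in>Basis. \<forall>\<^sub>F n in sequentially. \<forall>z. \<bar>ddir b (f n) z - lim (\<lambda>n. ddir b (f n) z)\<bar> \<le> d * w z"
        using cauchy_wrt_lim_close[OF assms(3) \<open>d > 0\<close>] unfolding eventually_sequentially by blast
    qed simp
    then show "\<forall>\<^sub>F n in sequentially. \<forall>x\<in>UNIV. \<forall>h. norm (ddir h (f n) x - g' x h) \<le> e * norm h"
    proof eventually_elim
      fix n assume *: "\<forall>b\<in>Basis. \<forall>z. \<bar>ddir b (f n) z - lim (\<lambda>n. ddir b (f n) z)\<bar> \<le> d * w z"
      show "\<forall>x\<in>UNIV. \<forall>h. norm (ddir h (f n) x - g' x h) \<le> e * norm h"
      proof (intro ballI allI)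
        fix x h
        have "norm (ddir h (f n) x - g' x h) = norm (\<Sum>b\<in>Basis. (h \<bullet> b) * (ddir b (f n) x - lim (\<lambda>n. ddir b (f n) x)))"
          unfolding lin[of h] g'_def by (simp add: sum_subtractf right_diff_distrib)
        also have "\<dots> \<le> (\<Sum>b\<in>(Basis::'a set). norm h * (d * (\<bar>B\<bar> + 1)))"
        proof (rule sum_norm_le)
          fix b :: 'a assume b: "b \<in> Basis"
          have "d * w x \<le> d * (\<bar>B\<bar> + 1)" using w(2)[of x] \<open>d > 0\<close> by (intro mult_left_mono) auto
          then have "\<bar>ddir b (f n) x - lim (\<lambda>n. ddir b (f n) x)\<bar> \<le> d * (\<bar>B\<bar> + 1)" using * b order_trans by blast
          then show "norm ((h \<bullet> b) * (ddir b (f n) x - lim (\<lambda>n. ddir b (f n) x))) \<le> norm h * (d * (\<bar>B\<bar> + 1))"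
            unfolding real_norm_def abs_mult by (intro mult_mono Basis_le_norm b) auto
        qed
        also have "\<dots> = e * norm h" unfolding d_def by simp
        finally show "norm (ddir h (f n) x - g' x h) \<le> e * norm h" .
      qed
    qed
  qed (use has_derivative_ddir[OF f(2)] in auto)
  then obtain g where g: "\<And>x. (\<lambda>n. f n x) \<longlonglongrightarrow> g x" "\<And>x. (g has_derivative g' x) (at x)" by auto
  have "g = (\<lambda>z. lim (\<lambda>n. f n z))" by (rule ext, rule limI[OF g(1), symmetric])
  then show ?thesis using g(2) unfolding g'_def by simp
qed

lemma ddir_lim:
  fixes f :: "nat \<Rightarrow> 'a::euclidean_space \<Rightarrow> real"
  assumes f: "cauchy_wrt w f" "\<And>n z. f n differentiable (at z)"
    and d: "\<And>e. cauchy_wrt w (\<lambda>n. ddir e (f n))"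
    and w: "\<And>z. 0 \<le> w z" "\<And>z. w z \<le> B"
  shows "ddir e (\<lambda>z. lim (\<lambda>n. f n z)) = (\<lambda>z. lim (\<lambda>n. ddir e (f n) z))"
proof
  fix z
  have "ddir e (\<lambda>z. lim (\<lambda>n. f n z)) z = (\<Sum>b\<in>Basis. (e \<bullet> b) * lim (\<lambda>n. ddir b (f n) z))"
    by (rule ddir_eq[OF has_derivative_lim[OF assms]])
  also have "(\<lambda>n. \<Sum>b\<in>Basis. (e \<bullet> b) * ddir b (f n) z) \<longlonglongrightarrow> \<dots>"
    by (intro tendsto_intros wcauchy_tendsto[OF d])
  moreover have "(\<Sum>b\<in>Basis. (e \<bullet> b) * ddir b (f n) z) = ddir e (f n) z" for n
    by (rule ddir_linear_at[OF f(2), symmetric])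
  ultimately show "ddir e (\<lambda>z. lim (\<lambda>n. f n z)) z = lim (\<lambda>n. ddir e (f n) z)"
    using limI by fastforce
qed

lemma wcauchy_lim:
  fixes f :: "nat \<Rightarrow> 'a::euclidean_space \<Rightarrow> real"
  assumes "wcauchy k w f" and w: "\<And>z. 0 \<le> w z" "\<And>z. w z \<le> B"
  shows "wbdd k w (\<lambda>z. lim (\<lambda>n. f n z))"
  using assms(1)
proof (induction k arbitrary: f)
  case 0 then show ?case using cauchy_wrt_lim w by auto
next
  case (Suc k)
  have *: "cauchy_wrt w f" "\<And>n z. f n differentiable (at z)" "\<And>e. wcauchy k w (\<lambda>n. ddir e (f n))"
    using Suc.prems by auto
  note ** = wcauchy_imp_cauchy_wrt[OF *(3)]
  have "(\<lambda>z. lim (\<lambda>n. f n z)) differentiable (at z)" for z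
    using has_derivative_lim[OF *(1,2) ** w] differentiable_def by blast
  moreover have "wbdd k w (ddir e (\<lambda>z. lim (\<lambda>n. f n z)))" for e
    unfolding ddir_lim[OF *(1,2) ** w] by (rule Suc.IH[OF *(3)])
  ultimately show ?case using cauchy_wrt_lim[OF *(1) w] by auto
qed

section \<open>Chain rule, locality and symmetry of second derivatives\<close>

lemma ddir_compose_at:
  fixes f :: "'a::euclidean_space \<Rightarrow> real" and L :: "'b::real_normed_vector \<Rightarrow> 'a"
  assumes "f differentiable (at (L z))" "L differentiable (at z)"
  shows "ddir e (\<lambda>z. f (L z)) z = (\<Sum>b\<in>Basis. ddir b f (L z) * ddir e (\<lambda>z. L z \<bullet> b) z)"
proof -
  obtain L' where L': "(L has_derivative L') (at z)" using assms(2) differentiable_def by blast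
  have "ddir e (\<lambda>z. f (L z)) z = ddir (L' e) f (L z)"
    by (rule ddir_eq[OF has_derivative_compose[OF L' has_derivative_ddir[OF assms(1)]]])
  also have "\<dots> = (\<Sum>b\<in>Basis. (L' e \<bullet> b) * ddir b f (L z))" by (rule ddir_linear_at[OF assms(1)])
  also have "\<dots> = (\<Sum>b\<in>Basis. ddir b f (L z) * ddir e (\<lambda>z. L z \<bullet> b) z)"
  proof (intro sum.cong refl)
    fix b :: 'a assume "b \<in> Basis"
    have "ddir e (\<lambda>z. L z \<bullet> b) z = L' e \<bullet> b"
      by (rule ddir_eq[OF has_derivative_inner_left[OF L']])
    then show "(L' e \<bullet> b) * ddir b f (L z) = ddir b f (L z) * ddir e (\<lambda>z. L z \<bullet> b) z" by simp
  qed
  finally show ?thesis .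
qed

text \<open>Only the derivatives of the components of \<open>L\<close> enter the chain rule, so
  \<open>L\<close> may be unbounded. This matters for \<open>scri_map\<close> and for the arguments
  of the cutoffs, which grow linearly.\<close>

lemma wbdd_compose:
  fixes f :: "'a::euclidean_space \<Rightarrow> real" and L :: "'b::real_normed_vector \<Rightarrow> 'a"
  assumes "wbdd k w f" "\<And>z. 0 \<le> w z"
    and L: "\<And>z. L differentiable (at z)" "\<And>b e. b \<in> Basis \<Longrightarrow> wbdd k (\<lambda>_. 1) (ddir e (\<lambda>z. L z \<bullet> b))"
  shows "wbdd k (\<lambda>z. w (L z)) (\<lambda>z. f (L z))"
proof -
  have contL: "continuous_on UNIV L" using L(1) differentiable_imp_continuous_on
    by (metis differentiable_at_imp_differentiable_on)
  have base: "cauchy_wrt (\<lambda>z. w (L z)) (\<lambda>_ z. g (L z))" if g: "cauchy_wrt w (\<lambda>_. g)" for g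
  proof -
    obtain C where C: "C > 0" "\<And>z. \<bar>g z\<bar> \<le> C * w z" by (rule cauchy_wrt_const_bound[OF g assms(2)]) auto
    have "continuous_on UNIV (\<lambda>z. g (L z))"
      by (rule continuous_on_compose2[OF _ contL]) (use g in \<open>auto simp: cauchy_wrt_def\<close>)
    then show ?thesis by (intro cauchy_wrt_const[of _ C]) (use assms C in auto)
  qed
  \<comment> \<open>The order demanded of \<open>g\<close> decreases in the induction, while the
    bounds on \<open>L\<close> stay available at the full order \<open>k\<close>.\<close>
  have "j \<le> k \<Longrightarrow> wbdd j w g \<Longrightarrow> wbdd j (\<lambda>z. w (L z)) (\<lambda>z. g (L z))" for j g
  proof (induction j arbitrary: g)
    case 0 then show ?case using base by auto
  next
    case (Suc j)
    have g: "\<And>z. g differentiable (at z)" using Suc.prems by auto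
    have "ddir e (\<lambda>z. g (L z)) = (\<lambda>z. \<Sum>b\<in>Basis. ddir b g (L z) * ddir e (\<lambda>z. L z \<bullet> b) z)" for e
      by (rule ext, rule ddir_compose_at[OF g L(1)])
    moreover have "wbdd j (\<lambda>z. w (L z)) (\<lambda>z. ddir b g (L z) * ddir e (\<lambda>z. L z \<bullet> b) z)" if b: "b \<in> Basis" for b e
      using wcauchy_mult[OF Suc.IH wcauchy_le[OF L(2)[OF b]], of "ddir b g" e] Suc.prems assms(2) by auto
    moreover have "(\<lambda>z. g (L z)) differentiable (at z)" for z
      using differentiable_compose[OF g L(1)] by simp
    moreover have "cauchy_wrt (\<lambda>z. w (L z)) (\<lambda>_ z. g (L z))"
      by (rule base[OF wcauchy_imp_cauchy_wrt[OF Suc.prems(2)]])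
    ultimately show ?case
      unfolding wcauchy.simps by (intro conjI allI) (simp_all, intro wcauchy_sum assms(2), simp)
  qed
  then show ?thesis using assms(1) by auto
qed

text \<open>\<open>frechet_derivative\<close> selects one of the linear maps that are derivatives at
  the point. Functions that agree near the point have the same derivatives there, so the selected
  maps agree, even if there is no derivative at all.\<close>

lemma ddir_cong_open:
  assumes "open V" "z \<in> V" "\<And>y. y \<in> V \<Longrightarrow> f y = g y"
  shows "ddir e f z = ddir e g z"
proof -
  have "(f has_derivative f') (at z) \<longleftrightarrow> (g has_derivative f') (at z)" for f'
    using has_derivative_transform_within_open[of _ _ z UNIV V] assms by metis
  then show ?thesis unfolding ddir_def frechet_derivative_def by simp
qed

text \<open>Both mixed derivatives are limits of the same second difference quotient, which is
  symmetric in the two directions.\<close>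

lemma ddir_mixed:
  fixes f :: "'a::euclidean_space \<Rightarrow> real"
  assumes f: "\<And>z. f differentiable (at z)"
    and d: "\<And>e z. ddir e f differentiable (at z)"
    and c: "\<And>e e'. continuous_on UNIV (ddir e (ddir e' f))"
  shows "ddir a (ddir b f) z = ddir b (ddir a f) z"
proof -
  have line: "((\<lambda>s. g (p + s *\<^sub>R e)) has_real_derivative ddir e g (p + s *\<^sub>R e)) (at s)"
    if "\<And>z. g differentiable (at z)" for g :: "'a \<Rightarrow> real" and p e s
  proof -
    have "((\<lambda>s. p + s *\<^sub>R e) has_derivative (\<lambda>h. h *\<^sub>R e)) (at s)"
      by (auto intro!: derivative_eq_intros)
    from has_derivative_compose[OF this has_derivative_ddir[OF that]]
    have "((\<lambda>s. g (p + s *\<^sub>R e)) has_derivative (\<lambda>h. ddir (h *\<^sub>R e) g (p + s *\<^sub>R e))) (at s)" .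
    moreover have "ddir (h *\<^sub>R e) g q = ddir e g q * h" for h q
    proof -
      interpret bounded_linear "\<lambda>h. ddir h g q"
        using has_derivative_ddir[OF that] has_derivative_bounded_linear by blast
      show ?thesis by (simp add: scaleR)
    qed
    ultimately show ?thesis unfolding has_field_derivative_def by (simp add: mult_commute_abs)
  qed
  \<comment> \<open>The mean value theorem is used twice: along \<open>a\<close> for the difference
    of two values displaced by \<open>h\<close> in direction \<open>b\<close>, then along
    \<open>b\<close> for the derivative in direction \<open>a\<close>.\<close>
  have mv: "\<exists>s\<in>{0<..<h}. \<exists>t\<in>{0<..<h}. f (z + h *\<^sub>R a + h *\<^sub>R b) - f (z + h *\<^sub>R a) - f (z + h *\<^sub>R b) + f z
      = h * h * ddir b (ddir a f) (z + s *\<^sub>R a + t *\<^sub>R b)" if h: "h > 0" for h a b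
  proof -
    define \<phi> where "\<phi> s = f ((z + h *\<^sub>R b) + s *\<^sub>R a) - f (z + s *\<^sub>R a)" for s
    have "(\<phi> has_real_derivative (ddir a f ((z + h *\<^sub>R b) + s *\<^sub>R a) - ddir a f (z + s *\<^sub>R a))) (at s)" for s
      unfolding \<phi>_def by (intro derivative_intros line f)
    then obtain s where s: "s > 0" "s < h" "\<phi> h - \<phi> 0 = (h - 0) * (ddir a f ((z + h *\<^sub>R b) + s *\<^sub>R a) - ddir a f (z + s *\<^sub>R a))"
      using MVT2[OF h, of \<phi> "\<lambda>s. ddir a f ((z + h *\<^sub>R b) + s *\<^sub>R a) - ddir a f (z + s *\<^sub>R a)"] by blast
    define \<psi> where "\<psi> t = ddir a f ((z + s *\<^sub>R a) + t *\<^sub>R b)" for t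
    have "(\<psi> has_real_derivative (ddir b (ddir a f) ((z + s *\<^sub>R a) + t *\<^sub>R b))) (at t)" for t
      unfolding \<psi>_def by (intro line d)
    then obtain t where t: "t > 0" "t < h" "\<psi> h - \<psi> 0 = (h - 0) * ddir b (ddir a f) ((z + s *\<^sub>R a) + t *\<^sub>R b)"
      using MVT2[OF h, of \<psi> "\<lambda>t. ddir b (ddir a f) ((z + s *\<^sub>R a) + t *\<^sub>R b)"] by blast
    have "\<phi> h - \<phi> 0 = h * (\<psi> h - \<psi> 0)" using s(3) unfolding \<psi>_def by (simp add: algebra_simps)
    then show ?thesis using s t unfolding \<phi>_def
      by (intro bexI[of _ s] bexI[of _ t]) (auto simp: algebra_simps)
  qed
  have close: "\<exists>\<delta>>0. \<forall>s t. \<bar>s\<bar> < \<delta> \<longrightarrow> \<bar>t\<bar> < \<delta> \<longrightarrow> \<bar>ddir b (ddir a f) (z + s *\<^sub>R a + t *\<^sub>R b) - ddir b (ddir a f) z\<bar> < e" if "e > 0" for e a b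
  proof -
    obtain d where d: "d > 0" "\<And>y. dist y z < d \<Longrightarrow> \<bar>ddir b (ddir a f) y - ddir b (ddir a f) z\<bar> < e"
      using c[of b a] \<open>e > 0\<close> unfolding continuous_on_iff dist_real_def by (metis UNIV_I)
    \<comment> \<open>Both increments contribute to the distance from \<open>z\<close>; the extra 1
      in the denominator covers the case that both directions vanish.\<close>
    show ?thesis
    proof (intro exI[of _ "d / (norm a + norm b + 1)"] conjI allI impI d(2))
      show "d / (norm a + norm b + 1) > 0" using d(1) by (simp add: add_nonneg_pos)
      fix s t assume st: "\<bar>s\<bar> < d / (norm a + norm b + 1)" "\<bar>t\<bar> < d / (norm a + norm b + 1)"
      have "dist (z + s *\<^sub>R a + t *\<^sub>R b) z \<le> \<bar>s\<bar> * norm a + \<bar>t\<bar> * norm b"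
        by (simp add: dist_norm add.assoc) (metis norm_scaleR norm_triangle_ineq)
      also have "\<dots> \<le> d / (norm a + norm b + 1) * norm a + d / (norm a + norm b + 1) * norm b"
        using st by (intro add_mono mult_right_mono) auto
      also have "\<dots> = d * ((norm a + norm b) / (norm a + norm b + 1))" by (simp add: add_divide_distrib algebra_simps)
      also have "\<dots> < d"
      proof -
        have "(norm a + norm b) / (norm a + norm b + 1) < 1" by (smt (verit) norm_ge_zero divide_less_eq_1)
        from mult_strict_left_mono[OF this d(1)] show ?thesis by simp
      qed
      finally show "dist (z + s *\<^sub>R a + t *\<^sub>R b) z < d" .
    qed
  qed
  show ?thesis
  proof (rule ccontr)
    assume ne: "ddir a (ddir b f) z \<noteq> ddir b (ddir a f) z"
    define e where "e = \<bar>ddir a (ddir b f) z - ddir b (ddir a f) z\<bar> / 2"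
    have "e > 0" using ne unfolding e_def by simp
    obtain d1 where d1: "d1 > 0" "\<And>s t. \<bar>s\<bar> < d1 \<Longrightarrow> \<bar>t\<bar> < d1 \<Longrightarrow> \<bar>ddir b (ddir a f) (z + s *\<^sub>R a + t *\<^sub>R b) - ddir b (ddir a f) z\<bar> < e"
      using close[OF \<open>e > 0\<close>, of b a] by blast
    obtain d2 where d2: "d2 > 0" "\<And>s t. \<bar>s\<bar> < d2 \<Longrightarrow> \<bar>t\<bar> < d2 \<Longrightarrow> \<bar>ddir a (ddir b f) (z + s *\<^sub>R b + t *\<^sub>R a) - ddir a (ddir b f) z\<bar> < e"
      using close[OF \<open>e > 0\<close>, of a b] by blast
    define h where "h = min d1 d2 / 2"
    have h: "h > 0" "h < d1" "h < d2" using d1(1) d2(1) unfolding h_def by auto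
    obtain s t where 1: "s \<in> {0<..<h}" "t \<in> {0<..<h}" "f (z + h *\<^sub>R a + h *\<^sub>R b) - f (z + h *\<^sub>R a) - f (z + h *\<^sub>R b) + f z
      = h * h * ddir b (ddir a f) (z + s *\<^sub>R a + t *\<^sub>R b)" using mv[OF h(1), of a b] by blast
    obtain s' t' where 2: "s' \<in> {0<..<h}" "t' \<in> {0<..<h}" "f (z + h *\<^sub>R b + h *\<^sub>R a) - f (z + h *\<^sub>R b) - f (z + h *\<^sub>R a) + f z
      = h * h * ddir a (ddir b f) (z + s' *\<^sub>R b + t' *\<^sub>R a)" using mv[OF h(1), of b a] by blast
    have "z + h *\<^sub>R b + h *\<^sub>R a = z + h *\<^sub>R a + h *\<^sub>R b" by simp
    then have "h * h * ddir b (ddir a f) (z + s *\<^sub>R a + t *\<^sub>R b) = h * h * ddir a (ddir b f) (z + s' *\<^sub>R b + t' *\<^sub>R a)"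
      using 1(3) 2(3) by (metis (no_types, lifting) diff_diff_add add.commute)
    then have "ddir b (ddir a f) (z + s *\<^sub>R a + t *\<^sub>R b) = ddir a (ddir b f) (z + s' *\<^sub>R b + t' *\<^sub>R a)"
      using h by simp
    moreover have "\<bar>ddir b (ddir a f) (z + s *\<^sub>R a + t *\<^sub>R b) - ddir b (ddir a f) z\<bar> < e"
      using 1 h by (intro d1) auto
    moreover have "\<bar>ddir a (ddir b f) (z + s' *\<^sub>R b + t' *\<^sub>R a) - ddir a (ddir b f) z\<bar> < e"
      using 2 h by (intro d2) auto
    ultimately show False unfolding e_def by (smt (verit) field_sum_of_halves)
  qed
qed

section \<open>Integration over the light cone\<close>

lemma borel_measure_eqI_atMost:
  fixes M N :: "real measure"
  assumes "sets M = sets borel" "sets N = sets borel"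
    and eq: "\<And>a. emeasure M {..a} = emeasure N {..a}" and fin: "\<And>a. emeasure M {..a} \<noteq> \<infinity>"
  shows "M = N"
proof (rule measure_eqI_generator_eq[where E = "range atMost" and \<Omega> = UNIV and A = "\<lambda>n. {..real n}"])
  show "Int_stable (range (atMost :: real \<Rightarrow> _))"
  proof (rule Int_stableI)
    fix a b :: "real set" assume "a \<in> range atMost" "b \<in> range atMost"
    then obtain x y where "a = {..x}" "b = {..y}" by blast
    then have "a \<inter> b = {..min x y}" by auto
    then show "a \<inter> b \<in> range atMost" by blast
  qed
  have "sets (borel :: real measure) = sigma_sets UNIV (range atMost)"
    unfolding borel_eq_atMost by (rule sets_measure_of) auto
  then show "sets M = sigma_sets UNIV (range atMost)" "sets N = sigma_sets UNIV (range atMost)"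
    using assms(1,2) by auto
  show "(\<Union>i. {..real i}) = UNIV" by (auto intro: real_arch_simple)
qed (use eq fin in auto)

text \<open>The substitution \<open>m = \<rho> ^ 2\<close> in the form of an image measure, obtained
  by comparing distribution functions: both sides give the half line up to \<open>a\<close> the mass
  \<open>max 0 a\<close>.\<close>

lemma distr_square_density:
  "distr (density lborel (\<lambda>\<rho>::real. ennreal (2 * \<rho>) * indicator {0..} \<rho>)) borel (\<lambda>\<rho>. \<rho>\<^sup>2)
    = density lborel (indicator {0..})" (is "?M = ?N")
proof (rule borel_measure_eqI_atMost)
  have N: "emeasure ?N {..a} = ennreal (max 0 a)" for a
  proof -
    have "emeasure ?N {..a} = (\<integral>\<^sup>+x. indicator {0..} x * indicator {..a} x \<partial>lborel)"
      by (rule emeasure_density) auto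
    also have "\<dots> = (\<integral>\<^sup>+x. indicator {0..a} x \<partial>lborel)"
      by (intro nn_integral_cong) (auto split: split_indicator)
    finally show ?thesis by (auto simp: max_def)
  qed
  have "emeasure ?M {..a} = ennreal (max 0 a)" for a
  proof (cases "a < 0")
    case True
    then have "(\<lambda>\<rho>::real. \<rho>\<^sup>2) -` {..a} = {}" by (auto simp: not_le) (smt (verit) zero_le_power2)
    then show ?thesis using True by (simp add: emeasure_distr)
  next
    case False
    have "emeasure ?M {..a} = emeasure (density lborel (\<lambda>\<rho>::real. ennreal (2 * \<rho>) * indicator {0..} \<rho>)) ((\<lambda>\<rho>. \<rho>\<^sup>2) -` {..a})"
      by (subst emeasure_distr) auto
    also have "\<dots> = (\<integral>\<^sup>+\<rho>. (ennreal (2 * \<rho>) * indicator {0..} \<rho>) * indicator ((\<lambda>\<rho>. \<rho>\<^sup>2) -` {..a}) \<rho> \<partial>lborel)"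
      by (rule emeasure_density) (auto intro!: measurable_sets_borel[of _ borel])
    also have "\<dots> = (\<integral>\<^sup>+\<rho>. ennreal (2 * \<rho>) * indicator {0..sqrt a} \<rho> \<partial>lborel)"
    proof (intro nn_integral_cong)
      fix \<rho> :: real
      have "\<rho>\<^sup>2 \<le> a \<longleftrightarrow> \<rho> \<le> sqrt a" if "\<rho> \<ge> 0"
        using that by (metis real_sqrt_le_iff real_sqrt_unique)
      then show "(ennreal (2 * \<rho>) * indicator {0..} \<rho>) * indicator ((\<lambda>\<rho>. \<rho>\<^sup>2) -` {..a}) \<rho> = ennreal (2 * \<rho>) * indicator {0..sqrt a} \<rho>"
        by (auto split: split_indicator)
    qed
    also have "\<dots> = ennreal ((sqrt a)\<^sup>2 - 0\<^sup>2)"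
      using False by (intro nn_integral_FTC_Icc[where F = "\<lambda>\<rho>. \<rho>\<^sup>2"]) (auto intro!: derivative_eq_intros)
    finally show ?thesis using False by simp
  qed
  then show "emeasure ?M {..a} = emeasure ?N {..a}" "emeasure ?M {..a} \<noteq> \<infinity>" for a
    using N by auto
qed auto

lemma nn_integral_square:
  assumes [measurable]: "f \<in> borel_measurable borel"
  shows "(\<integral>\<^sup>+m. indicator {0..} m * f m \<partial>lborel) = (\<integral>\<^sup>+\<rho>. ennreal (2 * \<rho>) * indicator {0..} \<rho> * f (\<rho>\<^sup>2) \<partial>lborel)"
proof -
  have "(\<integral>\<^sup>+m. indicator {0..} m * f m \<partial>lborel) = (\<integral>\<^sup>+m. f m \<partial>density lborel (indicator {0..}))"
    by (simp add: nn_integral_density)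
  also have "\<dots> = (\<integral>\<^sup>+\<rho>. f (\<rho>\<^sup>2) \<partial>density lborel (\<lambda>\<rho>. ennreal (2 * \<rho>) * indicator {0..} \<rho>))"
    unfolding distr_square_density[symmetric] by (simp add: nn_integral_distr)
  also have "\<dots> = (\<integral>\<^sup>+\<rho>. ennreal (2 * \<rho>) * indicator {0..} \<rho> * f (\<rho>\<^sup>2) \<partial>lborel)"
    by (simp add: nn_integral_density)
  finally show ?thesis .
qed

text \<open>A disc of radius \<open>sqrt a\<close> has area \<open>pi * a\<close>, which is linear
  in \<open>a\<close>; hence the squared modulus has constant density. All explicit integrals over
  three-dimensional space below come from this.\<close>

lemma distr_norm_square_complex:
  "distr lborel borel (\<lambda>z::complex. (norm z)\<^sup>2) = density lborel (\<lambda>m. ennreal pi * indicator {0..} m)" (is "?M = ?N")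
proof (rule borel_measure_eqI_atMost)
  have N: "emeasure ?N {..a} = ennreal (pi * max 0 a)" for a
  proof -
    have "emeasure ?N {..a} = (\<integral>\<^sup>+x. ennreal pi * indicator {0..a} x \<partial>lborel)"
      by (subst emeasure_density) (auto intro!: nn_integral_cong split: split_indicator)
    then show ?thesis by (auto simp: max_def nn_integral_cmult ennreal_mult')
  qed
  have "emeasure ?M {..a} = ennreal (pi * max 0 a)" for a
  proof (cases "a < 0")
    case True
    then have "(\<lambda>z::complex. (norm z)\<^sup>2) -` {..a} = {}" by (auto simp: not_le) (smt (verit) zero_le_power2)
    then show ?thesis using True by (simp add: emeasure_distr)
  next
    case False
    have "emeasure ?M {..a} = emeasure lborel ((\<lambda>z::complex. (norm z)\<^sup>2) -` {..a})"
      by (subst emeasure_distr) auto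
    also have "(\<lambda>z::complex. (norm z)\<^sup>2) -` {..a} = cball 0 (sqrt a)"
    proof -
      have "(cmod z)\<^sup>2 \<le> a \<longleftrightarrow> cmod z \<le> sqrt a" for z
        by (metis real_sqrt_le_iff real_sqrt_abs abs_norm_cancel)
      then show ?thesis by auto
    qed
    also have "emeasure lborel \<dots> = ennreal (pi * max 0 a)"
      using False by (subst emeasure_cball) (auto simp: eval_unit_ball_vol)
    finally show ?thesis .
  qed
  then show "emeasure ?M {..a} = emeasure ?N {..a}" "emeasure ?M {..a} \<noteq> \<infinity>" for a
    using N by auto
qed auto

lemma nn_integral_norm_square_complex:
  assumes [measurable]: "f \<in> borel_measurable borel"
  shows "(\<integral>\<^sup>+z. f ((norm (z::complex))\<^sup>2) \<partial>lborel) = ennreal pi * (\<integral>\<^sup>+m. indicator {0..} m * f m \<partial>lborel)"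
proof -
  have "(\<integral>\<^sup>+z. f ((norm (z::complex))\<^sup>2) \<partial>lborel) = (\<integral>\<^sup>+m. f m \<partial>distr lborel borel (\<lambda>z::complex. (norm z)\<^sup>2))"
    by (simp add: nn_integral_distr)
  also have "\<dots> = ennreal pi * (\<integral>\<^sup>+m. indicator {0..} m * f m \<partial>lborel)"
    unfolding distr_norm_square_complex by (simp add: nn_integral_density nn_integral_cmult mult.assoc)
  finally show ?thesis .
qed

lemma distr_orthogonal_lborel:
  fixes T :: "real ^ 3 \<Rightarrow> real ^ 3"
  assumes T: "orthogonal_transformation T"
  shows "distr lborel borel T = lborel"
proof (rule lborel_eqI[symmetric])
  fix l u :: "real ^ 3" assume lu: "\<And>b. b \<in> Basis \<Longrightarrow> l \<bullet> b \<le> u \<bullet> b"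
  have Tb: "T \<in> borel_measurable borel"
    using T orthogonal_transformation_linear linear_continuous_on linear_linear
    by (intro borel_measurable_continuous_onI) (blast intro: linear_continuous_on)
  have "bij T" using T orthogonal_transformation_bij by blast
  have o: "orthogonal_transformation (inv T)" using T orthogonal_transformation_inv by blast
  have e: "T -` box l u = inv T ` box l u" using \<open>bij T\<close> by (simp add: bij_vimage_eq_inv_image)
  have m: "inv T ` box l u \<in> lmeasurable" "measure lebesgue (inv T ` box l u) = measure lebesgue (box l u)"
    using measurable_orthogonal_image[OF o lmeasurable_box] measure_orthogonal_image[OF o lmeasurable_box] by auto
  have s: "T -` box l u \<in> sets borel" using measurable_sets_borel[OF Tb] by simp
  have "emeasure (distr lborel borel T) (box l u) = emeasure lborel (T -` box l u)"
    using Tb by (subst emeasure_distr) auto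
  also have "\<dots> = emeasure lebesgue (T -` box l u)" using s by simp
  also have "\<dots> = ennreal (measure lebesgue (box l u))"
    using m unfolding e by (metis emeasure_eq_measure2)
  also have "\<dots> = (\<Prod>b\<in>Basis. (u - l) \<bullet> b)" using lu by (simp add: inner_diff_left)
  finally show "emeasure (distr lborel borel T) (box l u) = (\<Prod>b\<in>Basis. (u - l) \<bullet> b)" .
qed simp

text \<open>Splits space into a horizontal plane, treated as the complex numbers so that areas of
  discs can be used, and a vertical axis.\<close>

definition vec_of_complex_real :: "complex \<times> real \<Rightarrow> real ^ 3" where
  "vec_of_complex_real = (\<lambda>(z, s). vector [Re z, Im z, s])"

lemma vec_of_complex_real_nth [simp]:
  "vec_of_complex_real p $ 1 = Re (fst p)" "vec_of_complex_real p $ 2 = Im (fst p)" "vec_of_complex_real p $ 3 = snd p"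
  unfolding vec_of_complex_real_def by (auto simp: split_def)

lemma borel_measurable_vec_of_complex_real [measurable]: "vec_of_complex_real \<in> borel_measurable borel"
proof (rule borel_measurable_continuous_onI)
  have *: "continuous_on UNIV (\<lambda>p. vec_of_complex_real p $ 1)" "continuous_on UNIV (\<lambda>p. vec_of_complex_real p $ 2)"
    "continuous_on UNIV (\<lambda>p. vec_of_complex_real p $ 3)"
    unfolding vec_of_complex_real_nth by (auto intro!: continuous_intros)
  have "continuous_on UNIV (\<lambda>p. vec_of_complex_real p $ i)" for i
    using exhaust_3[of i] * by auto
  then show "continuous_on UNIV vec_of_complex_real"
    unfolding continuous_on_componentwise[of _ vec_of_complex_real] by (auto simp: Basis_vec_def inner_axis)
qed

lemma distr_vec_of_complex_real: "distr lborel borel vec_of_complex_real = lborel"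
proof (rule lborel_eqI[symmetric])
  fix l u :: "real ^ 3" assume lu: "\<And>b. b \<in> Basis \<Longrightarrow> l \<bullet> b \<le> u \<bullet> b"
  have lu': "l $ i \<le> u $ i" for i using lu[of "axis i 1"] by (simp add: inner_axis)
  define P where "P = box (Complex (l $ 1) (l $ 2), l $ 3) (Complex (u $ 1) (u $ 2), u $ 3)"
  have "emeasure (distr lborel borel vec_of_complex_real) (box l u) = emeasure lborel (vec_of_complex_real -` box l u)"
    by (subst emeasure_distr) auto
  also have "vec_of_complex_real -` box l u = P"
    unfolding P_def by (auto simp: mem_box_cart forall_3 mem_box Basis_prod_def Basis_complex_def inner_complex_def)
  also have "emeasure lborel P = (\<Prod>b\<in>Basis. ((Complex (u $ 1) (u $ 2), u $ 3) - (Complex (l $ 1) (l $ 2), l $ 3)) \<bullet> b)"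
    unfolding P_def using lu' by (intro emeasure_lborel_box) (auto simp: Basis_prod_def Basis_complex_def inner_complex_def)
  also have "\<dots> = ennreal ((u$1 - l$1) * (u$2 - l$2) * (u$3 - l$3))"
  proof -
    have b: "(Basis :: (complex \<times> real) set) = {(1,0), (\<i>,0), (0,1)}" by (auto simp: Basis_prod_def Basis_complex_def)
    show ?thesis unfolding b by (simp add: inner_complex_def mult.assoc)
  qed
  also have "(u$1 - l$1) * (u$2 - l$2) * (u$3 - l$3) = (\<Prod>b\<in>Basis. (u - l) \<bullet> b)"
  proof -
    have "(\<Prod>b\<in>(Basis::(real^3) set). (u - l) \<bullet> b) = (\<Prod>i\<in>UNIV. (u - l) \<bullet> axis i 1)"
      by (rule prod.reindex_cong[of "\<lambda>i. axis i 1"]) (auto simp: Basis_vec_def inj_on_def axis_eq_axis)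
    also have "\<dots> = (u$1 - l$1) * (u$2 - l$2) * (u$3 - l$3)" unfolding UNIV_3 by (simp add: inner_axis)
    finally show ?thesis by simp
  qed
  finally show "emeasure (distr lborel borel vec_of_complex_real) (box l u) = (\<Prod>b\<in>Basis. (u - l) \<bullet> b)" .
qed simp

text \<open>Indicators of sets with varying endpoints become conditionals on inequalities between
  measurable functions, whose joint measurability can be derived automatically.\<close>

lemma indicator_interval_if:
  fixes a b x :: real
  shows "indicator {a..} x = (if a \<le> x then 1 else 0 :: ennreal)"
    and "indicator {a..b} x = (if a \<le> x \<and> x \<le> b then 1 else 0 :: ennreal)"
    and "indicator {n. P n} x = (if P x then 1 else 0 :: ennreal)"
  by (auto simp: indicator_def)

lemma borel_measurable_case_prod_compose:
  fixes f :: "real \<Rightarrow> real \<Rightarrow> ennreal"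
  assumes "case_prod f \<in> borel_measurable borel" "a \<in> borel_measurable M" "b \<in> borel_measurable M"
  shows "(\<lambda>x. f (a x) (b x)) \<in> borel_measurable M"
proof -
  have "(\<lambda>x. (a x, b x)) \<in> measurable M (borel \<Otimes>\<^sub>M borel)" using assms by measurable
  then have "(\<lambda>x. case_prod f (a x, b x)) \<in> borel_measurable M"
    using assms(1) unfolding borel_prod[symmetric] by (rule measurable_compose)
  then show ?thesis by simp
qed

text \<open>After a rotation that takes the vertical axis to \<open>e\<close>, the integral is
  sliced by \<open>s = y \<bullet> e\<close>. On a slice the squared norm is \<open>s ^ 2\<close>
  plus the squared modulus of the planar part, and the latter has density \<open>pi\<close>.\<close>

lemma nn_integral_norm_inner:
  fixes e :: "real ^ 3"
  assumes e: "norm e = 1" and f: "case_prod f \<in> borel_measurable borel"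
  shows "(\<integral>\<^sup>+y. f ((norm y)\<^sup>2) (y \<bullet> e) \<partial>lborel)
      = ennreal pi * (\<integral>\<^sup>+s. \<integral>\<^sup>+m. indicator {s\<^sup>2..} m * f m s \<partial>lborel \<partial>lborel)"
proof -
  note [measurable (raw)] = borel_measurable_case_prod_compose[OF f]
  have "\<exists>T::real ^ 3 \<Rightarrow> real ^ 3. orthogonal_transformation T \<and> T (axis 3 1) = e"
    using orthogonal_transformation_exists_1[of "axis 3 1" e] e by (metis norm_axis_1)
  then obtain T :: "real ^ 3 \<Rightarrow> real ^ 3" where T: "orthogonal_transformation T" "T (axis 3 1) = e" by blast
  have Tb[measurable]: "T \<in> borel_measurable borel"
    using T orthogonal_transformation_linear linear_continuous_on linear_linear
    by (intro borel_measurable_continuous_onI) (blast intro: linear_continuous_on)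
  have "(\<integral>\<^sup>+y. f ((norm y)\<^sup>2) (y \<bullet> e) \<partial>lborel) = (\<integral>\<^sup>+y. f ((norm y)\<^sup>2) (y \<bullet> e) \<partial>distr lborel borel T)"
    unfolding distr_orthogonal_lborel[OF T(1)] ..
  also have "\<dots> = (\<integral>\<^sup>+y. f ((norm (T y))\<^sup>2) (T y \<bullet> e) \<partial>lborel)"
    by (subst nn_integral_distr) auto
  also have "\<dots> = (\<integral>\<^sup>+y. f ((norm (y::real^3))\<^sup>2) (y $ 3) \<partial>lborel)"
  proof -
    have "T y \<bullet> e = y $ 3" for y
      using T orthogonal_transformation_def[of T] by (metis inner_axis inner_real_def mult.right_neutral)
    then show ?thesis using T orthogonal_transformation_norm by (simp add: orthogonal_transformation_norm)
  qed
  also have "\<dots> = (\<integral>\<^sup>+y. f ((norm (y::real^3))\<^sup>2) (y $ 3) \<partial>distr lborel borel vec_of_complex_real)"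
    unfolding distr_vec_of_complex_real ..
  also have "\<dots> = (\<integral>\<^sup>+p. f ((norm (fst (p :: complex \<times> real)))\<^sup>2 + (snd p)\<^sup>2) (snd p) \<partial>lborel)"
  proof (subst nn_integral_distr)
    have "(norm (vec_of_complex_real p))\<^sup>2 = (norm (fst p))\<^sup>2 + (snd p)\<^sup>2" for p
      by (simp add: norm_vec_def L2_set_def sum_3 cmod_power2)
    then show "(\<integral>\<^sup>+ x. f ((norm (vec_of_complex_real x))\<^sup>2) (vec_of_complex_real x $ 3) \<partial>lborel) =
       (\<integral>\<^sup>+p. f ((norm (fst (p :: complex \<times> real)))\<^sup>2 + (snd p)\<^sup>2) (snd p) \<partial>lborel)" by simp
  qed auto
  also have "\<dots> = (\<integral>\<^sup>+p. f ((norm (fst (p :: complex \<times> real)))\<^sup>2 + (snd p)\<^sup>2) (snd p) \<partial>((lborel :: complex measure) \<Otimes>\<^sub>M lborel))"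
    unfolding lborel_prod ..
  also have "\<dots> = (\<integral>\<^sup>+s. \<integral>\<^sup>+z. f ((norm (z::complex))\<^sup>2 + s\<^sup>2) s \<partial>lborel \<partial>lborel)"
    by (subst lborel_pair.nn_integral_snd[symmetric]) auto
  also have "\<dots> = (\<integral>\<^sup>+s. ennreal pi * (\<integral>\<^sup>+m. indicator {0..} m * f (m + s\<^sup>2) s \<partial>lborel) \<partial>lborel)"
    by (intro nn_integral_cong nn_integral_norm_square_complex) measurable
  also have "\<dots> = (\<integral>\<^sup>+s. ennreal pi * (\<integral>\<^sup>+m. indicator {s\<^sup>2..} m * f m s \<partial>lborel) \<partial>lborel)"
  proof (rule nn_integral_cong)
    fix s :: real
    have "(\<integral>\<^sup>+m. indicator {s\<^sup>2..} m * f m s \<partial>lborel) = (\<integral>\<^sup>+m. indicator {s\<^sup>2..} (s\<^sup>2 + 1 * m) * f (s\<^sup>2 + 1 * m) s \<partial>lborel)"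
      by (subst nn_integral_real_affine[where c = 1 and t = "s\<^sup>2"]) auto
    also have "\<dots> = (\<integral>\<^sup>+m. indicator {0..} m * f (m + s\<^sup>2) s \<partial>lborel)"
      by (intro nn_integral_cong) (auto split: split_indicator simp: add.commute)
    finally show "ennreal pi * (\<integral>\<^sup>+m. indicator {0..} m * f (m + s\<^sup>2) s \<partial>lborel) = ennreal pi * (\<integral>\<^sup>+m. indicator {s\<^sup>2..} m * f m s \<partial>lborel)" by simp
  qed
  also have "\<dots> = ennreal pi * (\<integral>\<^sup>+s. \<integral>\<^sup>+m. indicator {s\<^sup>2..} m * f m s \<partial>lborel \<partial>lborel)"
    by (rule nn_integral_cmult) (unfold indicator_interval_if, measurable)
  finally show ?thesis .
qed

text \<open>The proof rests on the fact that the pair \<open>((norm y)\<^sup>2, (norm (x + y))\<^sup>2)\<close> has constant density with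
  respect to Lebesgue measure on its range.\<close>

lemma nn_integral_bipolar:
  fixes x :: "real ^ 3"
  assumes x: "x \<noteq> 0" and g: "case_prod g \<in> borel_measurable borel"
  shows "(\<integral>\<^sup>+y. g (norm y) (norm (x + y)) \<partial>lborel) = ennreal (2 * pi / norm x) *
    (\<integral>\<^sup>+\<sigma>. \<integral>\<^sup>+\<rho>. indicator {\<bar>norm x - \<rho>\<bar>..norm x + \<rho>} \<sigma> * (indicator {0..} \<rho> * ennreal (\<rho> * \<sigma>) * g \<rho> \<sigma>) \<partial>lborel \<partial>lborel)"
proof -
  define r where "r = norm x"
  have r: "r > 0" using x unfolding r_def by simp
  define e where "e = x /\<^sub>R r"
  have e: "norm e = 1" using r unfolding e_def r_def by simp
  have xe: "x = r *\<^sub>R e" using r unfolding e_def by simp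
  note [measurable (raw)] = borel_measurable_case_prod_compose[OF g]
  \<comment> \<open>With \<open>m\<close> and \<open>n\<close> in the roles of the squares of
    \<open>norm y\<close> and \<open>norm (x + y)\<close>, this says that the lengths
    \<open>r\<close>, \<open>sqrt m\<close>, \<open>sqrt n\<close> form a possibly degenerate
    triangle.\<close>
  define T where "T m n \<longleftrightarrow> (n - r\<^sup>2 - m)\<^sup>2 \<le> 4 * r\<^sup>2 * m" for m n
  have [measurable (raw)]: "Measurable.pred M (\<lambda>x. T (a x) (b x))"
    if [measurable]: "a \<in> borel_measurable M" "b \<in> borel_measurable M" for M :: "'m measure" and a b
    unfolding T_def by measurable
  have Tpos: "m \<ge> 0 \<and> n \<ge> 0" if "T m n" for m n
  proof -
    have "0 \<le> 4 * r\<^sup>2 * m" using that unfolding T_def by (smt (verit) zero_le_power2)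
    then have m: "m \<ge> 0" using r by (simp add: zero_le_mult_iff)
    have "(n - r\<^sup>2 - m)\<^sup>2 \<le> (2 * r * sqrt m)\<^sup>2" using that m unfolding T_def by (simp add: power_mult_distrib)
    then have "\<bar>n - r\<^sup>2 - m\<bar> \<le> 2 * r * sqrt m" using r m by (simp add: abs_le_square_iff[symmetric])
    moreover have "r\<^sup>2 + m - 2 * r * sqrt m = (r - sqrt m)\<^sup>2" using m by (simp add: power2_diff)
    ultimately show ?thesis using m by (smt (verit) zero_le_power2)
  qed
  define f where "f m s = g (sqrt m) (sqrt (r\<^sup>2 + 2 * r * s + m))" for m s
  have fm: "case_prod f \<in> borel_measurable borel" unfolding f_def split_def borel_prod[symmetric] by measurable
  note [measurable (raw)] = borel_measurable_case_prod_compose[OF fm]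
  have "norm (x + y) = sqrt (r\<^sup>2 + 2 * r * (y \<bullet> e) + (norm y)\<^sup>2)" for y
  proof -
    have "(norm (x + y))\<^sup>2 = (norm x)\<^sup>2 + 2 * (y \<bullet> x) + (norm y)\<^sup>2"
      unfolding power2_norm_eq_inner by (simp add: inner_add inner_commute)
    then show ?thesis unfolding r_def[symmetric] using xe by (metis (no_types, lifting) inner_scaleR_right mult.assoc norm_ge_zero real_sqrt_unique)
  qed
  then have "(\<integral>\<^sup>+y. g (norm y) (norm (x + y)) \<partial>lborel) = (\<integral>\<^sup>+y. f ((norm y)\<^sup>2) (y \<bullet> e) \<partial>lborel)"
    unfolding f_def by simp
  also have "\<dots> = ennreal pi * (\<integral>\<^sup>+s. \<integral>\<^sup>+m. indicator {s\<^sup>2..} m * f m s \<partial>lborel \<partial>lborel)"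
    by (rule nn_integral_norm_inner[OF e fm])
  also have "(\<integral>\<^sup>+s. \<integral>\<^sup>+m. indicator {s\<^sup>2..} m * f m s \<partial>lborel \<partial>lborel) = (\<integral>\<^sup>+m. \<integral>\<^sup>+s. indicator {s\<^sup>2..} m * f m s \<partial>lborel \<partial>lborel)"
    by (rule lborel_pair.Fubini') (unfold indicator_interval_if, measurable)
  also have "\<dots> = (\<integral>\<^sup>+m. ennreal (1 / (2 * r)) * (\<integral>\<^sup>+n. indicator {n. T m n} n * g (sqrt m) (sqrt n) \<partial>lborel) \<partial>lborel)"
  proof (rule nn_integral_cong)
    \<comment> \<open>Law of cosines: \<open>n = r ^ 2 + 2 * r * s + m\<close>. For fixed
      \<open>m\<close> this is affine in \<open>s\<close>, so the density remains constant and only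
      the factor \<open>1 / (2 * r)\<close> appears.\<close>
    fix m :: real
    have "(\<integral>\<^sup>+s. indicator {s\<^sup>2..} m * f m s \<partial>lborel) = ennreal \<bar>1 / (2 * r)\<bar> *
       (\<integral>\<^sup>+n. indicator {(- ((r\<^sup>2 + m) / (2 * r)) + 1 / (2 * r) * n)\<^sup>2..} m * f m (- ((r\<^sup>2 + m) / (2 * r)) + 1 / (2 * r) * n) \<partial>lborel)"
      using r by (intro nn_integral_real_affine) (unfold indicator_interval_if, measurable)
    also have "(\<integral>\<^sup>+n. indicator {(- ((r\<^sup>2 + m) / (2 * r)) + 1 / (2 * r) * n)\<^sup>2..} m * f m (- ((r\<^sup>2 + m) / (2 * r)) + 1 / (2 * r) * n) \<partial>lborel)
       = (\<integral>\<^sup>+n. indicator {n. T m n} n * g (sqrt m) (sqrt n) \<partial>lborel)"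
    proof (rule nn_integral_cong)
      fix n
      have a: "- ((r\<^sup>2 + m) / (2 * r)) + 1 / (2 * r) * n = (n - r\<^sup>2 - m) / (2 * r)" using r by (simp add: field_simps)
      have b: "r\<^sup>2 + 2 * r * ((n - r\<^sup>2 - m) / (2 * r)) + m = n" using r by simp
      have c: "((n - r\<^sup>2 - m) / (2 * r))\<^sup>2 \<le> m \<longleftrightarrow> T m n"
        unfolding T_def using r by (simp add: power_divide power_mult_distrib divide_le_eq mult_ac)
      show "indicator {(- ((r\<^sup>2 + m) / (2 * r)) + 1 / (2 * r) * n)\<^sup>2..} m * f m (- ((r\<^sup>2 + m) / (2 * r)) + 1 / (2 * r) * n)
         = indicator {n. T m n} n * g (sqrt m) (sqrt n)"
        unfolding a f_def b using c by (simp add: indicator_def)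
    qed
    finally show "(\<integral>\<^sup>+s. indicator {s\<^sup>2..} m * f m s \<partial>lborel) = ennreal (1 / (2 * r)) * (\<integral>\<^sup>+n. indicator {n. T m n} n * g (sqrt m) (sqrt n) \<partial>lborel)"
      using r by simp
  qed
  also have "\<dots> = ennreal (1 / (2 * r)) * (\<integral>\<^sup>+m. (\<integral>\<^sup>+n. indicator {n. T m n} n * g (sqrt m) (sqrt n) \<partial>lborel) \<partial>lborel)"
    by (rule nn_integral_cmult) (unfold indicator_interval_if, measurable)
  also have "(\<integral>\<^sup>+m. \<integral>\<^sup>+n. indicator {n. T m n} n * g (sqrt m) (sqrt n) \<partial>lborel \<partial>lborel)
     = (\<integral>\<^sup>+m. \<integral>\<^sup>+n. indicator {0..} n * (indicator {n. T m n} n * g (sqrt m) (sqrt n)) \<partial>lborel \<partial>lborel)"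
    using Tpos by (intro nn_integral_cong) (auto simp: indicator_def)
  also have "\<dots> = (\<integral>\<^sup>+m. \<integral>\<^sup>+\<sigma>. ennreal (2 * \<sigma>) * indicator {0..} \<sigma> * (indicator {n. T m n} (\<sigma>\<^sup>2) * g (sqrt m) (sqrt (\<sigma>\<^sup>2))) \<partial>lborel \<partial>lborel)"
    by (intro nn_integral_cong nn_integral_square) (unfold indicator_interval_if, measurable)
  also have "\<dots> = (\<integral>\<^sup>+\<sigma>. \<integral>\<^sup>+m. ennreal (2 * \<sigma>) * indicator {0..} \<sigma> * (indicator {n. T m n} (\<sigma>\<^sup>2) * g (sqrt m) (sqrt (\<sigma>\<^sup>2))) \<partial>lborel \<partial>lborel)"
    by (rule lborel_pair.Fubini') (unfold indicator_interval_if, measurable)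
  also have "\<dots> = (\<integral>\<^sup>+\<sigma>. \<integral>\<^sup>+m. indicator {0..} m * (ennreal (2 * \<sigma>) * indicator {0..} \<sigma> * (indicator {n. T m n} (\<sigma>\<^sup>2) * g (sqrt m) (sqrt (\<sigma>\<^sup>2)))) \<partial>lborel \<partial>lborel)"
    using Tpos by (intro nn_integral_cong) (auto simp: indicator_def)
  also have "\<dots> = (\<integral>\<^sup>+\<sigma>. \<integral>\<^sup>+\<rho>. ennreal (2 * \<rho>) * indicator {0..} \<rho> *
       (ennreal (2 * \<sigma>) * indicator {0..} \<sigma> * (indicator {n. T (\<rho>\<^sup>2) n} (\<sigma>\<^sup>2) * g (sqrt (\<rho>\<^sup>2)) (sqrt (\<sigma>\<^sup>2)))) \<partial>lborel \<partial>lborel)"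
    by (intro nn_integral_cong nn_integral_square) (unfold indicator_interval_if, measurable)
  also have "\<dots> = (\<integral>\<^sup>+\<sigma>. \<integral>\<^sup>+\<rho>. ennreal 4 * (indicator {\<bar>r - \<rho>\<bar>..r + \<rho>} \<sigma> * (indicator {0..} \<rho> * ennreal (\<rho> * \<sigma>) * g \<rho> \<sigma>)) \<partial>lborel \<partial>lborel)"
  proof (intro nn_integral_cong)
    fix \<rho> \<sigma> :: real
    have "T (\<rho>\<^sup>2) (\<sigma>\<^sup>2) \<longleftrightarrow> \<bar>r - \<rho>\<bar> \<le> \<sigma> \<and> \<sigma> \<le> r + \<rho>" if "\<rho> \<ge> 0" "\<sigma> \<ge> 0"
    proof -
      have "T (\<rho>\<^sup>2) (\<sigma>\<^sup>2) \<longleftrightarrow> (\<sigma>\<^sup>2 - r\<^sup>2 - \<rho>\<^sup>2)\<^sup>2 \<le> (2 * r * \<rho>)\<^sup>2" unfolding T_def by (simp add: power_mult_distrib)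
      also have "\<dots> \<longleftrightarrow> \<bar>\<sigma>\<^sup>2 - r\<^sup>2 - \<rho>\<^sup>2\<bar> \<le> 2 * r * \<rho>" using r that by (simp add: abs_le_square_iff[symmetric])
      also have "\<dots> \<longleftrightarrow> \<bar>r - \<rho>\<bar>\<^sup>2 \<le> \<sigma>\<^sup>2 \<and> \<sigma>\<^sup>2 \<le> (r + \<rho>)\<^sup>2" by (auto simp: power2_eq_square algebra_simps abs_le_iff)
      also have "\<dots> \<longleftrightarrow> \<bar>r - \<rho>\<bar> \<le> \<sigma> \<and> \<sigma> \<le> r + \<rho>" using r that by (metis abs_ge_zero add_nonneg_nonneg less_imp_le power2_le_iff_abs_le abs_of_nonneg)
      finally show ?thesis .
    qed
    moreover have "\<sigma> \<ge> 0" if "\<bar>r - \<rho>\<bar> \<le> \<sigma>" using that by linarith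
    moreover have "ennreal (2 * \<rho>) * (ennreal (2 * \<sigma>) * g \<rho> \<sigma>) = ennreal 4 * (ennreal (\<rho> * \<sigma>) * g \<rho> \<sigma>)" if "\<rho> \<ge> 0" "\<sigma> \<ge> 0"
    proof -
      have "ennreal (2 * \<rho>) * ennreal (2 * \<sigma>) = ennreal 4 * ennreal (\<rho> * \<sigma>)" using that by (simp add: ennreal_mult[symmetric] del: ennreal_numeral)
      then show ?thesis by (simp only: mult.assoc[symmetric])
    qed
    ultimately show "ennreal (2 * \<rho>) * indicator {0..} \<rho> *
       (ennreal (2 * \<sigma>) * indicator {0..} \<sigma> * (indicator {n. T (\<rho>\<^sup>2) n} (\<sigma>\<^sup>2) * g (sqrt (\<rho>\<^sup>2)) (sqrt (\<sigma>\<^sup>2))))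
       = ennreal 4 * (indicator {\<bar>r - \<rho>\<bar>..r + \<rho>} \<sigma> * (indicator {0..} \<rho> * ennreal (\<rho> * \<sigma>) * g \<rho> \<sigma>))"
      by (cases "\<rho> \<ge> 0"; cases "\<sigma> \<ge> 0") (auto simp: indicator_def)
  qed
  also have "\<dots> = (\<integral>\<^sup>+\<sigma>. ennreal 4 * (\<integral>\<^sup>+\<rho>. (indicator {\<bar>r - \<rho>\<bar>..r + \<rho>} \<sigma> * (indicator {0..} \<rho> * ennreal (\<rho> * \<sigma>) * g \<rho> \<sigma>)) \<partial>lborel) \<partial>lborel)"
    by (intro nn_integral_cong nn_integral_cmult) (unfold indicator_interval_if, measurable)
  also have "\<dots> = ennreal 4 * (\<integral>\<^sup>+\<sigma>. \<integral>\<^sup>+\<rho>. (indicator {\<bar>r - \<rho>\<bar>..r + \<rho>} \<sigma> * (indicator {0..} \<rho> * ennreal (\<rho> * \<sigma>) * g \<rho> \<sigma>)) \<partial>lborel \<partial>lborel)"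
    by (rule nn_integral_cmult) (unfold indicator_interval_if, measurable)
  finally have "(\<integral>\<^sup>+y. g (norm y) (norm (x + y)) \<partial>lborel) = ennreal pi * (ennreal (1 / (2 * r)) * (ennreal 4 * (\<integral>\<^sup>+\<sigma>. \<integral>\<^sup>+\<rho>. (indicator {\<bar>r - \<rho>\<bar>..r + \<rho>} \<sigma> * (indicator {0..} \<rho> * ennreal (\<rho> * \<sigma>) * g \<rho> \<sigma>)) \<partial>lborel \<partial>lborel)))" .
  \<comment> \<open>The factors are the planar density, the affine substitution, and a 4 from
    returning to \<open>\<rho>\<close> and \<open>\<sigma>\<close> from their squares.\<close>
  moreover have "ennreal pi * ennreal (1 / (2 * r)) * ennreal 4 = ennreal (2 * pi / r)"
    using r by (simp add: ennreal_mult[symmetric] del: ennreal_numeral)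
  ultimately show ?thesis unfolding r_def by (simp only: mult.assoc[symmetric])
qed

text \<open>In the bipolar coordinates \<open>\<rho> = norm y\<close>,
  \<open>\<sigma> = norm (x + y)\<close> the density is proportional to
  \<open>\<rho> * \<sigma>\<close>, so the kernel \<open>1 / \<rho>\<close> cancels. Exchanging
  \<open>\<rho>\<close> for the value \<open>u\<close> of \<open>ucoord\<close> at the cone point
  turns the triangle inequalities into an interval for \<open>u\<close> and a lower bound for
  \<open>\<sigma>\<close>.\<close>

lemma nn_integral_light_cone_le:
  fixes x :: "real ^ 3" and t :: real
  assumes x: "x \<noteq> 0" and h: "case_prod h \<in> borel_measurable borel"
  shows "(\<integral>\<^sup>+y. h ((t + norm y - norm (x + y)) / 2) (norm (x + y)) * ennreal (1 / norm y) \<partial>lborel) \<le> ennreal (4 * pi / norm x) *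
    (\<integral>\<^sup>+u. indicator {(t - norm x) / 2..(t + norm x) / 2} u * (\<integral>\<^sup>+\<sigma>. indicator {max 0 ((t + norm x) / 2 - u)..} \<sigma> * ennreal \<sigma> * h u \<sigma> \<partial>lborel) \<partial>lborel)"
    (is "?L \<le> _ * ?R")
proof -
  define r where "r = norm x"
  have r: "r > 0" using x unfolding r_def by simp
  note [measurable (raw)] = borel_measurable_case_prod_compose[OF h]
  define g where "g \<rho> \<sigma> = h ((t + \<rho> - \<sigma>) / 2) \<sigma> * ennreal (1 / \<rho>)" for \<rho> \<sigma>
  have gm: "case_prod g \<in> borel_measurable borel" unfolding g_def split_def borel_prod[symmetric] by measurable
  define A where "A = (\<integral>\<^sup>+\<sigma>. \<integral>\<^sup>+\<rho>. indicator {\<bar>norm x - \<rho>\<bar>..norm x + \<rho>} \<sigma> * (indicator {0..} \<rho> * ennreal (\<rho> * \<sigma>) * g \<rho> \<sigma>) \<partial>lborel \<partial>lborel)"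
  define B where "B = (\<integral>\<^sup>+\<sigma>. \<integral>\<^sup>+u. indicator {\<bar>r - (\<sigma> - t + 2 * u)\<bar>..r + (\<sigma> - t + 2 * u)} \<sigma> * (ennreal \<sigma> * h u \<sigma>) \<partial>lborel \<partial>lborel)"
  have L: "?L = ennreal (2 * pi / norm x) * A"
    using nn_integral_bipolar[OF x gm] unfolding g_def A_def .
  have "A
     \<le> (\<integral>\<^sup>+\<sigma>. \<integral>\<^sup>+\<rho>. indicator {\<bar>r - \<rho>\<bar>..r + \<rho>} \<sigma> * (ennreal \<sigma> * h ((t + \<rho> - \<sigma>) / 2) \<sigma>) \<partial>lborel \<partial>lborel)"
    unfolding A_def
  proof (intro nn_integral_mono)
    fix \<rho> \<sigma> :: real
    have "ennreal (\<rho> * \<sigma>) * (X * ennreal (1 / \<rho>)) \<le> ennreal \<sigma> * X" if "\<rho> \<ge> 0" "\<sigma> \<ge> 0" for X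
    proof (cases "\<rho> = 0")
      case False
      have "ennreal (\<rho> * \<sigma>) * (X * ennreal (1 / \<rho>)) = (ennreal (\<rho> * \<sigma>) * ennreal (1 / \<rho>)) * X" by (simp add: mult_ac)
      also have "ennreal (\<rho> * \<sigma>) * ennreal (1 / \<rho>) = ennreal \<sigma>" using that False by (simp add: ennreal_mult[symmetric])
      finally show ?thesis by simp
    qed simp
    then show "indicator {\<bar>norm x - \<rho>\<bar>..norm x + \<rho>} \<sigma> * (indicator {0..} \<rho> * ennreal (\<rho> * \<sigma>) * g \<rho> \<sigma>)
       \<le> indicator {\<bar>r - \<rho>\<bar>..r + \<rho>} \<sigma> * (ennreal \<sigma> * h ((t + \<rho> - \<sigma>) / 2) \<sigma>)"
      unfolding g_def r_def by (auto simp: indicator_def)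
  qed
  also have "\<dots> = (\<integral>\<^sup>+\<sigma>. ennreal 2 * (\<integral>\<^sup>+u. indicator {\<bar>r - (\<sigma> - t + 2 * u)\<bar>..r + (\<sigma> - t + 2 * u)} \<sigma> * (ennreal \<sigma> * h u \<sigma>) \<partial>lborel) \<partial>lborel)"
  proof (rule nn_integral_cong)
    fix \<sigma> :: real
    have m: "(\<lambda>\<rho>. indicator {\<bar>r - \<rho>\<bar>..r + \<rho>} \<sigma> * (ennreal \<sigma> * h ((t + \<rho> - \<sigma>) / 2) \<sigma>)) \<in> borel_measurable borel"
      unfolding indicator_interval_if by measurable
    have "(\<integral>\<^sup>+\<rho>. indicator {\<bar>r - \<rho>\<bar>..r + \<rho>} \<sigma> * (ennreal \<sigma> * h ((t + \<rho> - \<sigma>) / 2) \<sigma>) \<partial>lborel)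
       = ennreal \<bar>2\<bar> * (\<integral>\<^sup>+u. indicator {\<bar>r - (\<sigma> - t + 2 * u)\<bar>..r + (\<sigma> - t + 2 * u)} \<sigma> * (ennreal \<sigma> * h ((t + (\<sigma> - t + 2 * u) - \<sigma>) / 2) \<sigma>) \<partial>lborel)"
      by (rule nn_integral_real_affine[OF m, of 2 "\<sigma> - t"]) simp
    then show "(\<integral>\<^sup>+\<rho>. indicator {\<bar>r - \<rho>\<bar>..r + \<rho>} \<sigma> * (ennreal \<sigma> * h ((t + \<rho> - \<sigma>) / 2) \<sigma>) \<partial>lborel)
       = ennreal 2 * (\<integral>\<^sup>+u. indicator {\<bar>r - (\<sigma> - t + 2 * u)\<bar>..r + (\<sigma> - t + 2 * u)} \<sigma> * (ennreal \<sigma> * h u \<sigma>) \<partial>lborel)"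
      by simp
  qed
  also have "\<dots> = ennreal 2 * B" unfolding B_def
    by (rule nn_integral_cmult) (unfold indicator_interval_if, measurable)
  finally have AB: "A \<le> ennreal 2 * B" .
  have "B
     = (\<integral>\<^sup>+u. \<integral>\<^sup>+\<sigma>. indicator {\<bar>r - (\<sigma> - t + 2 * u)\<bar>..r + (\<sigma> - t + 2 * u)} \<sigma> * (ennreal \<sigma> * h u \<sigma>) \<partial>lborel \<partial>lborel)"
    unfolding B_def by (rule lborel_pair.Fubini') (unfold indicator_interval_if, measurable)
  also have "\<dots> \<le> (\<integral>\<^sup>+u. \<integral>\<^sup>+\<sigma>. indicator {(t - r) / 2..(t + r) / 2} u * (indicator {max 0 ((t + r) / 2 - u)..} \<sigma> * ennreal \<sigma> * h u \<sigma>) \<partial>lborel \<partial>lborel)"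
  proof (intro nn_integral_mono)
    fix u \<sigma> :: real
    have "(t - r) / 2 \<le> u \<and> u \<le> (t + r) / 2 \<and> 0 \<le> \<sigma> \<and> (t + r) / 2 - u \<le> \<sigma>"
      if "\<bar>r - (\<sigma> - t + 2 * u)\<bar> \<le> \<sigma>" "\<sigma> \<le> r + (\<sigma> - t + 2 * u)"
      using that by (auto simp: abs_le_iff field_simps)
    then show "indicator {\<bar>r - (\<sigma> - t + 2 * u)\<bar>..r + (\<sigma> - t + 2 * u)} \<sigma> * (ennreal \<sigma> * h u \<sigma>)
       \<le> indicator {(t - r) / 2..(t + r) / 2} u * (indicator {max 0 ((t + r) / 2 - u)..} \<sigma> * ennreal \<sigma> * h u \<sigma>)"
      by (auto simp: indicator_def)
  qed
  also have "\<dots> = ?R" unfolding r_def[symmetric]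
    by (intro nn_integral_cong nn_integral_cmult) (unfold indicator_interval_if, measurable)
  finally have "A \<le> ennreal 2 * ?R" using AB by (meson mult_left_mono order_trans zero_le)
  then have "?L \<le> ennreal (2 * pi / norm x) * (ennreal 2 * ?R)"
    unfolding L by (rule mult_left_mono) simp
  also have "\<dots> = ennreal (4 * pi / norm x) * ?R"
  proof -
    have "ennreal (2 * pi / norm x) * ennreal 2 = ennreal (4 * pi / norm x)"
      by (subst ennreal_mult[symmetric]) auto
    then show ?thesis by (simp only: mult.assoc[symmetric])
  qed
  finally show ?thesis .
qed

text \<open>A function of the norm alone does not see \<open>s\<close>, so slicing leaves the length
  \<open>2 * sqrt m\<close> of the range of \<open>s\<close>. Together with the density
  \<open>pi\<close> and the factor \<open>2 * \<rho>\<close> from \<open>m = \<rho> ^ 2\<close> this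
  produces the area of the sphere.\<close>

lemma nn_integral_radial:
  assumes k[measurable]: "k \<in> borel_measurable borel"
  shows "(\<integral>\<^sup>+y. k (norm (y :: real ^ 3)) \<partial>lborel) = ennreal (4 * pi) * (\<integral>\<^sup>+\<rho>. indicator {0..} \<rho> * (ennreal (\<rho>\<^sup>2) * k \<rho>) \<partial>lborel)"
proof -
  define f where "f m s = k (sqrt m)" for m s :: real
  have fm: "case_prod f \<in> borel_measurable borel" unfolding f_def split_def borel_prod[symmetric] by measurable
  note [measurable (raw)] = borel_measurable_case_prod_compose[OF fm]
  have "(\<integral>\<^sup>+y. k (norm (y :: real ^ 3)) \<partial>lborel) = (\<integral>\<^sup>+y. f ((norm y)\<^sup>2) (y \<bullet> (axis 1 1 :: real ^ 3)) \<partial>lborel)"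
    unfolding f_def by simp
  also have "\<dots> = ennreal pi * (\<integral>\<^sup>+s. \<integral>\<^sup>+m. indicator {s\<^sup>2..} m * f m s \<partial>lborel \<partial>lborel)"
    by (rule nn_integral_norm_inner[OF _ fm]) simp
  also have "(\<integral>\<^sup>+s. \<integral>\<^sup>+m. indicator {s\<^sup>2..} m * f m s \<partial>lborel \<partial>lborel) = (\<integral>\<^sup>+m. \<integral>\<^sup>+s. indicator {s\<^sup>2..} m * f m s \<partial>lborel \<partial>lborel)"
    by (rule lborel_pair.Fubini') (unfold indicator_interval_if, measurable)
  also have "\<dots> = (\<integral>\<^sup>+m. indicator {0..} m * (ennreal (2 * sqrt m) * k (sqrt m)) \<partial>lborel)"
  proof (rule nn_integral_cong)
    fix m :: real
    have "(\<integral>\<^sup>+s. indicator {s\<^sup>2..} m * f m s \<partial>lborel) = (\<integral>\<^sup>+s. k (sqrt m) * indicator (if m \<ge> 0 then {-sqrt m..sqrt m} else {}) s \<partial>lborel)"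
    proof (rule nn_integral_cong)
      fix s
      have "s\<^sup>2 \<le> m \<longleftrightarrow> \<bar>s\<bar> \<le> sqrt m" by (metis real_sqrt_abs real_sqrt_le_iff)
      moreover have "0 \<le> m" if "s\<^sup>2 \<le> m" using that by (smt (verit) zero_le_power2)
      ultimately show "indicator {s\<^sup>2..} m * f m s = k (sqrt m) * indicator (if m \<ge> 0 then {-sqrt m..sqrt m} else {}) s"
        unfolding f_def by (auto simp: indicator_def abs_le_iff)
    qed
    also have "\<dots> = k (sqrt m) * emeasure lborel (if m \<ge> 0 then {-sqrt m..sqrt m} else {})"
      by (rule nn_integral_cmult_indicator) auto
    also have "\<dots> = indicator {0..} m * (ennreal (2 * sqrt m) * k (sqrt m))"
      by (auto simp: indicator_def mult.commute)
    finally show "(\<integral>\<^sup>+s. indicator {s\<^sup>2..} m * f m s \<partial>lborel) = indicator {0..} m * (ennreal (2 * sqrt m) * k (sqrt m))" .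
  qed
  also have "\<dots> = (\<integral>\<^sup>+\<rho>. ennreal (2 * \<rho>) * indicator {0..} \<rho> * (ennreal (2 * sqrt (\<rho>\<^sup>2)) * k (sqrt (\<rho>\<^sup>2))) \<partial>lborel)"
    by (rule nn_integral_square) measurable
  also have "\<dots> = (\<integral>\<^sup>+\<rho>. ennreal 4 * (indicator {0..} \<rho> * (ennreal (\<rho>\<^sup>2) * k \<rho>)) \<partial>lborel)"
  proof (rule nn_integral_cong)
    fix \<rho> :: real
    have "ennreal (2 * \<rho>) * ennreal (2 * \<rho>) = ennreal 4 * ennreal (\<rho>\<^sup>2)" if "\<rho> \<ge> 0"
      using that by (simp add: ennreal_mult[symmetric] power2_eq_square del: ennreal_numeral)
    then have "ennreal (2 * \<rho>) * (ennreal (2 * \<rho>) * k \<rho>) = ennreal 4 * (ennreal (\<rho>\<^sup>2) * k \<rho>)" if "\<rho> \<ge> 0"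
      using that by (metis mult.assoc)
    then show "ennreal (2 * \<rho>) * indicator {0..} \<rho> * (ennreal (2 * sqrt (\<rho>\<^sup>2)) * k (sqrt (\<rho>\<^sup>2)))
        = ennreal 4 * (indicator {0..} \<rho> * (ennreal (\<rho>\<^sup>2) * k \<rho>))"
      by (auto simp: indicator_def)
  qed
  also have "\<dots> = ennreal 4 * (\<integral>\<^sup>+\<rho>. indicator {0..} \<rho> * (ennreal (\<rho>\<^sup>2) * k \<rho>) \<partial>lborel)"
    by (rule nn_integral_cmult) (unfold indicator_interval_if, measurable)
  finally have "(\<integral>\<^sup>+y. k (norm (y :: real ^ 3)) \<partial>lborel) = ennreal pi * (ennreal 4 * (\<integral>\<^sup>+\<rho>. indicator {0..} \<rho> * (ennreal (\<rho>\<^sup>2) * k \<rho>) \<partial>lborel))" .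
  moreover have "ennreal pi * ennreal 4 = ennreal (4 * pi)" by (subst ennreal_mult[symmetric]) (auto simp: mult.commute)
  ultimately show ?thesis by (simp only: mult.assoc[symmetric])
qed

section \<open>Weighted integrals over a light cone\<close>

lemma nn_integral_inverse_square_tail:
  assumes "a > -1"
  shows "(\<integral>\<^sup>+\<sigma>. ennreal (1 / (1 + \<sigma>)\<^sup>2) * indicator {a..} \<sigma> \<partial>lborel) = ennreal (1 / (1 + a))"
proof -
  have "(\<integral>\<^sup>+\<sigma>. ennreal (1 / (1 + \<sigma>)\<^sup>2) * indicator {a..} \<sigma> \<partial>lborel) = ennreal (0 - (- 1 / (1 + a)))"
  proof (rule nn_integral_FTC_atLeast)
    show "((\<lambda>\<sigma>. - 1 / (1 + \<sigma>)) has_real_derivative 1 / (1 + \<sigma>)\<^sup>2) (at \<sigma>)" if "a \<le> \<sigma>" for \<sigma>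
      using that assms by (auto intro!: derivative_eq_intros simp: power2_eq_square divide_simps)
    show "((\<lambda>\<sigma>::real. - 1 / (1 + \<sigma>)) \<longlongrightarrow> 0) at_top" by real_asymp
  qed auto
  then show ?thesis by simp
qed

text \<open>One integrable majorant for all cone integrands: in three dimensions the inverse square
  is integrable at the vertex and the inverse fourth power at infinity. The full inverse square at
  the vertex is required by \<open>cone_field'\<close>.\<close>

definition cone_majorant :: "real ^ 3 \<Rightarrow> real" where
  "cone_majorant y = 1 / ((1 + norm y)\<^sup>2 * (norm y)\<^sup>2)"

lemma integrable_cone_majorant: "integrable lborel cone_majorant"
proof (rule integrableI_nonneg)
  show [measurable]: "cone_majorant \<in> borel_measurable lborel" unfolding cone_majorant_def by measurable
  have "(\<integral>\<^sup>+y. ennreal (cone_majorant y) \<partial>lborel) = ennreal (4 * pi) * (\<integral>\<^sup>+\<rho>. indicator {0..} \<rho> * (ennreal (\<rho>\<^sup>2) * ennreal (1 / ((1 + \<rho>)\<^sup>2 * \<rho>\<^sup>2))) \<partial>lborel)"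
    unfolding cone_majorant_def by (rule nn_integral_radial[of "\<lambda>\<rho>. ennreal (1 / ((1 + \<rho>)\<^sup>2 * \<rho>\<^sup>2))"]) measurable
  also have "(\<integral>\<^sup>+\<rho>. indicator {0..} \<rho> * (ennreal (\<rho>\<^sup>2) * ennreal (1 / ((1 + \<rho>)\<^sup>2 * \<rho>\<^sup>2))) \<partial>lborel) \<le> (\<integral>\<^sup>+\<rho>. ennreal (1 / (1 + \<rho>)\<^sup>2) * indicator {0..} \<rho> \<partial>lborel)"
    by (intro nn_integral_mono) (auto simp: indicator_def ennreal_mult[symmetric])
  also have "\<dots> = 1" using nn_integral_inverse_square_tail[of 0] by simp
  finally have "(\<integral>\<^sup>+y. ennreal (cone_majorant y) \<partial>lborel) \<le> ennreal (4 * pi) * 1" by (simp add: mult_left_mono)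
  also have "\<dots> < \<infinity>" by simp
  finally show "(\<integral>\<^sup>+y. ennreal (cone_majorant y) \<partial>lborel) < \<infinity>" .
qed (auto simp: cone_majorant_def)

text \<open>With three powers of the radius, the integral of
  \<open>\<sigma> / (1 + \<sigma>) ^ 3\<close> over \<open>\<sigma> \<ge> m\<close> is at most
  \<open>1 / (1 + m)\<close>; the factor in \<open>ucoord\<close> makes the remaining integral over
  \<open>u\<close> converge. The restriction to radius at least \<open>D\<close> is what later
  yields the gain \<open>1 / (1 + D)\<close>.\<close>

definition src_weight :: "real \<Rightarrow> spacetime \<Rightarrow> real" where
  "src_weight D w = (if D \<le> norm (snd w) then 1 / ((1 + norm (snd w)) ^ 3 * (1 + (ucoord w)\<^sup>2)) else 0)"

lemma src_weight_nonneg: "0 \<le> src_weight D w"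
  unfolding src_weight_def by auto

lemma nn_integral_src_weight:
  assumes x: "x \<noteq> 0" and D: "D \<ge> 0"
  shows "(\<integral>\<^sup>+y. ennreal (src_weight D ((t, x) + (norm y, y))) * ennreal (1 / norm y) \<partial>lborel) \<le> ennreal (4 * pi / norm x) *
    (\<integral>\<^sup>+u. indicator {(t - norm x) / 2..(t + norm x) / 2} u * ennreal (1 / ((1 + u\<^sup>2) * (1 + max D ((t + norm x) / 2 - u)))) \<partial>lborel)"
proof -
  define h where "h u \<sigma> = indicator {D..} \<sigma> * ennreal (1 / ((1 + \<sigma>) ^ 3 * (1 + u\<^sup>2)))" for u \<sigma> :: real
  have hm: "case_prod h \<in> borel_measurable borel" unfolding h_def split_def indicator_interval_if borel_prod[symmetric] by measurable
  have "(\<integral>\<^sup>+y. ennreal (src_weight D ((t, x) + (norm y, y))) * ennreal (1 / norm y) \<partial>lborel) =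
    (\<integral>\<^sup>+y. h ((t + norm y - norm (x + y)) / 2) (norm (x + y)) * ennreal (1 / norm y) \<partial>lborel)"
    unfolding h_def src_weight_def ucoord_def by (intro nn_integral_cong) (auto simp: indicator_def)
  also have "\<dots> \<le> ennreal (4 * pi / norm x) *
    (\<integral>\<^sup>+u. indicator {(t - norm x) / 2..(t + norm x) / 2} u * (\<integral>\<^sup>+\<sigma>. indicator {max 0 ((t + norm x) / 2 - u)..} \<sigma> * ennreal \<sigma> * h u \<sigma> \<partial>lborel) \<partial>lborel)"
    by (rule nn_integral_light_cone_le[OF x hm])
  also have "\<dots> \<le> ennreal (4 * pi / norm x) *
    (\<integral>\<^sup>+u. indicator {(t - norm x) / 2..(t + norm x) / 2} u * ennreal (1 / ((1 + u\<^sup>2) * (1 + max D ((t + norm x) / 2 - u)))) \<partial>lborel)"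
  proof (rule mult_left_mono[OF nn_integral_mono])
    fix u :: real
    define m where "m = max D ((t + norm x) / 2 - u)"
    have m: "m \<ge> 0" using D unfolding m_def by simp
    have "(\<integral>\<^sup>+\<sigma>. indicator {max 0 ((t + norm x) / 2 - u)..} \<sigma> * ennreal \<sigma> * h u \<sigma> \<partial>lborel)
       \<le> (\<integral>\<^sup>+\<sigma>. ennreal (1 / (1 + u\<^sup>2)) * (ennreal (1 / (1 + \<sigma>)\<^sup>2) * indicator {m..} \<sigma>) \<partial>lborel)"
    proof (intro nn_integral_mono)
      fix \<sigma> :: real
      have "ennreal \<sigma> * ennreal (1 / ((1 + \<sigma>) ^ 3 * (1 + u\<^sup>2))) \<le> ennreal (1 / (1 + u\<^sup>2)) * ennreal (1 / (1 + \<sigma>)\<^sup>2)" if s: "\<sigma> \<ge> 0"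
      proof -
        have p: "1 + u\<^sup>2 > 0" by (simp add: add_pos_nonneg)
        have "\<sigma> / (1 + \<sigma>) ^ 3 \<le> (1 + \<sigma>) / (1 + \<sigma>) ^ 3" using s by (intro divide_right_mono) auto
        also have "\<dots> = 1 / (1 + \<sigma>)\<^sup>2" using s by (simp add: power2_eq_square power3_eq_cube)
        finally have "\<sigma> * (1 / ((1 + \<sigma>) ^ 3 * (1 + u\<^sup>2))) \<le> 1 / (1 + u\<^sup>2) * (1 / (1 + \<sigma>)\<^sup>2)"
          using p mult_right_mono[of "\<sigma> / (1 + \<sigma>) ^ 3" "1 / (1 + \<sigma>)\<^sup>2" "1 / (1 + u\<^sup>2)"] by (simp add: mult_ac)
        then show ?thesis using s p by (simp add: ennreal_mult[symmetric] ennreal_leI del: times_divide_eq_right times_divide_eq_left)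
      qed
      then show "indicator {max 0 ((t + norm x) / 2 - u)..} \<sigma> * ennreal \<sigma> * h u \<sigma> \<le> ennreal (1 / (1 + u\<^sup>2)) * (ennreal (1 / (1 + \<sigma>)\<^sup>2) * indicator {m..} \<sigma>)"
        unfolding h_def m_def by (auto simp: indicator_def)
    qed
    also have "\<dots> = ennreal (1 / (1 + u\<^sup>2)) * (\<integral>\<^sup>+\<sigma>. ennreal (1 / (1 + \<sigma>)\<^sup>2) * indicator {m..} \<sigma> \<partial>lborel)"
      by (rule nn_integral_cmult) (unfold indicator_interval_if, measurable)
    also have "\<dots> = ennreal (1 / (1 + u\<^sup>2)) * ennreal (1 / (1 + m))"
      using nn_integral_inverse_square_tail[of m] m by simp
    also have "\<dots> = ennreal (1 / ((1 + u\<^sup>2) * (1 + m)))" using m by (subst ennreal_mult[symmetric]) auto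
    finally show "indicator {(t - norm x) / 2..(t + norm x) / 2} u * (\<integral>\<^sup>+\<sigma>. indicator {max 0 ((t + norm x) / 2 - u)..} \<sigma> * ennreal \<sigma> * h u \<sigma> \<partial>lborel)
      \<le> indicator {(t - norm x) / 2..(t + norm x) / 2} u * ennreal (1 / ((1 + u\<^sup>2) * (1 + max D ((t + norm x) / 2 - u))))"
      unfolding m_def by (intro mult_left_mono) auto
  qed auto
  finally show ?thesis .
qed

lemma nn_integral_arctan:
  "(\<integral>\<^sup>+u. indicator {a..b} u * ennreal (1 / (1 + u\<^sup>2)) \<partial>lborel) \<le> ennreal pi"
proof (cases "a \<le> b")
  case True
  have "(\<integral>\<^sup>+u. indicator {a..b} u * ennreal (1 / (1 + u\<^sup>2)) \<partial>lborel) = (\<integral>\<^sup>+u. ennreal (1 / (1 + u\<^sup>2)) * indicator {a..b} u \<partial>lborel)"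
    by (simp add: mult.commute)
  also have "\<dots> = ennreal (arctan b - arctan a)"
  proof (rule nn_integral_FTC_Icc)
    show "(arctan has_real_derivative 1 / (1 + u\<^sup>2)) (at u)" for u
      using DERIV_arctan[of u] by (simp add: inverse_eq_divide)
  qed (use True in auto)
  also have "\<dots> \<le> ennreal pi" using arctan_ubound[of b] arctan_lbound[of a] by (intro ennreal_leI) linarith
  finally show ?thesis .
qed simp

lemma nn_integral_src_weight_le:
  assumes x: "x \<noteq> 0" and D: "D \<ge> 0"
  shows "(\<integral>\<^sup>+y. ennreal (src_weight D ((t, x) + (norm y, y))) * ennreal (1 / norm y) \<partial>lborel)
     \<le> ennreal (4 * pi * (1 + pi) / ((1 + D) * (1 + norm x)))"
proof -
  define r where "r = norm x"
  have r: "r > 0" using x unfolding r_def by simp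
  define I where "I = (\<integral>\<^sup>+u. indicator {(t - r) / 2..(t + r) / 2} u * ennreal (1 / (1 + u\<^sup>2)) \<partial>lborel)"
  have "I \<le> (\<integral>\<^sup>+u. indicator {(t - r) / 2..(t + r) / 2} u \<partial>lborel)" unfolding I_def
  proof (intro nn_integral_mono)
    fix u :: real
    have "1 / (1 + u\<^sup>2) \<le> 1" by (simp add: add_pos_nonneg)
    then have "ennreal (1 / (1 + u\<^sup>2)) \<le> 1" by (metis ennreal_1 ennreal_leI)
    then show "indicator {(t - r) / 2..(t + r) / 2} u * ennreal (1 / (1 + u\<^sup>2)) \<le> indicator {(t - r) / 2..(t + r) / 2} u"
      by (auto simp: indicator_def)
  qed
  also have "\<dots> = ennreal r" using r by (simp add: field_simps)
  finally have I1: "I \<le> ennreal r" .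
  have I2: "I \<le> ennreal pi" unfolding I_def by (rule nn_integral_arctan)
  \<comment> \<open>Near the axis the length \<open>r\<close> of the interval for \<open>u\<close>
    compensates the prefactor \<open>1 / r\<close>; far from it the arctangent bound
    \<open>pi\<close> is the better one.\<close>
  have I: "I \<le> ennreal (min r pi)" using I1 I2 by (simp add: min_def)
  have "(\<integral>\<^sup>+y. ennreal (src_weight D ((t, x) + (norm y, y))) * ennreal (1 / norm y) \<partial>lborel) \<le> ennreal (4 * pi / r) *
    (\<integral>\<^sup>+u. indicator {(t - r) / 2..(t + r) / 2} u * ennreal (1 / ((1 + u\<^sup>2) * (1 + max D ((t + r) / 2 - u)))) \<partial>lborel)"
    unfolding r_def by (rule nn_integral_src_weight[OF x D])
  also have "\<dots> \<le> ennreal (4 * pi / r) * (\<integral>\<^sup>+u. ennreal (1 / (1 + D)) * (indicator {(t - r) / 2..(t + r) / 2} u * ennreal (1 / (1 + u\<^sup>2))) \<partial>lborel)"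
  proof (intro mult_left_mono nn_integral_mono)
    fix u :: real
    have "1 / ((1 + u\<^sup>2) * (1 + max D ((t + r) / 2 - u))) \<le> 1 / ((1 + u\<^sup>2) * (1 + D))"
      using D by (intro divide_left_mono mult_left_mono mult_pos_pos) (auto simp: add_pos_nonneg)
    then have "ennreal (1 / ((1 + u\<^sup>2) * (1 + max D ((t + r) / 2 - u)))) \<le> ennreal (1 / (1 + D)) * ennreal (1 / (1 + u\<^sup>2))"
      using D by (simp add: ennreal_mult[symmetric] ennreal_leI mult.commute)
    then show "indicator {(t - r) / 2..(t + r) / 2} u * ennreal (1 / ((1 + u\<^sup>2) * (1 + max D ((t + r) / 2 - u))))
       \<le> ennreal (1 / (1 + D)) * (indicator {(t - r) / 2..(t + r) / 2} u * ennreal (1 / (1 + u\<^sup>2)))"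
      by (auto simp: indicator_def)
  qed auto
  also have "\<dots> = ennreal (4 * pi / r) * (ennreal (1 / (1 + D)) * I)" unfolding I_def
    by (intro arg_cong2[where f = "(*)"] refl nn_integral_cmult) (unfold indicator_interval_if, measurable)
  also have "\<dots> \<le> ennreal (4 * pi / r) * (ennreal (1 / (1 + D)) * ennreal (min r pi))"
    by (intro mult_left_mono I) auto
  also have "\<dots> = ennreal (4 * pi / r * (1 / (1 + D) * min r pi))"
    using r D by (simp add: ennreal_mult[symmetric])
  also have "\<dots> \<le> ennreal (4 * pi * (1 + pi) / ((1 + D) * (1 + r)))"
  proof (rule ennreal_leI)
    have "min r pi * (1 + r) = min r pi + min r pi * r" by (simp add: algebra_simps)
    also have "\<dots> \<le> r + pi * r" using r by (intro add_mono mult_right_mono) auto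
    finally have "min r pi / r \<le> (1 + pi) / (1 + r)" using r by (simp add: field_simps)
    then have "(4 * pi / (1 + D)) * (min r pi / r) \<le> (4 * pi / (1 + D)) * ((1 + pi) / (1 + r))"
      using D by (intro mult_left_mono) auto
    then show "4 * pi / r * (1 / (1 + D) * min r pi) \<le> 4 * pi * (1 + pi) / ((1 + D) * (1 + r))"
      by (simp add: mult_ac)
  qed
  finally show ?thesis unfolding r_def .
qed

text \<open>The integral is split at \<open>u = v / 2\<close>. Below, the radius of the source point
  is at least \<open>v / 2\<close>; above, \<open>u ^ 2\<close> is at least
  \<open>v ^ 2 / 4\<close>. The resulting bound still tends to zero after multiplication by the
  radius when \<open>v\<close> and the radius grow at the same rate.\<close>

lemma nn_integral_src_weight_scri:
  assumes x: "x \<noteq> 0" and v: "v = (t + norm x) / 2" "v \<ge> 0"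
  shows "(\<integral>\<^sup>+y. ennreal (src_weight 0 ((t, x) + (norm y, y))) * ennreal (1 / norm y) \<partial>lborel)
     \<le> ennreal (4 * pi / norm x * (2 * pi / (2 + v) + 4 * norm x / (4 + v\<^sup>2)))"
proof -
  define r where "r = norm x"
  have r: "r > 0" using x unfolding r_def by simp
  have p: "1 + u\<^sup>2 > 0" for u :: real by (simp add: add_pos_nonneg)
  have "(\<integral>\<^sup>+y. ennreal (src_weight 0 ((t, x) + (norm y, y))) * ennreal (1 / norm y) \<partial>lborel) \<le> ennreal (4 * pi / r) *
    (\<integral>\<^sup>+u. indicator {(t - r) / 2..v} u * ennreal (1 / ((1 + u\<^sup>2) * (1 + max 0 (v - u)))) \<partial>lborel)"
    unfolding r_def v by (rule nn_integral_src_weight[OF x]) simp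
  also have "\<dots> \<le> ennreal (4 * pi / r) * (\<integral>\<^sup>+u. ennreal (2 / (2 + v)) * (indicator {(t - r) / 2..v} u * ennreal (1 / (1 + u\<^sup>2)))
        + ennreal (4 / (4 + v\<^sup>2)) * indicator {(t - r) / 2..v} u \<partial>lborel)"
  proof (intro mult_left_mono nn_integral_mono)
    fix u :: real
    have "1 / ((1 + u\<^sup>2) * (1 + max 0 (v - u))) \<le> 2 / (2 + v) * (1 / (1 + u\<^sup>2)) + 4 / (4 + v\<^sup>2)" if "u \<le> v"
    proof (cases "u \<le> v / 2")
      case True
      have "1 / ((1 + u\<^sup>2) * (1 + max 0 (v - u))) \<le> 1 / ((1 + u\<^sup>2) * (1 + v / 2))"
        using True p[of u] v(2) by (intro divide_left_mono mult_left_mono mult_pos_pos) auto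
      also have "\<dots> = 2 / (2 + v) * (1 / (1 + u\<^sup>2))" using v(2) p[of u] by (simp add: divide_simps)
      finally show ?thesis by (smt (verit) divide_nonneg_nonneg zero_le_power2)
    next
      case False
      have "(v / 2)\<^sup>2 \<le> u\<^sup>2" using False v(2) by (intro power_mono) auto
      then have "1 + (v / 2)\<^sup>2 \<le> (1 + u\<^sup>2) * 1" by simp
      also have "\<dots> \<le> (1 + u\<^sup>2) * (1 + max 0 (v - u))" using p[of u] by (intro mult_left_mono) auto
      finally have "1 / ((1 + u\<^sup>2) * (1 + max 0 (v - u))) \<le> 1 / (1 + (v / 2)\<^sup>2)"
        using p[of "v/2"] p[of u] by (intro divide_left_mono mult_pos_pos) auto
      also have "\<dots> = 4 / (4 + v\<^sup>2)" by (simp add: power_divide divide_simps)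
      finally show ?thesis using p[of u] v(2) by (smt (verit) divide_nonneg_nonneg mult_nonneg_nonneg)
    qed
    then have "ennreal (1 / ((1 + u\<^sup>2) * (1 + max 0 (v - u)))) \<le> ennreal (2 / (2 + v)) * ennreal (1 / (1 + u\<^sup>2)) + ennreal (4 / (4 + v\<^sup>2))" if "u \<le> v"
      using that v(2) p[of u] p[of v] by (simp add: ennreal_mult[symmetric] ennreal_plus[symmetric] ennreal_leI del: ennreal_plus)
    then show "indicator {(t - r) / 2..v} u * ennreal (1 / ((1 + u\<^sup>2) * (1 + max 0 (v - u)))) \<le>
       ennreal (2 / (2 + v)) * (indicator {(t - r) / 2..v} u * ennreal (1 / (1 + u\<^sup>2))) + ennreal (4 / (4 + v\<^sup>2)) * indicator {(t - r) / 2..v} u"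
      by (auto simp: indicator_def)
  qed auto
  also have "\<dots> = ennreal (4 * pi / r) * (ennreal (2 / (2 + v)) * (\<integral>\<^sup>+u. indicator {(t - r) / 2..v} u * ennreal (1 / (1 + u\<^sup>2)) \<partial>lborel)
      + ennreal (4 / (4 + v\<^sup>2)) * (\<integral>\<^sup>+u. indicator {(t - r) / 2..v} u \<partial>lborel))"
    by (subst nn_integral_add) (auto simp: nn_integral_cmult)
  also have "\<dots> \<le> ennreal (4 * pi / r) * (ennreal (2 / (2 + v)) * ennreal pi + ennreal (4 / (4 + v\<^sup>2)) * ennreal r)"
  proof (intro mult_left_mono add_mono nn_integral_arctan)
    have "(\<integral>\<^sup>+u. indicator {(t - r) / 2..v} u \<partial>lborel) = emeasure lborel {(t - r) / 2..v}" by simp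
    also have "\<dots> = ennreal r" using r unfolding v r_def[symmetric] by (subst emeasure_lborel_Icc) (auto simp: field_simps)
    finally show "(\<integral>\<^sup>+u. indicator {(t - r) / 2..v} u \<partial>lborel) \<le> ennreal r" by simp
  qed auto
  also have "\<dots> = ennreal (4 * pi / r * (2 / (2 + v) * pi + 4 / (4 + v\<^sup>2) * r))"
    using r v(2) by (simp add: ennreal_mult[symmetric] ennreal_plus[symmetric] del: ennreal_plus)
  finally show ?thesis unfolding r_def by simp
qed

section \<open>The advanced potential\<close>

text \<open>Radial decay alone is enough for absolute convergence of the cone integral and for
  differentiation under it. This weight dominates \<open>src_weight D\<close> for every
  \<open>D\<close>.\<close>

definition cone_wt :: "spacetime \<Rightarrow> real" where
  "cone_wt w = 1 / (1 + norm (snd w)) ^ 3"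

lemma cone_wt_nonneg: "0 \<le> cone_wt w" unfolding cone_wt_def by simp

lemma cone_wt_le_1: "cone_wt w \<le> 1"
proof -
  have "1 \<le> (1 + norm (snd w)) ^ 3" by (rule one_le_power) simp
  then show ?thesis unfolding cone_wt_def by (metis divide_le_eq_1_pos less_le_trans zero_less_one)
qed

text \<open>From \<open>1 + norm y \<le> (1 + norm (x + y)) * (1 + norm x)\<close> with
  \<open>x = snd z\<close>: moving the vertex of the cone costs a factor that depends only on the
  radius of the vertex.\<close>

lemma cone_wt_shift: "cone_wt (z + (norm y, y)) \<le> (1 + norm (snd z)) ^ 3 / (1 + norm y) ^ 3"
proof -
  have "norm y \<le> norm (snd z + y) + norm (snd z)"
    by (metis add_diff_cancel_left' norm_triangle_ineq4 add.commute)
  moreover have "0 \<le> norm (snd z + y) * norm (snd z)" by simp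
  ultimately have "1 + norm y \<le> (1 + norm (snd z + y)) * (1 + norm (snd z))" by (simp only: ring_distribs)
  then have "(1 + norm y) ^ 3 \<le> (1 + norm (snd z + y)) ^ 3 * (1 + norm (snd z)) ^ 3"
    by (metis power_mono power_mult_distrib add_nonneg_nonneg norm_ge_zero zero_le_one)
  moreover have "0 < (1 + norm (snd z + y)) ^ 3" "0 < (1 + norm y) ^ 3" by (simp_all add: add_pos_nonneg)
  ultimately show ?thesis unfolding cone_wt_def by (simp add: field_simps)
qed

lemma cone_majorant_nonneg: "0 \<le> cone_majorant y" unfolding cone_majorant_def by simp

lemma cone_majorant_ge:
  "1 / ((1 + norm y) ^ 3 * norm y) \<le> cone_majorant y" "1 / ((1 + norm y) ^ 3 * (norm y)\<^sup>2) \<le> cone_majorant y"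
proof -
  show "1 / ((1 + norm y) ^ 3 * norm y) \<le> cone_majorant y"
  proof (cases "y = 0")
    case False
    then have "(1 + norm y)\<^sup>2 * norm y * norm y \<le> (1 + norm y)\<^sup>2 * norm y * (1 + norm y)"
      by (intro mult_left_mono) auto
    then have "(1 + norm y)\<^sup>2 * (norm y)\<^sup>2 \<le> (1 + norm y) ^ 3 * norm y"
      by (simp add: power2_eq_square power3_eq_cube mult_ac)
    moreover have "(1 + norm y)\<^sup>2 * (norm y)\<^sup>2 > 0" using False by (auto simp: add_nonneg_eq_0_iff)
    ultimately show ?thesis unfolding cone_majorant_def by (intro divide_left_mono) (auto intro: mult_pos_pos)
  qed (simp add: cone_majorant_def)
  show "1 / ((1 + norm y) ^ 3 * (norm y)\<^sup>2) \<le> cone_majorant y"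
  proof (cases "y = 0")
    case False
    have "(1 + norm y)\<^sup>2 * 1 \<le> (1 + norm y)\<^sup>2 * (1 + norm y)" by (intro mult_left_mono) auto
    then have "(1 + norm y)\<^sup>2 * (norm y)\<^sup>2 \<le> (1 + norm y) ^ 3 * (norm y)\<^sup>2"
      by (intro mult_right_mono) (auto simp: power2_eq_square power3_eq_cube)
    moreover have "(1 + norm y)\<^sup>2 * (norm y)\<^sup>2 > 0" using False by (auto simp: add_nonneg_eq_0_iff)
    ultimately show ?thesis unfolding cone_majorant_def by (intro divide_left_mono) (auto intro: mult_pos_pos)
  qed (simp add: cone_majorant_def)
qed

lemma cone_integrand_bound:
  assumes "\<And>w. \<bar>F w\<bar> \<le> C * cone_wt w" "C \<ge> 0" "norm (snd z) \<le> R"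
  shows "\<bar>F (z + (norm y, y)) / norm y\<bar> \<le> C * (1 + R) ^ 3 * cone_majorant y"
proof -
  have "\<bar>F (z + (norm y, y))\<bar> \<le> C * ((1 + norm (snd z)) ^ 3 / (1 + norm y) ^ 3)"
    using order_trans[OF assms(1) mult_left_mono[OF cone_wt_shift assms(2)]] .
  also have "\<dots> \<le> C * ((1 + R) ^ 3 / (1 + norm y) ^ 3)"
    using assms(2,3) by (intro mult_left_mono divide_right_mono power_mono) auto
  finally have "\<bar>F (z + (norm y, y))\<bar> / norm y \<le> C * ((1 + R) ^ 3 / (1 + norm y) ^ 3) / norm y"
    by (rule divide_right_mono) simp
  also have "\<dots> = C * (1 + R) ^ 3 * (1 / ((1 + norm y) ^ 3 * norm y))" by simp
  also have "\<dots> \<le> C * (1 + R) ^ 3 * cone_majorant y"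
    using assms(2) order_trans[OF norm_ge_zero assms(3)] by (intro mult_left_mono cone_majorant_ge mult_nonneg_nonneg) auto
  finally show ?thesis by simp
qed

lemma borel_measurable_cone:
  fixes F :: "spacetime \<Rightarrow> real"
  assumes "continuous_on UNIV F"
  shows "(\<lambda>y. F (z + (norm y, y))) \<in> borel_measurable borel"
  by (intro borel_measurable_continuous_onI continuous_on_compose2[OF assms]) (auto intro!: continuous_intros)

lemma integrable_cone:
  fixes F :: "spacetime \<Rightarrow> real"
  assumes F: "continuous_on UNIV F" "\<And>w. \<bar>F w\<bar> \<le> C * cone_wt w" "C \<ge> 0"
  shows "integrable lborel (\<lambda>y. F (z + (norm y, y)) / norm y)"
proof (rule Bochner_Integration.integrable_bound)
  show "integrable lborel (\<lambda>y. C * (1 + norm (snd z)) ^ 3 * cone_majorant y)"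
    using integrable_cone_majorant by simp
  note [measurable] = borel_measurable_cone[OF F(1)]
  show "(\<lambda>y. F (z + (norm y, y)) / norm y) \<in> borel_measurable lborel" by measurable
  show "AE y in lborel. norm (F (z + (norm y, y)) / norm y) \<le> norm (C * (1 + norm (snd z)) ^ 3 * cone_majorant y)"
  proof (rule AE_I2)
    fix y
    show "norm (F (z + (norm y, y)) / norm y) \<le> norm (C * (1 + norm (snd z)) ^ 3 * cone_majorant y)"
      unfolding real_norm_def using cone_integrand_bound[OF F(2,3) order_refl] by (rule order_trans[OF _ abs_ge_self])
  qed
qed

definition cone_const :: real where
  "cone_const = (LINT y|(lborel :: (real ^ 3) measure). 3 / ((1 + norm y) ^ 4 * (norm y)\<^sup>2))"

text \<open>The normalising constant is the coefficient that the divergence identity for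
  \<open>cone_field\<close> produces at the vertex of the cone. It equals \<open>4 * pi\<close>, but only its positivity is
  used.\<close>

definition adv :: "(spacetime \<Rightarrow> real) \<Rightarrow> spacetime \<Rightarrow> real" where
  "adv F z = (LINT y|lborel. F (z + (norm y, y)) / norm y) / cone_const"

lemma integrable_cone_const: "integrable lborel (\<lambda>y::real ^ 3. 3 / ((1 + norm y) ^ 4 * (norm y)\<^sup>2))"
proof (rule Bochner_Integration.integrable_bound)
  show "integrable lborel (\<lambda>y. 3 * cone_majorant y)" using integrable_cone_majorant by simp
  show "AE y in lborel. norm (3 / ((1 + norm y) ^ 4 * (norm y)\<^sup>2)) \<le> norm (3 * cone_majorant y)"
  proof (rule AE_I2)
    fix y :: "real ^ 3"
    have "1 / ((1 + norm y) ^ 4 * (norm y)\<^sup>2) \<le> 1 / ((1 + norm y) ^ 3 * (norm y)\<^sup>2)"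
    proof (cases "y = 0")
      case False
      have "(1 + norm y) ^ 3 \<le> (1 + norm y) ^ 4" by (rule power_increasing) auto
      moreover have "0 < 1 + norm y" by (simp add: add_pos_nonneg)
      ultimately show ?thesis using False by (intro divide_left_mono mult_right_mono mult_pos_pos) auto
    qed simp
    also have "\<dots> \<le> cone_majorant y" by (rule cone_majorant_ge)
    finally show "norm (3 / ((1 + norm y) ^ 4 * (norm y)\<^sup>2)) \<le> norm (3 * cone_majorant y)"
      using cone_majorant_nonneg[of y] by simp
  qed
qed measurable

lemma cone_const_pos: "cone_const > 0"
proof -
  have "cone_const \<noteq> 0"
  proof
    assume "cone_const = 0"
    then have "AE y in lborel. 3 / ((1 + norm (y :: real ^ 3)) ^ 4 * (norm y)\<^sup>2) = 0"
      unfolding cone_const_def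
      by (subst (asm) integral_nonneg_eq_0_iff_AE[OF integrable_cone_const]) auto
    moreover have "AE y in lborel. y \<noteq> (0 :: real ^ 3)" by (rule AE_lborel_singleton)
    ultimately have "AE y in (lborel :: (real ^ 3) measure). False"
      by eventually_elim (auto simp: add_nonneg_eq_0_iff)
    then have "emeasure (lborel :: (real ^ 3) measure) (space lborel) = 0"
      unfolding eventually_False ae_filter_eq_bot_iff .
    then show False by simp
  qed
  moreover have "cone_const \<ge> 0" unfolding cone_const_def by (rule Bochner_Integration.integral_nonneg) simp
  ultimately show ?thesis by simp
qed

text \<open>Dominated convergence with source and vertex varying together. A constant source gives
  continuity of \<open>adv F\<close>; a constant vertex lets the limit pass through the nonlinear
  fixed point equation.\<close>

lemma adv_tendsto:
  fixes F :: "nat \<Rightarrow> spacetime \<Rightarrow> real"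
  assumes F: "\<And>n. continuous_on UNIV (F n)" "\<And>n w. \<bar>F n w\<bar> \<le> C * cone_wt w" "C \<ge> 0"
    and G: "continuous_on UNIV G"
    and R: "\<And>n. norm (snd (Z n)) \<le> R"
    and lim: "\<And>y. (\<lambda>n. F n (Z n + (norm y, y))) \<longlonglongrightarrow> G (z + (norm y, y))"
  shows "(\<lambda>n. adv (F n) (Z n)) \<longlonglongrightarrow> adv G z"
  unfolding adv_def
proof (intro tendsto_divide tendsto_const)
  note [measurable] = borel_measurable_cone[OF F(1)] borel_measurable_cone[OF G]
  show "(\<lambda>n. LINT y|lborel. F n (Z n + (norm y, y)) / norm y) \<longlonglongrightarrow> (LINT y|lborel. G (z + (norm y, y)) / norm y)"
  proof (rule integral_dominated_convergence[where w = "\<lambda>y. C * (1 + R) ^ 3 * cone_majorant y"])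
    show "integrable lborel (\<lambda>y. C * (1 + R) ^ 3 * cone_majorant y)" using integrable_cone_majorant by simp
    show "AE y in lborel. (\<lambda>n. F n (Z n + (norm y, y)) / norm y) \<longlonglongrightarrow> G (z + (norm y, y)) / norm y"
    proof (rule AE_I2)
      fix y :: "real ^ 3"
      show "(\<lambda>n. F n (Z n + (norm y, y)) / norm y) \<longlonglongrightarrow> G (z + (norm y, y)) / norm y"
        by (cases "y = 0") (auto intro!: tendsto_divide lim)
    qed
    show "AE y in lborel. norm (F n (Z n + (norm y, y)) / norm y) \<le> C * (1 + R) ^ 3 * cone_majorant y" for n
      using cone_integrand_bound[OF F(2,3) R] by (intro AE_I2) auto
  qed measurable
qed (use cone_const_pos in auto)

lemma continuous_on_adv:
  assumes F: "continuous_on UNIV F" "\<And>w. \<bar>F w\<bar> \<le> C * cone_wt w" "C \<ge> 0"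
  shows "continuous_on UNIV (adv F)"
proof (rule continuous_on_sequentiallyI)
  fix Z :: "nat \<Rightarrow> spacetime" and z assume Z: "Z \<longlonglongrightarrow> z"
  then have "bounded (range (\<lambda>n. snd (Z n)))" using tendsto_snd[OF Z] convergent_imp_bounded by blast
  then obtain R where R: "\<And>n. norm (snd (Z n)) \<le> R" unfolding bounded_iff by blast
  show "(\<lambda>n. adv F (Z n)) \<longlonglongrightarrow> adv F z"
  proof (rule adv_tendsto[OF F F(1) R])
    show "(\<lambda>n. F (Z n + (norm y, y))) \<longlonglongrightarrow> F (z + (norm y, y))" for y
      using continuous_on_tendsto_compose[OF F(1) tendsto_add[OF Z tendsto_const]] by auto
  qed
qed

lemma adv_add:
  assumes F: "continuous_on UNIV F" "\<And>w. \<bar>F w\<bar> \<le> C * cone_wt w" "C \<ge> 0"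
    and G: "continuous_on UNIV G" "\<And>w. \<bar>G w\<bar> \<le> D * cone_wt w" "D \<ge> 0"
  shows "adv (\<lambda>w. a * F w + b * G w) z = a * adv F z + b * adv G z"
proof -
  have "(LINT y|lborel. (a * F (z + (norm y, y)) + b * G (z + (norm y, y))) / norm y)
     = (LINT y|lborel. a * (F (z + (norm y, y)) / norm y) + b * (G (z + (norm y, y)) / norm y))"
    by (simp add: add_divide_distrib)
  also have "\<dots> = a * (LINT y|lborel. F (z + (norm y, y)) / norm y) + b * (LINT y|lborel. G (z + (norm y, y)) / norm y)"
    using integrable_cone[OF F, of z] integrable_cone[OF G, of z]
    by (subst Bochner_Integration.integral_add) (simp_all del: times_divide_eq_right)
  finally show ?thesis unfolding adv_def by (simp add: add_divide_distrib)
qed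

text \<open>Differentiation under the integral. Moving the vertex translates the integrand, and the
  mean value inequality on the unit ball around \<open>z\<close> bounds the difference quotients by
  a multiple of \<open>cone_majorant\<close>.\<close>

lemma has_derivative_adv:
  fixes F :: "spacetime \<Rightarrow> real"
  assumes F: "continuous_on UNIV F" "\<And>w. \<bar>F w\<bar> \<le> C * cone_wt w" "C \<ge> 0" and diff: "\<And>w. F differentiable (at w)"
    and dF: "\<And>b. b \<in> Basis \<Longrightarrow> continuous_on UNIV (ddir b F)" "\<And>b w. b \<in> Basis \<Longrightarrow> \<bar>ddir b F w\<bar> \<le> C * cone_wt w"
  shows "(adv F has_derivative (\<lambda>h. \<Sum>b\<in>Basis. (h \<bullet> b) * adv (ddir b F) z)) (at z)"
  unfolding has_derivative_at_within
proof (intro conjI)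
  show "bounded_linear (\<lambda>h. \<Sum>b\<in>Basis. (h \<bullet> b) * adv (ddir b F) z)"
    by (intro bounded_linear_sum bounded_linear_mult_const bounded_linear_inner_left)
  define c where "c y = (norm y, y)" for y :: "real ^ 3"
  define R where "R = norm (snd z) + 1"
  define M where "M = DIM(spacetime) * (C * (1 + R) ^ 3)"
  have lip: "\<bar>F (z' + c y) - F (z + c y)\<bar> \<le> M / (1 + norm y) ^ 3 * norm (z' - z)" if "z' \<in> cball z 1" for z' y
  proof -
    have "norm (F (z' + c y) - F (z + c y)) \<le> M / (1 + norm y) ^ 3 * norm (z' - z)"
    proof (rule differentiable_bound[where S = "cball z 1" and f' = "\<lambda>w h. ddir h F (w + c y)"])
      fix w assume w: "w \<in> cball z 1"
      have "((\<lambda>w. w + c y) has_derivative (\<lambda>h. h)) (at w within cball z 1)" by (auto intro!: derivative_eq_intros)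
      from has_derivative_compose[OF this has_derivative_ddir[OF diff]]
      show "((\<lambda>w. F (w + c y)) has_derivative (\<lambda>h. ddir h F (w + c y))) (at w within cball z 1)" .
      have "norm (snd w) \<le> norm (snd z) + norm (snd w - snd z)" by (rule norm_triangle_sub)
      moreover have "norm (snd w - snd z) \<le> norm (w - z)" by (metis norm_snd_le snd_diff prod.collapse)
      moreover have "norm (w - z) \<le> 1" using w by (simp add: dist_norm norm_minus_commute)
      ultimately have wR: "norm (snd w) \<le> R" unfolding R_def by linarith
      have b: "\<bar>ddir b F (w + c y)\<bar> \<le> C * (1 + R) ^ 3 / (1 + norm y) ^ 3" if "b \<in> Basis" for b
      proof -
        have "\<bar>ddir b F (w + c y)\<bar> \<le> C * ((1 + norm (snd w)) ^ 3 / (1 + norm y) ^ 3)"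
          unfolding c_def using order_trans[OF dF(2)[OF that] mult_left_mono[OF cone_wt_shift F(3)]] .
        also have "\<dots> \<le> C * ((1 + R) ^ 3 / (1 + norm y) ^ 3)"
          using F(3) wR by (intro mult_left_mono divide_right_mono power_mono) auto
        finally show ?thesis by simp
      qed
      show "onorm (\<lambda>h. ddir h F (w + c y)) \<le> M / (1 + norm y) ^ 3"
      proof (rule onorm_bound)
        fix h :: spacetime
        have "norm (ddir h F (w + c y)) = norm (\<Sum>b\<in>Basis. (h \<bullet> b) * ddir b F (w + c y))"
          by (subst ddir_linear_at[OF diff]) simp
        also have "\<dots> \<le> (\<Sum>b\<in>(Basis :: spacetime set). norm h * (C * (1 + R) ^ 3 / (1 + norm y) ^ 3))"
          unfolding real_norm_def
          by (rule order_trans[OF sum_abs], intro sum_mono, unfold abs_mult, intro mult_mono Basis_le_norm b) auto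
        also have "\<dots> = M / (1 + norm y) ^ 3 * norm h" unfolding M_def by simp
        finally show "norm (ddir h F (w + c y)) \<le> M / (1 + norm y) ^ 3 * norm h" .
      qed (use F(3) in \<open>auto simp: M_def R_def\<close>)
    qed (use that in auto)
    then show ?thesis by simp
  qed
  have Mnn: "M \<ge> 0" using F(3) unfolding M_def R_def by simp
  have ddb: "\<bar>ddir h F (z + c y)\<bar> \<le> M / (1 + norm y) ^ 3 * norm h" for h y
  proof -
    have "\<bar>ddir b F (z + c y)\<bar> \<le> C * (1 + R) ^ 3 / (1 + norm y) ^ 3" if "b \<in> Basis" for b
    proof -
      have "\<bar>ddir b F (z + c y)\<bar> \<le> C * ((1 + norm (snd z)) ^ 3 / (1 + norm y) ^ 3)"
        unfolding c_def using order_trans[OF dF(2)[OF that] mult_left_mono[OF cone_wt_shift F(3)]] .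
      also have "\<dots> \<le> C * ((1 + R) ^ 3 / (1 + norm y) ^ 3)"
        using F(3) by (intro mult_left_mono divide_right_mono power_mono) (auto simp: R_def)
      finally show ?thesis by simp
    qed note b = this
    have "norm (ddir h F (z + c y)) = norm (\<Sum>b\<in>Basis. (h \<bullet> b) * ddir b F (z + c y))"
      by (subst ddir_linear_at[OF diff]) simp
    also have "\<dots> \<le> (\<Sum>b\<in>(Basis :: spacetime set). norm h * (C * (1 + R) ^ 3 / (1 + norm y) ^ 3))"
      unfolding real_norm_def
      by (rule order_trans[OF sum_abs], intro sum_mono, unfold abs_mult, intro mult_mono Basis_le_norm b) auto
    also have "\<dots> = M / (1 + norm y) ^ 3 * norm h" unfolding M_def by simp
    finally show ?thesis by simp
  qed
  show "((\<lambda>y. (adv F y - adv F z - (\<Sum>b\<in>Basis. ((y - z) \<bullet> b) * adv (ddir b F) z)) /\<^sub>R norm (y - z)) \<longlongrightarrow> 0) (at z)"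
  proof (unfold tendsto_at_iff_sequentially, intro allI impI)
    fix X :: "nat \<Rightarrow> spacetime" assume X: "\<forall>i. X i \<in> UNIV - {z}" "X \<longlonglongrightarrow> z"
    \<comment> \<open>The Lipschitz bound \<open>lip\<close> is available only in the unit ball, so
      the sequence is replaced by a tail; \<open>LIMSEQ_offset\<close> undoes the shift at the
      end.\<close>
    obtain N where N: "\<And>n. n \<ge> N \<Longrightarrow> X n \<in> cball z 1"
      using X(2)[unfolded lim_sequentially, rule_format, of 1] by (force simp: dist_commute)
    define Y where "Y n = X (n + N)" for n
    have Y: "Y \<longlonglongrightarrow> z" "\<And>n. Y n \<in> cball z 1" "\<And>n. Y n \<noteq> z"
      using X N unfolding Y_def by (auto intro: LIMSEQ_ignore_initial_segment)
    define q where "q n y = (F (Y n + c y) - F (z + c y) - ddir (Y n - z) F (z + c y)) / norm (Y n - z)" for n y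
    note mb[measurable] = borel_measurable_cone[OF F(1)] borel_measurable_cone[OF dF(1)]
    have q_sum: "q n y / norm y = (F (Y n + (norm y, y)) / norm y - F (z + (norm y, y)) / norm y - (\<Sum>b\<in>Basis. ((Y n - z) \<bullet> b) * (ddir b F (z + (norm y, y)) / norm y))) / norm (Y n - z)" for n y
      unfolding q_def c_def by (subst ddir_linear_at[OF diff]) (simp add: diff_divide_distrib sum_divide_distrib mult.commute)
    have int_d: "integrable lborel (\<lambda>y. ddir b F (z + (norm y, y)) / norm y)" if "b \<in> Basis" for b
      by (rule integrable_cone[OF dF(1)[OF that] dF(2)[OF that] F(3)])
    have "has_bochner_integral lborel (\<lambda>y. q n y / norm y) (((LINT y|lborel. F (Y n + (norm y, y)) / norm y) - (LINT y|lborel. F (z + (norm y, y)) / norm y)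
        - (\<Sum>b\<in>Basis. ((Y n - z) \<bullet> b) * (LINT y|lborel. ddir b F (z + (norm y, y)) / norm y))) / norm (Y n - z))" for n
      unfolding q_sum
      by (intro has_bochner_integral_divide_zero has_bochner_integral_diff has_bochner_integral_sum has_bochner_integral_mult_right
            has_bochner_integral_integrable integrable_cone[OF F] int_d)
    then have "(LINT y|lborel. q n y / norm y) = ((LINT y|lborel. F (Y n + (norm y, y)) / norm y) - (LINT y|lborel. F (z + (norm y, y)) / norm y)
        - (\<Sum>b\<in>Basis. ((Y n - z) \<bullet> b) * (LINT y|lborel. ddir b F (z + (norm y, y)) / norm y))) / norm (Y n - z)" for n
      by (rule has_bochner_integral_integral_eq)
    then have "(adv F (Y n) - adv F z - (\<Sum>b\<in>Basis. ((Y n - z) \<bullet> b) * adv (ddir b F) z)) /\<^sub>R norm (Y n - z)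
        = (LINT y|lborel. q n y / norm y) / cone_const" for n
      unfolding adv_def by (simp add: diff_divide_distrib sum_divide_distrib inverse_eq_divide mult.commute)
    moreover have "(\<lambda>n. LINT y|lborel. q n y / norm y) \<longlonglongrightarrow> (LINT y|(lborel::(real^3) measure). 0)"
    proof (rule integral_dominated_convergence[where w = "\<lambda>y. 2 * M * cone_majorant y"])
      show "integrable lborel (\<lambda>y. 2 * M * cone_majorant y)" using integrable_cone_majorant by simp
      show "(\<lambda>y. q n y / norm y) \<in> borel_measurable lborel" for n
      proof -
        have [measurable]: "(\<lambda>y. \<Sum>b\<in>Basis. ((Y n - z) \<bullet> b) * (ddir b F (z + (norm y, y)) / norm y)) \<in> borel_measurable borel"
          by (intro borel_measurable_sum) measurable
        show ?thesis unfolding q_sum by measurable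
      qed
      show "AE y in lborel. norm (q n y / norm y) \<le> 2 * M * cone_majorant y" for n
      proof (rule AE_I2)
        fix y :: "real ^ 3"
        have "\<bar>F (Y n + c y) - F (z + c y) - ddir (Y n - z) F (z + c y)\<bar> \<le> 2 * (M / (1 + norm y) ^ 3) * norm (Y n - z)"
          using lip[OF Y(2), of n y] ddb[of "Y n - z" y] by linarith
        then have "\<bar>q n y\<bar> \<le> 2 * (M / (1 + norm y) ^ 3)"
          unfolding q_def using Y(3)[of n] by (simp add: divide_le_eq)
        then have "\<bar>q n y\<bar> / norm y \<le> 2 * (M / (1 + norm y) ^ 3) / norm y" by (rule divide_right_mono) simp
        also have "\<dots> = 2 * M * (1 / ((1 + norm y) ^ 3 * norm y))" by simp
        also have "\<dots> \<le> 2 * M * cone_majorant y" using Mnn by (intro mult_left_mono cone_majorant_ge) auto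
        finally show "norm (q n y / norm y) \<le> 2 * M * cone_majorant y" by simp
      qed
      show "AE y in lborel. (\<lambda>n. q n y / norm y) \<longlonglongrightarrow> 0"
      proof (rule AE_I2)
        fix y :: "real ^ 3"
        have "((\<lambda>w. w + c y) has_derivative (\<lambda>h. h)) (at z)" by (auto intro!: derivative_eq_intros)
        from has_derivative_compose[OF this has_derivative_ddir[OF diff]]
        have "((\<lambda>w. F (w + c y)) has_derivative (\<lambda>h. ddir h F (z + c y))) (at z)" .
        then have "((\<lambda>w. (F (w + c y) - F (z + c y) - ddir (w - z) F (z + c y)) /\<^sub>R norm (w - z)) \<longlongrightarrow> 0) (at z)"
          unfolding has_derivative_at_within by auto
        then have "((\<lambda>w. (F (w + c y) - F (z + c y) - ddir (w - z) F (z + c y)) /\<^sub>R norm (w - z)) \<circ> Y) \<longlonglongrightarrow> 0"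
          unfolding tendsto_at_iff_sequentially using Y by blast
        then have "(\<lambda>n. q n y) \<longlonglongrightarrow> 0" unfolding q_def comp_def by (simp add: divide_inverse mult.commute)
        then show "(\<lambda>n. q n y / norm y) \<longlonglongrightarrow> 0" by (rule tendsto_divide_zero)
      qed
    qed simp
    ultimately have "(\<lambda>n. (adv F (Y n) - adv F z - (\<Sum>b\<in>Basis. ((Y n - z) \<bullet> b) * adv (ddir b F) z)) /\<^sub>R norm (Y n - z)) \<longlonglongrightarrow> 0"
      using tendsto_divide_zero[of _ _ cone_const] by simp
    then show "((\<lambda>y. (adv F y - adv F z - (\<Sum>b\<in>Basis. ((y - z) \<bullet> b) * adv (ddir b F) z)) /\<^sub>R norm (y - z)) \<circ> X) \<longlonglongrightarrow> 0"
      unfolding Y_def comp_def by (rule LIMSEQ_offset)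
  qed
qed

text \<open>Averaging \<open>f'\<close> over the unit segments in direction \<open>b\<close> turns its integral into that of
  \<open>f (y + b) - f y\<close>. Singularities on a null set of lines are harmless.\<close>

lemma integral_directional_derivative_zero:
  fixes f f' :: "'a::euclidean_space \<Rightarrow> real" and b :: 'a
  assumes f: "integrable lborel f" and f': "integrable lborel f'"
    and ae: "AE y in lborel. \<forall>\<tau>. ((\<lambda>\<tau>. f (y + \<tau> *\<^sub>R b)) has_real_derivative f' (y + \<tau> *\<^sub>R b)) (at \<tau>)"
    and ct: "AE y in lborel. continuous_on UNIV (\<lambda>\<tau>. f' (y + \<tau> *\<^sub>R b))"
  shows "integral\<^sup>L lborel f' = 0"
proof -
  have shift: "integrable lborel (\<lambda>y. g (y + c))" "(LINT y|lborel. g (y + c)) = integral\<^sup>L lborel g"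
    if g: "integrable lborel g" for g :: "'a \<Rightarrow> real" and c
  proof -
    have [measurable]: "g \<in> borel_measurable borel" using borel_measurable_integrable[OF g] by simp
    have e: "distr lborel borel ((+) c) = lborel" using lborel_distr_plus by blast
    show "integrable lborel (\<lambda>y. g (y + c))"
      using g integrable_distr_eq[of "(+) c" lborel borel g] unfolding e by (simp add: add.commute)
    show "(LINT y|lborel. g (y + c)) = integral\<^sup>L lborel g"
      using integral_distr[of "(+) c" lborel borel g] unfolding e by (simp add: add.commute)
  qed
  have [measurable]: "f' \<in> borel_measurable borel" using borel_measurable_integrable[OF f'] by simp
  define I where "I \<tau> = (indicator {0..1} \<tau> :: real)" for \<tau> :: real
  have [measurable]: "I \<in> borel_measurable borel" unfolding I_def by measurable
  have inner: "integrable lborel (\<lambda>y. I \<tau> * f' (y + \<tau> *\<^sub>R b))" "(LINT y|lborel. I \<tau> * f' (y + \<tau> *\<^sub>R b)) = I \<tau> * integral\<^sup>L lborel f'" for \<tau>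
    using shift[OF f', of "\<tau> *\<^sub>R b"] by auto
  have abs: "(LINT y|lborel. norm (I \<tau> * f' (y + \<tau> *\<^sub>R b))) = I \<tau> * (LINT y|lborel. \<bar>f' y\<bar>)" for \<tau>
    using shift(2)[OF integrable_abs[OF f'], of "\<tau> *\<^sub>R b"] by (simp add: abs_mult I_def)
  have Iint: "integrable lborel I" unfolding I_def by (rule integrable_real_indicator) auto
  have int: "integrable (lborel \<Otimes>\<^sub>M lborel) (\<lambda>(\<tau>, y). I \<tau> * f' (y + \<tau> *\<^sub>R b))"
  proof (rule lborel_pair.Fubini_integrable)
    show "(\<lambda>(\<tau>, y). I \<tau> * f' (y + \<tau> *\<^sub>R b)) \<in> borel_measurable (lborel \<Otimes>\<^sub>M lborel)" by measurable
    show "integrable lborel (\<lambda>\<tau>. LINT y|lborel. norm (case (\<tau>, y) of (\<tau>, y) \<Rightarrow> I \<tau> * f' (y + \<tau> *\<^sub>R b)))"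
      using Iint by (simp only: prod.case abs) simp
    show "AE \<tau> in lborel. integrable lborel (\<lambda>y. case (\<tau>, y) of (\<tau>, y) \<Rightarrow> I \<tau> * f' (y + \<tau> *\<^sub>R b))"
      using inner(1) by simp
  qed
  have "(LINT y|lborel. LINT \<tau>|lborel. I \<tau> * f' (y + \<tau> *\<^sub>R b)) = (LINT \<tau>|lborel. LINT y|lborel. I \<tau> * f' (y + \<tau> *\<^sub>R b))"
    using lborel_pair.Fubini_integral[OF int] by simp
  also have "\<dots> = (LINT \<tau>|lborel. I \<tau> * integral\<^sup>L lborel f')" unfolding inner(2) ..
  also have "\<dots> = integral\<^sup>L lborel f'" unfolding I_def by simp
  finally have 1: "(LINT y|lborel. LINT \<tau>|lborel. I \<tau> * f' (y + \<tau> *\<^sub>R b)) = integral\<^sup>L lborel f'" .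
  have "(LINT y|lborel. LINT \<tau>|lborel. I \<tau> * f' (y + \<tau> *\<^sub>R b)) = (LINT y|lborel. f (y + b) - f y)"
  proof (rule integral_cong_AE)
    show "AE y in lborel. (LINT \<tau>|lborel. I \<tau> * f' (y + \<tau> *\<^sub>R b)) = f (y + b) - f y"
      using ae ct
    proof eventually_elim
      fix y assume d: "\<forall>\<tau>. ((\<lambda>\<tau>. f (y + \<tau> *\<^sub>R b)) has_real_derivative f' (y + \<tau> *\<^sub>R b)) (at \<tau>)"
        and c: "continuous_on UNIV (\<lambda>\<tau>. f' (y + \<tau> *\<^sub>R b))"
      have "(LINT \<tau>|lborel. indicator {0..1} \<tau> *\<^sub>R f' (y + \<tau> *\<^sub>R b)) = f (y + 1 *\<^sub>R b) - f (y + 0 *\<^sub>R b)"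
      proof (rule integral_FTC_Icc)
        show "((\<lambda>\<tau>. f (y + \<tau> *\<^sub>R b)) has_vector_derivative f' (y + \<tau> *\<^sub>R b)) (at \<tau> within {0..1})" for \<tau>
          using d by (meson has_field_derivative_at_within has_real_derivative_iff_has_vector_derivative)
        show "continuous_on {0..1} (\<lambda>\<tau>. f' (y + \<tau> *\<^sub>R b))" using c continuous_on_subset by blast
      qed simp
      then show "(LINT \<tau>|lborel. I \<tau> * f' (y + \<tau> *\<^sub>R b)) = f (y + b) - f y" unfolding I_def by simp
    qed
    have [measurable]: "f \<in> borel_measurable borel" using borel_measurable_integrable[OF f] by simp
    show "(\<lambda>y. f (y + b) - f y) \<in> borel_measurable lborel" by measurable
    show "(\<lambda>y. LINT \<tau>|lborel. I \<tau> * f' (y + \<tau> *\<^sub>R b)) \<in> borel_measurable lborel"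
      by (rule lborel.borel_measurable_lebesgue_integral) measurable
  qed
  also have "\<dots> = 0" using shift[OF f, of b] f by simp
  finally show ?thesis using 1 by simp
qed

text \<open>A line in direction \<open>b\<close> through the origin lies in the hyperplane
  orthogonal to another basis vector, and that hyperplane is a null set.\<close>

lemma AE_off_axis:
  fixes b :: "real ^ 3"
  assumes "b \<in> Basis"
  shows "AE y in lborel. \<forall>\<tau>. y + \<tau> *\<^sub>R b \<noteq> 0"
proof -
  have "\<exists>b'::real ^ 3. b' \<in> Basis \<and> b' \<noteq> b"
  proof (rule ccontr)
    assume "\<not> ?thesis"
    then have "(Basis :: (real ^ 3) set) \<subseteq> {b}" by blast
    then have "DIM(real ^ 3) \<le> card {b}" by (rule card_mono[rotated]) simp
    then show False by simp
  qed
  then obtain b' :: "real ^ 3" where b': "b' \<in> Basis" "b' \<noteq> b" by blast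
  have "negligible {y. b' \<bullet> y = 0}" using b' by (intro negligible_hyperplane) (auto simp: nonzero_Basis)
  then have "{y. b' \<bullet> y = 0} \<in> null_sets lebesgue" by (simp add: negligible_iff_null_sets)
  moreover have "{y. b' \<bullet> y = 0} \<in> sets borel" by measurable
  ultimately have "{y. b' \<bullet> y = 0} \<in> null_sets lborel" by (auto simp: null_sets_def)
  then have "AE y in lborel. b' \<bullet> y \<noteq> 0" by (auto dest: AE_not_in)
  then show ?thesis
  proof eventually_elim
    case (elim y)
    show ?case
    proof (intro allI notI)
      fix \<tau> assume "y + \<tau> *\<^sub>R b = 0"
      then have "b' \<bullet> (y + \<tau> *\<^sub>R b) = 0" by simp
      moreover have "b' \<bullet> b = 0" using b' assms by (simp add: inner_Basis)
      ultimately show False using elim by (simp add: inner_add_right)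
    qed
  qed
qed

section \<open>The divergence identity on the forward light cone\<close>

lemma ddir_split:
  fixes F :: "spacetime \<Rightarrow> real"
  assumes "F differentiable (at w)"
  shows "ddir (s, b) F w = s * ddir (1, 0) F w + ddir (0, b) F w"
proof -
  interpret bounded_linear "\<lambda>h. ddir h F w"
    using has_derivative_ddir[OF assms] has_derivative_bounded_linear by blast
  have "(s, b) = s *\<^sub>R (1, 0) + (0, b)" by simp
  then show ?thesis by (metis add scaleR real_scaleR_def)
qed

lemma DERIV_norm_line:
  fixes y b :: "'a::real_inner"
  assumes "y + \<tau> *\<^sub>R b \<noteq> 0"
  shows "((\<lambda>\<tau>. norm (y + \<tau> *\<^sub>R b)) has_real_derivative ((y + \<tau> *\<^sub>R b) \<bullet> b) / norm (y + \<tau> *\<^sub>R b)) (at \<tau>)"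
proof -
  have "((\<lambda>\<tau>. y + \<tau> *\<^sub>R b) has_derivative (\<lambda>h. h *\<^sub>R b)) (at \<tau>)" by (auto intro!: derivative_eq_intros)
  from has_derivative_compose[OF this has_derivative_norm[OF assms]]
  have "((\<lambda>\<tau>. norm (y + \<tau> *\<^sub>R b)) has_derivative (\<lambda>h. h *\<^sub>R b \<bullet> sgn (y + \<tau> *\<^sub>R b))) (at \<tau>)" .
  moreover have "(\<lambda>h. h *\<^sub>R b \<bullet> sgn (y + \<tau> *\<^sub>R b)) = (*) (((y + \<tau> *\<^sub>R b) \<bullet> b) / norm (y + \<tau> *\<^sub>R b))"
    by (rule ext) (simp add: sgn_div_norm inner_commute divide_inverse)
  ultimately show ?thesis unfolding has_field_derivative_def by simp
qed

lemma DERIV_cone_line: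
  fixes F :: "spacetime \<Rightarrow> real"
  assumes "\<And>w. F differentiable (at w)" "y + \<tau> *\<^sub>R b \<noteq> 0"
  shows "((\<lambda>\<tau>. F (z + (norm (y + \<tau> *\<^sub>R b), y + \<tau> *\<^sub>R b))) has_real_derivative
    ((y + \<tau> *\<^sub>R b) \<bullet> b) / norm (y + \<tau> *\<^sub>R b) * ddir (1, 0) F (z + (norm (y + \<tau> *\<^sub>R b), y + \<tau> *\<^sub>R b))
     + ddir (0, b) F (z + (norm (y + \<tau> *\<^sub>R b), y + \<tau> *\<^sub>R b))) (at \<tau>)"
proof -
  define n where "n = ((y + \<tau> *\<^sub>R b) \<bullet> b) / norm (y + \<tau> *\<^sub>R b)"
  have "((\<lambda>\<tau>. norm (y + \<tau> *\<^sub>R b)) has_derivative (*) n) (at \<tau>)"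
    using DERIV_norm_line[OF assms(2)] unfolding n_def has_field_derivative_def .
  then have "((\<lambda>\<tau>. z + (norm (y + \<tau> *\<^sub>R b), y + \<tau> *\<^sub>R b)) has_derivative (\<lambda>h. (n * h, h *\<^sub>R b))) (at \<tau>)"
    by (auto intro!: derivative_eq_intros has_derivative_Pair)
  from has_derivative_compose[OF this has_derivative_ddir[OF assms(1)]]
  have "((\<lambda>\<tau>. F (z + (norm (y + \<tau> *\<^sub>R b), y + \<tau> *\<^sub>R b))) has_derivative
     (\<lambda>h. ddir (n * h, h *\<^sub>R b) F (z + (norm (y + \<tau> *\<^sub>R b), y + \<tau> *\<^sub>R b)))) (at \<tau>)" .
  moreover have "ddir (n * h, h *\<^sub>R b) F w = (n * ddir (1, 0) F w + ddir (0, b) F w) * h" for h w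
  proof -
    interpret bounded_linear "\<lambda>h. ddir h F w"
      using has_derivative_ddir[OF assms(1)] has_derivative_bounded_linear by blast
    have "(n * h, h *\<^sub>R b) = h *\<^sub>R (n, b)" by simp
    then have "ddir (n * h, h *\<^sub>R b) F w = h * ddir (n, b) F w" by (metis scaleR real_scaleR_def)
    then show ?thesis by (simp add: ddir_split[OF assms(1), of n])
  qed
  ultimately show ?thesis unfolding has_field_derivative_def n_def[symmetric] by (simp add: mult_commute_abs)
qed

text \<open>Up to a multiple of \<open>F z\<close>, the divergence of this field in \<open>y\<close> is the integrand of the advanced
  potential of \<open>wave_op F\<close>. Subtracting the value at the vertex, damped at infinity, makes the field
  and its divergence integrable, so that no boundary term at the vertex has to be computed.\<close>

definition cone_field :: "(spacetime \<Rightarrow> real) \<Rightarrow> spacetime \<Rightarrow> real ^ 3 \<Rightarrow> real ^ 3 \<Rightarrow> real" where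
  "cone_field F z b y = ddir (0, b) F (z + (norm y, y)) / norm y
     - ddir (1, 0) F (z + (norm y, y)) * (y \<bullet> b) / (norm y)\<^sup>2
     + (F (z + (norm y, y)) - F z / (1 + norm y) ^ 3) * (y \<bullet> b) / (norm y) ^ 3"

text \<open>The derivative of \<open>cone_field\<close> along its own direction \<open>b\<close>,
  written out. The term with \<open>3 / (1 + \<rho>) ^ 4\<close> comes from differentiating the
  damping of the vertex value.\<close>

definition cone_field' :: "(spacetime \<Rightarrow> real) \<Rightarrow> spacetime \<Rightarrow> real ^ 3 \<Rightarrow> real ^ 3 \<Rightarrow> real" where
  "cone_field' F z b y = (let w = z + (norm y, y); \<rho> = norm y; s = y \<bullet> b in
     ((s / \<rho> * ddir (1, 0) (ddir (0, b) F) w + ddir (0, b) (ddir (0, b) F) w) / \<rho> - ddir (0, b) F w * s / \<rho> ^ 3)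
     - ((s / \<rho> * ddir (1, 0) (ddir (1, 0) F) w + ddir (0, b) (ddir (1, 0) F) w) * s / \<rho>\<^sup>2
         + ddir (1, 0) F w * (1 / \<rho>\<^sup>2 - 2 * s\<^sup>2 / \<rho> ^ 4))
     + ((s / \<rho> * ddir (1, 0) F w + ddir (0, b) F w + F z * (3 / (1 + \<rho>) ^ 4) * (s / \<rho>)) * s / \<rho> ^ 3
         + (F w - F z / (1 + \<rho>) ^ 3) * (1 / \<rho> ^ 3 - 3 * s\<^sup>2 / \<rho> ^ 5)))"

lemma DERIV_cone_field:
  fixes F :: "spacetime \<Rightarrow> real" and b y :: "real ^ 3"
  assumes F: "\<And>w. F differentiable (at w)" "\<And>e w. ddir e F differentiable (at w)"
    and b: "b \<in> Basis" and y: "y + \<tau> *\<^sub>R b \<noteq> 0"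
  shows "((\<lambda>\<tau>. cone_field F z b (y + \<tau> *\<^sub>R b)) has_real_derivative cone_field' F z b (y + \<tau> *\<^sub>R b)) (at \<tau>)"
proof -
  define w where "w \<tau> = z + (norm (y + \<tau> *\<^sub>R b), y + \<tau> *\<^sub>R b)" for \<tau>
  define \<rho> where "\<rho> \<tau> = norm (y + \<tau> *\<^sub>R b)" for \<tau>
  define s where "s \<tau> = (y + \<tau> *\<^sub>R b) \<bullet> b" for \<tau>
  have \<rho>0: "\<rho> \<tau> > 0" using y unfolding \<rho>_def by simp
  have d\<rho>: "(\<rho> has_real_derivative s \<tau> / \<rho> \<tau>) (at \<tau>)"
    using DERIV_norm_line[OF y] unfolding \<rho>_def s_def .
  have "s = (\<lambda>\<tau>. y \<bullet> b + \<tau>)" unfolding s_def using b by (simp add: inner_add_left)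
  then have ds: "(s has_real_derivative 1) (at \<tau>)" by (auto intro!: derivative_eq_intros)
  have dG: "((\<lambda>\<tau>. G (w \<tau>)) has_real_derivative s \<tau> / \<rho> \<tau> * ddir (1, 0) G (w \<tau>) + ddir (0, b) G (w \<tau>)) (at \<tau>)"
    if "\<And>w. G differentiable (at w)" for G
    using DERIV_cone_line[OF that y] unfolding w_def \<rho>_def s_def .
  \<comment> \<open>Working with the reciprocals of \<open>\<rho>\<close> and
    \<open>1 + \<rho>\<close> turns the quotient rules below into polynomial identities.\<close>
  have di: "((\<lambda>\<tau>. 1 / \<rho> \<tau>) has_real_derivative - (s \<tau> * (1 / \<rho> \<tau>) ^ 3)) (at \<tau>)"
    using DERIV_inverse'[OF d\<rho>] \<rho>0 by (simp add: inverse_eq_divide power3_eq_cube)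
  have dj: "((\<lambda>\<tau>. 1 / (1 + \<rho> \<tau>)) has_real_derivative - (s \<tau> / \<rho> \<tau> * (1 / (1 + \<rho> \<tau>))\<^sup>2)) (at \<tau>)"
    using DERIV_inverse'[OF DERIV_add[OF DERIV_const[of 1] d\<rho>]] \<rho>0 by (simp add: inverse_eq_divide power2_eq_square mult_ac)
  have A: "((\<lambda>\<tau>. g \<tau> / \<rho> \<tau>) has_real_derivative g' / \<rho> \<tau> - g \<tau> * s \<tau> / \<rho> \<tau> ^ 3) (at \<tau>)"
    if "(g has_real_derivative g') (at \<tau>)" for g g'
    using DERIV_mult[OF that di] by (simp add: power_one_over algebra_simps)
  have B: "((\<lambda>\<tau>. g \<tau> * s \<tau> / (\<rho> \<tau>)\<^sup>2) has_real_derivative g' * s \<tau> / (\<rho> \<tau>)\<^sup>2 + g \<tau> * (1 / (\<rho> \<tau>)\<^sup>2 - 2 * (s \<tau>)\<^sup>2 / \<rho> \<tau> ^ 4)) (at \<tau>)"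
    if "(g has_real_derivative g') (at \<tau>)" for g g'
  proof -
    define i where "i = 1 / \<rho> \<tau>"
    have "((\<lambda>\<tau>. g \<tau> * s \<tau> * (1 / \<rho> \<tau>)\<^sup>2) has_real_derivative g' * s \<tau> * i\<^sup>2 + g \<tau> * (i\<^sup>2 - 2 * (s \<tau>)\<^sup>2 * i ^ 4)) (at \<tau>)"
      by (rule derivative_eq_intros that di ds refl)+ (simp add: i_def[symmetric] algebra_simps eval_nat_numeral)
    then show ?thesis unfolding i_def by (simp add: power_one_over)
  qed
  have C: "((\<lambda>\<tau>. g \<tau> * s \<tau> / \<rho> \<tau> ^ 3) has_real_derivative g' * s \<tau> / \<rho> \<tau> ^ 3 + g \<tau> * (1 / \<rho> \<tau> ^ 3 - 3 * (s \<tau>)\<^sup>2 / \<rho> \<tau> ^ 5)) (at \<tau>)"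
    if "(g has_real_derivative g') (at \<tau>)" for g g'
  proof -
    define i where "i = 1 / \<rho> \<tau>"
    have "((\<lambda>\<tau>. g \<tau> * s \<tau> * (1 / \<rho> \<tau>) ^ 3) has_real_derivative g' * s \<tau> * i ^ 3 + g \<tau> * (i ^ 3 - 3 * (s \<tau>)\<^sup>2 * i ^ 5)) (at \<tau>)"
      by (rule derivative_eq_intros that di ds refl)+ (simp add: i_def[symmetric] algebra_simps eval_nat_numeral)
    then show ?thesis unfolding i_def by (simp add: power_one_over)
  qed
  have E: "((\<lambda>\<tau>. F (w \<tau>) - F z / (1 + \<rho> \<tau>) ^ 3) has_real_derivative
      s \<tau> / \<rho> \<tau> * ddir (1, 0) F (w \<tau>) + ddir (0, b) F (w \<tau>) + F z * (3 / (1 + \<rho> \<tau>) ^ 4) * (s \<tau> / \<rho> \<tau>)) (at \<tau>)"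
  proof -
    define j where "j = 1 / (1 + \<rho> \<tau>)"
    have "((\<lambda>\<tau>. F (w \<tau>) - F z * (1 / (1 + \<rho> \<tau>)) ^ 3) has_real_derivative
      s \<tau> / \<rho> \<tau> * ddir (1, 0) F (w \<tau>) + ddir (0, b) F (w \<tau>) + F z * (3 * j ^ 4) * (s \<tau> / \<rho> \<tau>)) (at \<tau>)"
      by (rule derivative_eq_intros dG[OF F(1)] dj refl)+ (simp add: j_def[symmetric] algebra_simps eval_nat_numeral)
    then show ?thesis unfolding j_def by (simp add: power_one_over)
  qed
  have "((\<lambda>\<tau>. ddir (0, b) F (w \<tau>) / \<rho> \<tau> - ddir (1, 0) F (w \<tau>) * s \<tau> / (\<rho> \<tau>)\<^sup>2 + (F (w \<tau>) - F z / (1 + \<rho> \<tau>) ^ 3) * s \<tau> / \<rho> \<tau> ^ 3)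
     has_real_derivative
     ((s \<tau> / \<rho> \<tau> * ddir (1, 0) (ddir (0, b) F) (w \<tau>) + ddir (0, b) (ddir (0, b) F) (w \<tau>)) / \<rho> \<tau> - ddir (0, b) F (w \<tau>) * s \<tau> / \<rho> \<tau> ^ 3)
     - ((s \<tau> / \<rho> \<tau> * ddir (1, 0) (ddir (1, 0) F) (w \<tau>) + ddir (0, b) (ddir (1, 0) F) (w \<tau>)) * s \<tau> / (\<rho> \<tau>)\<^sup>2
         + ddir (1, 0) F (w \<tau>) * (1 / (\<rho> \<tau>)\<^sup>2 - 2 * (s \<tau>)\<^sup>2 / \<rho> \<tau> ^ 4))
     + ((s \<tau> / \<rho> \<tau> * ddir (1, 0) F (w \<tau>) + ddir (0, b) F (w \<tau>) + F z * (3 / (1 + \<rho> \<tau>) ^ 4) * (s \<tau> / \<rho> \<tau>)) * s \<tau> / \<rho> \<tau> ^ 3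
         + (F (w \<tau>) - F z / (1 + \<rho> \<tau>) ^ 3) * (1 / \<rho> \<tau> ^ 3 - 3 * (s \<tau>)\<^sup>2 / \<rho> \<tau> ^ 5))) (at \<tau>)"
    by (intro DERIV_add DERIV_diff A[OF dG] B[OF dG] C[OF E] F)
  then show ?thesis unfolding cone_field_def cone_field'_def Let_def w_def \<rho>_def s_def .
qed

text \<open>In each direction the mixed derivatives and the spatial first derivatives cancel. On
  summing over the three directions, where the squared components of \<open>y\<close> add up to
  \<open>\<rho> ^ 2\<close>, the terms in \<open>T\<close> and \<open>P\<close> cancel as well. What
  survives is the wave operator and the derivative of the damping.\<close>

lemma sum_cone_field':
  fixes F :: "spacetime \<Rightarrow> real"
  assumes y: "y \<noteq> 0" and comm: "\<And>a b w. ddir a (ddir b F) w = ddir b (ddir a F) w"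
  shows "(\<Sum>b\<in>Basis. cone_field' F z b y) = wave_op F (z + (norm y, y)) / norm y + F z * (3 / ((1 + norm y) ^ 4 * (norm y)\<^sup>2))"
proof -
  define w where "w = z + (norm y, y)"
  define \<rho> where "\<rho> = norm y"
  have \<rho>: "\<rho> > 0" using y unfolding \<rho>_def by simp
  define P where "P = F w - F z / (1 + \<rho>) ^ 3"
  define q where "q = F z * (3 / (1 + \<rho>) ^ 4)"
  define T where "T = ddir (1, 0) F w"
  define TT where "TT = ddir (1, 0) (ddir (1, 0) F) w"
  \<comment> \<open>A purely algebraic identity for one direction, in which \<open>A\<close> stands
    for both orders of the mixed derivative.\<close>
  have gen: "((s / r * A + B) / r - f * s / r ^ 3) - ((s / r * TT + A) * s / r\<^sup>2 + T * (1 / r\<^sup>2 - 2 * s\<^sup>2 / r ^ 4))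
     + ((s / r * T + f + q * (s / r)) * s / r ^ 3 + P * (1 / r ^ 3 - 3 * s\<^sup>2 / r ^ 5))
     = B / r + s\<^sup>2 * (- TT / r ^ 3 + 3 * T / r ^ 4 + q / r ^ 4 - 3 * P / r ^ 5) + (P / r ^ 3 - T / r\<^sup>2)"
    for s r A B f TT T q P :: real
    by (simp add: divide_inverse power_inverse algebra_simps eval_nat_numeral)
  have each: "cone_field' F z b y = ddir (0, b) (ddir (0, b) F) w / \<rho> + (y \<bullet> b)\<^sup>2 * (- TT / \<rho> ^ 3 + 3 * T / \<rho> ^ 4 + q / \<rho> ^ 4 - 3 * P / \<rho> ^ 5)
      + (P / \<rho> ^ 3 - T / \<rho>\<^sup>2)" for b :: "real ^ 3"
    unfolding cone_field'_def Let_def P_def q_def T_def TT_def w_def \<rho>_def comm[of "(1, 0)" "(0, b)"] by (rule gen)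
  have sq: "(\<Sum>b\<in>Basis. (y \<bullet> b)\<^sup>2) = \<rho>\<^sup>2"
    unfolding \<rho>_def power2_norm_eq_inner by (subst euclidean_inner) (simp add: power2_eq_square)
  have "(\<Sum>b\<in>Basis. cone_field' F z b y) = (\<Sum>b\<in>Basis. ddir (0, b) (ddir (0, b) F) w) / \<rho>
     + \<rho>\<^sup>2 * (- TT / \<rho> ^ 3 + 3 * T / \<rho> ^ 4 + q / \<rho> ^ 4 - 3 * P / \<rho> ^ 5) + 3 * (P / \<rho> ^ 3 - T / \<rho>\<^sup>2)"
    unfolding each sum.distrib sum_distrib_right[symmetric] sum_divide_distrib[symmetric] sq by simp
  also have "\<rho>\<^sup>2 * (- TT / \<rho> ^ 3 + 3 * T / \<rho> ^ 4 + q / \<rho> ^ 4 - 3 * P / \<rho> ^ 5) = - TT / \<rho> + 3 * T / \<rho>\<^sup>2 + q / \<rho>\<^sup>2 - 3 * P / \<rho> ^ 3"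
  proof -
    have "\<rho>\<^sup>2 * (X / \<rho> ^ 3) = X / \<rho>" "\<rho>\<^sup>2 * (X / \<rho> ^ 4) = X / \<rho>\<^sup>2" "\<rho>\<^sup>2 * (X / \<rho> ^ 5) = X / \<rho> ^ 3" for X
      using \<rho> by (simp_all add: eval_nat_numeral)
    then show ?thesis by (simp only: ring_distribs)
  qed
  also have "(\<Sum>b\<in>Basis. ddir (0, b) (ddir (0, b) F) w) / \<rho> + (- TT / \<rho> + 3 * T / \<rho>\<^sup>2 + q / \<rho>\<^sup>2 - 3 * P / \<rho> ^ 3) + 3 * (P / \<rho> ^ 3 - T / \<rho>\<^sup>2)
      = (- TT + (\<Sum>b\<in>Basis. ddir (0, b) (ddir (0, b) F) w)) / \<rho> + q / \<rho>\<^sup>2"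
    by (simp add: add_divide_distrib diff_divide_distrib)
  also have "\<dots> = wave_op F w / \<rho> + F z * (3 / ((1 + \<rho>) ^ 4 * \<rho>\<^sup>2))"
    unfolding wave_op_def TT_def q_def by simp
  finally show ?thesis unfolding w_def \<rho>_def .
qed

lemma finite_uniform_bound:
  fixes f :: "'i \<Rightarrow> 'a \<Rightarrow> real"
  assumes "finite I" "\<And>w. 0 \<le> g w" "\<And>i. i \<in> I \<Longrightarrow> \<exists>C. \<forall>w. \<bar>f i w\<bar> \<le> C * g w"
  obtains C where "C \<ge> 0" "\<And>i w. i \<in> I \<Longrightarrow> \<bar>f i w\<bar> \<le> C * g w"
proof -
  obtain c where c: "\<And>i w. i \<in> I \<Longrightarrow> \<bar>f i w\<bar> \<le> c i * g w" using assms(3) by metis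
  show ?thesis
  proof (rule that[of "\<Sum>i\<in>I. \<bar>c i\<bar>"])
    show "(\<Sum>i\<in>I. \<bar>c i\<bar>) \<ge> 0" by (intro sum_nonneg) auto
    fix i w assume i: "i \<in> I"
    have "c i \<le> (\<Sum>i\<in>I. \<bar>c i\<bar>)" using member_le_sum[OF i, of "\<lambda>i. \<bar>c i\<bar>"] assms(1) by force
    then show "\<bar>f i w\<bar> \<le> (\<Sum>i\<in>I. \<bar>c i\<bar>) * g w"
      using order_trans[OF c[OF i] mult_right_mono[OF _ assms(2)]] by blast
  qed
qed

lemma adv_sum:
  assumes "finite I" and G: "\<And>i. i \<in> I \<Longrightarrow> continuous_on UNIV (G i)" "\<And>i w. i \<in> I \<Longrightarrow> \<bar>G i w\<bar> \<le> C * cone_wt w" "C \<ge> 0"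
  shows "adv (\<lambda>w. \<Sum>i\<in>I. c i * G i w) z = (\<Sum>i\<in>I. c i * adv (G i) z)"
proof -
  have "has_bochner_integral lborel (\<lambda>y. \<Sum>i\<in>I. c i * (G i (z + (norm y, y)) / norm y))
     (\<Sum>i\<in>I. c i * (LINT y|lborel. G i (z + (norm y, y)) / norm y))"
    by (intro has_bochner_integral_sum has_bochner_integral_mult_right has_bochner_integral_integrable integrable_cone[OF G])
  from has_bochner_integral_integral_eq[OF this] show ?thesis
    unfolding adv_def by (simp add: sum_divide_distrib)
qed

text \<open>The cone integral commutes with translations of spacetime, hence with derivatives. The
  weight is left general because the sources below are controlled by
  \<open>src_weight\<close>.\<close>

lemma adv_differentiable_ddir:
  fixes F :: "spacetime \<Rightarrow> real"
  assumes F: "wbdd (Suc k) w F" and w: "\<And>z. 0 \<le> w z" "\<And>z. w z \<le> cone_wt z"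
  shows "adv F differentiable (at z)" "ddir e (adv F) = adv (ddir e F)"
proof -
  have F1: "wbdd (Suc k) cone_wt F" by (rule wcauchy_mono[OF F w(1), of 1]) (use w in auto)
  have dF: "F differentiable (at z)" for z by (rule wcauchy_diff[OF F])
  have b: "\<exists>C. \<forall>z. \<bar>G z\<bar> \<le> C * cone_wt z" if "wbdd j cone_wt G" for j and G :: "spacetime \<Rightarrow> real"
    using wbdd_bound[OF that cone_wt_nonneg] by metis
  have db: "wbdd k cone_wt (ddir e F)" for e by (rule wcauchy_ddir[OF F1])
  obtain C1 where C1: "C1 > 0" "\<And>w. \<bar>F w\<bar> \<le> C1 * cone_wt w" using wbdd_bound[OF F1 cone_wt_nonneg] by metis
  obtain C2 where C2: "C2 \<ge> 0" "\<And>e w. e \<in> Basis \<Longrightarrow> \<bar>ddir e F w\<bar> \<le> C2 * cone_wt w"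
    by (rule finite_uniform_bound[of "Basis :: spacetime set" cone_wt "\<lambda>e. ddir e F"]) (use cone_wt_nonneg b[OF db] in auto)
  define C where "C = C1 + C2"
  have C: "C \<ge> 0" "\<bar>F w\<bar> \<le> C * cone_wt w" "e \<in> Basis \<Longrightarrow> \<bar>ddir e F w\<bar> \<le> C * cone_wt w" for e w
    using C1(1) C2(1) order_trans[OF C1(2)[of w] mult_right_mono[of C1 C "cone_wt w"]]
      order_trans[OF C2(2)[of e w] mult_right_mono[of C2 C "cone_wt w"]] cone_wt_nonneg[of w]
    unfolding C_def by auto
  have ct: "continuous_on UNIV F" "continuous_on UNIV (ddir e F)" for e
    using wcauchy_imp_cauchy_wrt[OF F1] wcauchy_imp_cauchy_wrt[OF db] unfolding cauchy_wrt_def by auto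
  note hd = has_derivative_adv[OF ct(1) C(2,1) dF ct(2) C(3)]
  show "adv F differentiable (at z)" using hd differentiable_def by blast
  show "ddir e (adv F) = adv (ddir e F)"
  proof
    fix z
    have "ddir e (adv F) z = (\<Sum>b\<in>Basis. (e \<bullet> b) * adv (ddir b F) z)" by (rule ddir_eq[OF hd])
    also have "\<dots> = adv (\<lambda>w. \<Sum>b\<in>Basis. (e \<bullet> b) * ddir b F w) z"
      using C ct by (intro adv_sum[symmetric]) auto
    also have "(\<lambda>w. \<Sum>b\<in>Basis. (e \<bullet> b) * ddir b F w) = ddir e F"
      by (rule ext, rule ddir_linear_at[symmetric, OF dF])
    finally show "ddir e (adv F) z = adv (ddir e F) z" .
  qed
qed

lemma Basis_spacetime: "(Basis :: spacetime set) = insert (1, 0) (Pair 0 ` Basis)"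
  by (auto simp: Basis_prod_def)

text \<open>Writing the wave operator as a signed sum over the whole spacetime basis makes
  \<open>adv_sum\<close> applicable to it at once.\<close>

lemma wave_op_Basis:
  "wave_op f z = (\<Sum>e\<in>Basis. (if e = (1, 0) then -1 else 1) * ddir e (ddir e f) z)"
proof -
  have "(\<Sum>e\<in>Basis. (if e = (1, 0) then -1 else 1) * ddir e (ddir e f) z)
     = - ddir (1, 0) (ddir (1, 0) f) z + (\<Sum>e\<in>Pair 0 ` Basis. (if e = (1, 0) then -1 else 1) * ddir e (ddir e f) z)"
    unfolding Basis_spacetime by (subst sum.insert) auto
  also have "(\<Sum>e\<in>Pair 0 ` (Basis :: (real ^ 3) set). (if e = (1, 0) then -1 else 1) * ddir e (ddir e f) z)
     = (\<Sum>b\<in>Basis. ddir (0, b) (ddir (0, b) f) z)"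
    by (subst sum.reindex) (auto simp: inj_on_def)
  finally show ?thesis unfolding wave_op_def by simp
qed

text \<open>Near the vertex the difference vanishes linearly by the mean value inequality; far away
  both terms decay like the weight. The resulting factor \<open>norm y\<close> is what makes
  \<open>cone_field\<close> and its divergence integrable.\<close>

lemma cone_difference_bound:
  fixes F :: "spacetime \<Rightarrow> real"
  assumes dF: "\<And>w. F differentiable (at w)" and C: "C \<ge> 0" "\<And>w. \<bar>F w\<bar> \<le> C * cone_wt w" "\<And>e w. e \<in> Basis \<Longrightarrow> \<bar>ddir e F w\<bar> \<le> C * cone_wt w"
    and A: "A = C * (1 + norm (snd z)) ^ 3"
  shows "\<bar>F (z + (norm y, y)) - F z / (1 + norm y) ^ 3\<bar> \<le> 90 * A * norm y / (1 + norm y) ^ 3"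
proof -
  define \<rho> where "\<rho> = norm y"
  have \<rho>: "\<rho> \<ge> 0" unfolding \<rho>_def by simp
  have "1 \<le> (1 + norm (snd z)) ^ 3" by (rule one_le_power) simp
  then have AC: "C \<le> A" unfolding A using mult_left_mono[of 1 "(1 + norm (snd z)) ^ 3" C] C(1) by simp
  have Fz: "\<bar>F z\<bar> \<le> C" using order_trans[OF C(2)[of z] mult_left_mono[OF cone_wt_le_1 C(1)]] by simp
  show ?thesis
  proof (cases "\<rho> \<le> 1")
    case True
    \<comment> \<open>Four basis directions give the Lipschitz constant \<open>4 * C\<close>, and
      the displacement \<open>(norm y, y)\<close> has length at most
      \<open>2 * \<rho>\<close>.\<close>
    have "norm (F (z + (norm y, y)) - F z) \<le> (4 * C) * norm ((z + (norm y, y)) - z)"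
    proof (rule differentiable_bound[where S = UNIV and f' = "\<lambda>w h. ddir h F w"])
      show "(F has_derivative (\<lambda>h. ddir h F w)) (at w within UNIV)" for w using has_derivative_ddir[OF dF] by simp
      show "onorm (\<lambda>h. ddir h F w) \<le> 4 * C" for w
      proof (rule onorm_bound)
        fix h :: spacetime
        have "\<bar>ddir b F w\<bar> \<le> C" if "b \<in> Basis" for b
          using order_trans[OF C(3)[OF that] mult_left_mono[OF cone_wt_le_1 C(1)]] by simp
        note b = this
        have "norm (ddir h F w) = norm (\<Sum>b\<in>Basis. (h \<bullet> b) * ddir b F w)" by (subst ddir_linear_at[OF dF]) simp
        also have "\<dots> \<le> (\<Sum>b\<in>(Basis :: spacetime set). norm h * C)" unfolding real_norm_def
          by (rule order_trans[OF sum_abs], intro sum_mono, unfold abs_mult, intro mult_mono Basis_le_norm b) auto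
        finally show "norm (ddir h F w) \<le> 4 * C * norm h" by (simp add: mult_ac)
      qed (use C in simp)
    qed auto
    also have "norm ((z + (norm y, y)) - z) \<le> \<rho> + \<rho>"
      using norm_Pair_le[of "norm y" y] unfolding \<rho>_def by simp
    finally have 1: "\<bar>F (z + (norm y, y)) - F z\<bar> \<le> 8 * C * \<rho>" using C(1) by (simp add: mult_left_mono)
    have p: "(1 + \<rho>) ^ 3 > 0" using \<rho> by simp
    have "(1 - 3 * \<rho>) * (1 + \<rho>) ^ 3 = 1 - (6 * \<rho>\<^sup>2 + 8 * \<rho> ^ 3 + 3 * \<rho> ^ 4)" by (simp add: eval_nat_numeral algebra_simps)
    also have "\<dots> \<le> 1"
    proof -
      have "0 \<le> 6 * \<rho>\<^sup>2 + 8 * \<rho> ^ 3 + 3 * \<rho> ^ 4" by (intro add_nonneg_nonneg) (use \<rho> in auto)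
      then show ?thesis by linarith
    qed
    finally have 2: "1 - 1 / (1 + \<rho>) ^ 3 \<le> 3 * \<rho>" using p by (simp add: field_simps)
    have 3: "0 \<le> 1 - 1 / (1 + \<rho>) ^ 3" using \<rho> p one_le_power[of "1 + \<rho>" 3] by (simp add: field_simps)
    have "F (z + (norm y, y)) - F z / (1 + norm y) ^ 3 = (F (z + (norm y, y)) - F z) + F z * (1 - 1 / (1 + \<rho>) ^ 3)"
      unfolding \<rho>_def by (simp add: algebra_simps)
    moreover have "\<bar>F z * (1 - 1 / (1 + \<rho>) ^ 3)\<bar> \<le> C * (3 * \<rho>)"
      unfolding abs_mult using 2 3 Fz C(1) by (intro mult_mono) auto
    ultimately have "\<bar>F (z + (norm y, y)) - F z / (1 + norm y) ^ 3\<bar> \<le> 11 * C * \<rho>" using 1 by linarith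
    also have "\<dots> \<le> 11 * A * \<rho>" using AC \<rho> by (intro mult_right_mono) auto
    \<comment> \<open>The coefficient 11 is the sum of 8 and 3 from the two contributions above;
      since \<open>\<rho> \<le> 1\<close>, the constant 90 only has to exceed
      \<open>11 * 2 ^ 3\<close>.\<close>
    also have "\<dots> \<le> 90 * A * \<rho> / (1 + \<rho>) ^ 3"
    proof -
      have "(1 + \<rho>) ^ 3 \<le> (1 + 1) ^ 3" using True \<rho> by (intro power_mono) auto
      then have "11 * (1 + \<rho>) ^ 3 \<le> 90" by simp
      from mult_left_mono[OF this, of "A * \<rho>"] show ?thesis using p AC C(1) \<rho> by (simp add: field_simps)
    qed
    finally show ?thesis unfolding \<rho>_def .
  next
    case False
    have "\<bar>F (z + (norm y, y))\<bar> \<le> A / (1 + \<rho>) ^ 3"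
      using order_trans[OF C(2) mult_left_mono[OF cone_wt_shift C(1)]] unfolding A \<rho>_def by simp
    moreover have "\<bar>F z / (1 + norm y) ^ 3\<bar> \<le> A / (1 + \<rho>) ^ 3"
      unfolding \<rho>_def abs_divide using Fz AC by (simp add: divide_right_mono)
    ultimately have "\<bar>F (z + (norm y, y)) - F z / (1 + norm y) ^ 3\<bar> \<le> A / (1 + \<rho>) ^ 3 + A / (1 + \<rho>) ^ 3" by linarith
    also have "\<dots> = 2 * A / (1 + \<rho>) ^ 3" by simp
    also have "\<dots> \<le> 90 * A * \<rho> / (1 + \<rho>) ^ 3"
    proof (rule divide_right_mono)
      have "2 * A * 1 \<le> 90 * A * \<rho>" using False AC C(1) by (intro mult_mono) auto
      then show "2 * A \<le> 90 * A * \<rho>" by simp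
    qed (use \<rho> in simp)
    finally show ?thesis unfolding \<rho>_def .
  qed
qed

text \<open>Writing \<open>y \<bullet> b\<close> as \<open>\<sigma> * \<rho>\<close> with
  \<open>\<sigma>\<close> at most 1 in modulus, and using the factor \<open>\<rho>\<close> in the
  bound for \<open>P\<close>, leaves a first-order singularity in the field and a second-order one
  in its derivative. \<open>cone_majorant\<close> dominates both. The numerical constants are
  generous.\<close>

lemma cone_field_bounds:
  fixes F :: "spacetime \<Rightarrow> real"
  assumes dF: "\<And>w. F differentiable (at w)" and C: "C \<ge> 0" "\<And>w. \<bar>F w\<bar> \<le> C * cone_wt w" "\<And>e w. e \<in> Basis \<Longrightarrow> \<bar>ddir e F w\<bar> \<le> C * cone_wt w"
     "\<And>e e' w. e \<in> Basis \<Longrightarrow> e' \<in> Basis \<Longrightarrow> \<bar>ddir e (ddir e' F) w\<bar> \<le> C * cone_wt w"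
    and A: "A = C * (1 + norm (snd z)) ^ 3" and b: "b \<in> Basis"
  shows "\<bar>cone_field F z b y\<bar> \<le> 100 * A * cone_majorant y" "\<bar>cone_field' F z b y\<bar> \<le> 400 * A * cone_majorant y"
proof -
  define w where "w = z + (norm y, y)"
  define \<rho> where "\<rho> = norm y"
  define e3 where "e3 = 1 / (1 + \<rho>) ^ 3"
  define \<sigma> where "\<sigma> = (y \<bullet> b) / \<rho>"
  have \<rho>: "\<rho> \<ge> 0" unfolding \<rho>_def by simp
  have e3: "e3 \<ge> 0" using \<rho> unfolding e3_def by simp
  have A0: "A \<ge> 0" unfolding A using C(1) by simp
  have \<sigma>: "\<bar>\<sigma>\<bar> \<le> 1" using Basis_le_norm[OF b, of y] unfolding \<sigma>_def \<rho>_def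
    by (cases "y = 0") (auto simp: divide_le_eq)
  have s: "y \<bullet> b = \<sigma> * \<rho>" unfolding \<sigma>_def \<rho>_def by (cases "y = 0") auto
  have t0: "(1, 0) \<in> (Basis :: spacetime set)" "(0, b) \<in> (Basis :: spacetime set)" using b unfolding Basis_spacetime by auto
  have bd: "\<bar>G w\<bar> \<le> A * e3" if "\<And>w. \<bar>G w\<bar> \<le> C * cone_wt w" for G
    using order_trans[OF that mult_left_mono[OF cone_wt_shift C(1)]] unfolding A w_def e3_def \<rho>_def by simp
  define P where "P = F w - F z / (1 + \<rho>) ^ 3"
  have P: "\<bar>P\<bar> \<le> 90 * A * \<rho> * e3"
    using cone_difference_bound[OF dF C(1-3) A, of y] unfolding P_def w_def \<rho>_def e3_def by simp
  define T where "T = ddir (1, 0) F w"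
  define X where "X = ddir (0, b) F w"
  have TX: "\<bar>T\<bar> \<le> A * e3" "\<bar>X\<bar> \<le> A * e3" unfolding T_def X_def by (rule bd, rule C(3), rule t0)+
  define TT TX' XT XX where "TT = ddir (1, 0) (ddir (1, 0) F) w" and "TX' = ddir (1, 0) (ddir (0, b) F) w"
    and "XT = ddir (0, b) (ddir (1, 0) F) w" and "XX = ddir (0, b) (ddir (0, b) F) w"
  have d2: "\<bar>TT\<bar> \<le> A * e3" "\<bar>TX'\<bar> \<le> A * e3" "\<bar>XT\<bar> \<le> A * e3" "\<bar>XX\<bar> \<le> A * e3"
    unfolding TT_def TX'_def XT_def XX_def by (rule bd, rule C(4), (rule t0)+)+
  define q where "q = F z * (3 / (1 + \<rho>) ^ 4)"
  have q: "\<bar>q\<bar> \<le> 3 * A * e3"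
  proof -
    have "\<bar>F z\<bar> \<le> C" using order_trans[OF C(2)[of z] mult_left_mono[OF cone_wt_le_1 C(1)]] by simp
    also have "C \<le> A" using mult_left_mono[OF one_le_power[of "1 + norm (snd z)" 3] C(1)] unfolding A by simp
    finally have Fz: "\<bar>F z\<bar> \<le> A" .
    have "(1 + \<rho>) ^ 3 \<le> (1 + \<rho>) ^ 4" using \<rho> by (intro power_increasing) auto
    then have "3 / (1 + \<rho>) ^ 4 \<le> 3 * e3" unfolding e3_def using \<rho> by (simp add: frac_le)
    then have "\<bar>q\<bar> \<le> A * (3 * e3)" unfolding q_def abs_mult using Fz \<rho> A0 by (intro mult_mono) auto
    then show ?thesis by simp
  qed
  have cm: "e3 / \<rho> \<le> cone_majorant y" "e3 / \<rho>\<^sup>2 \<le> cone_majorant y"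
    using cone_majorant_ge[of y] unfolding e3_def \<rho>_def by auto
  have mul: "\<bar>\<sigma> * Y\<bar> \<le> B" if "\<bar>Y\<bar> \<le> B" for Y B
    using mult_mono[OF \<sigma> that] by (simp add: abs_mult)
  show "\<bar>cone_field F z b y\<bar> \<le> 100 * A * cone_majorant y"
  proof (cases "y = 0")
    case True then show ?thesis unfolding cone_field_def using A0 cone_majorant_nonneg[of y] by simp
  next
    case False
    then have \<rho>p: "\<rho> > 0" unfolding \<rho>_def by simp
    have "cone_field F z b y = (X - \<sigma> * T + \<sigma> * (P / \<rho>)) / \<rho>"
      unfolding cone_field_def s X_def T_def P_def w_def \<rho>_def[symmetric] using \<rho>p by (simp add: field_simps eval_nat_numeral)
    moreover have "\<bar>P / \<rho>\<bar> \<le> 90 * A * e3" using P \<rho>p by (simp add: abs_divide divide_le_eq mult_ac)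
    then have "\<bar>X - \<sigma> * T + \<sigma> * (P / \<rho>)\<bar> \<le> 100 * A * e3"
      using TX(2) mul[OF TX(1)] mul[of "P / \<rho>" "90 * A * e3"] mult_nonneg_nonneg[OF A0 e3] by linarith
    ultimately have "\<bar>cone_field F z b y\<bar> \<le> 100 * A * e3 / \<rho>" using \<rho>p by (simp add: abs_divide divide_right_mono)
    also have "\<dots> = 100 * A * (e3 / \<rho>)" by simp
    also have "\<dots> \<le> 100 * A * cone_majorant y" using A0 by (intro mult_left_mono cm) auto
    finally show ?thesis .
  qed
  show "\<bar>cone_field' F z b y\<bar> \<le> 400 * A * cone_majorant y"
  proof (cases "y = 0")
    case True then show ?thesis unfolding cone_field'_def using A0 cone_majorant_nonneg[of y] by simp
  next
    case False
    then have \<rho>p: "\<rho> > 0" unfolding \<rho>_def by simp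
    define M where "M = A * e3"
    have M: "M \<ge> 0" unfolding M_def using A0 e3 by simp
    have r: "\<sigma> * \<rho> / \<rho> = \<sigma>" "x * (\<sigma> * \<rho>) / \<rho>\<^sup>2 = x * \<sigma> / \<rho>" "x * (\<sigma> * \<rho>) / \<rho> ^ 3 = x * \<sigma> / \<rho>\<^sup>2"
      "x * (\<sigma> * \<rho>)\<^sup>2 / \<rho> ^ 4 = x * \<sigma>\<^sup>2 / \<rho>\<^sup>2" "x * (\<sigma> * \<rho>)\<^sup>2 / \<rho> ^ 5 = x * \<sigma>\<^sup>2 / \<rho> ^ 3" for x
      using \<rho>p by (simp_all add: eval_nat_numeral)
    have "cone_field' F z b y = (\<sigma> * TX' + XX - \<sigma> * (\<sigma> * TT) - \<sigma> * XT) / \<rho>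
       + (- (\<sigma> * X) - T + 2 * (\<sigma> * (\<sigma> * T)) + \<sigma> * (\<sigma> * T) + \<sigma> * X + \<sigma> * (\<sigma> * q) + P / \<rho> - 3 * (\<sigma> * (\<sigma> * (P / \<rho>)))) / \<rho>\<^sup>2"
      unfolding cone_field'_def Let_def s X_def T_def P_def TT_def TX'_def XT_def XX_def q_def w_def \<rho>_def[symmetric] r
      by (simp add: divide_inverse power_inverse algebra_simps) (simp add: eval_nat_numeral)
    note cf = this
    have "\<bar>P / \<rho>\<bar> \<le> 90 * M" using P \<rho>p unfolding M_def by (simp add: abs_divide divide_le_eq mult_ac)
    note Pb = this
    \<comment> \<open>The summands contribute at most
      \<open>1 + 1 + 2 + 1 + 1 + 3 + 90 + 270\<close> multiples of \<open>M\<close>.\<close>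
    have "\<bar>- (\<sigma> * X) - T + 2 * (\<sigma> * (\<sigma> * T)) + \<sigma> * (\<sigma> * T) + \<sigma> * X + \<sigma> * (\<sigma> * q) + P / \<rho> - 3 * (\<sigma> * (\<sigma> * (P / \<rho>)))\<bar> \<le> 390 * M"
      using TX(1) mul[OF TX(2)] mul[OF mul[OF TX(1)]] mul[OF mul[OF q]] Pb mul[OF mul[OF Pb]] M unfolding M_def by linarith
    then have 2: "\<bar>(- (\<sigma> * X) - T + 2 * (\<sigma> * (\<sigma> * T)) + \<sigma> * (\<sigma> * T) + \<sigma> * X + \<sigma> * (\<sigma> * q) + P / \<rho> - 3 * (\<sigma> * (\<sigma> * (P / \<rho>)))) / \<rho>\<^sup>2\<bar> \<le> 390 * M / \<rho>\<^sup>2"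
      unfolding abs_divide using \<rho>p by (simp add: divide_right_mono)
    have "\<bar>\<sigma> * TX' + XX - \<sigma> * (\<sigma> * TT) - \<sigma> * XT\<bar> \<le> 4 * M"
      using mul[OF d2(2)] d2(4) mul[OF mul[OF d2(1)]] mul[OF d2(3)] unfolding M_def by linarith
    then have 1: "\<bar>(\<sigma> * TX' + XX - \<sigma> * (\<sigma> * TT) - \<sigma> * XT) / \<rho>\<bar> \<le> 4 * M / \<rho>"
      unfolding abs_divide using \<rho>p by (simp add: divide_right_mono)
    have "\<bar>cone_field' F z b y\<bar> \<le> 4 * M / \<rho> + 390 * M / \<rho>\<^sup>2"
      unfolding cf by (rule order_trans[OF abs_triangle_ineq add_mono[OF 1 2]])
    also have "\<dots> = 4 * (M / \<rho>) + 390 * (M / \<rho>\<^sup>2)" by simp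
    also have "\<dots> \<le> 4 * (A * cone_majorant y) + 390 * (A * cone_majorant y)"
      using mult_left_mono[OF cm(1) A0] mult_left_mono[OF cm(2) A0] unfolding M_def by (intro add_mono mult_left_mono) auto
    also have "\<dots> \<le> 400 * A * cone_majorant y" using mult_nonneg_nonneg[OF A0 cone_majorant_nonneg[of y]] by simp
    finally show ?thesis .
  qed
qed

lemma borel_measurable_cone_fields:
  fixes F :: "spacetime \<Rightarrow> real"
  assumes "continuous_on UNIV F" "\<And>e. continuous_on UNIV (ddir e F)" "\<And>e e'. continuous_on UNIV (ddir e (ddir e' F))"
  shows "cone_field F z b \<in> borel_measurable borel" "cone_field' F z b \<in> borel_measurable borel"
proof -
  note [measurable] = borel_measurable_cone[OF assms(1)] borel_measurable_cone[OF assms(2)] borel_measurable_cone[OF assms(3)]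
  show "cone_field F z b \<in> borel_measurable borel" unfolding cone_field_def by measurable
  show "cone_field' F z b \<in> borel_measurable borel" unfolding cone_field'_def Let_def by measurable
qed

text \<open>A representation formula of Kirchhoff type. The directional derivatives in
  \<open>sum_cone_field'\<close> each integrate to zero, so the cone integral of
  \<open>wave_op F\<close> must balance \<open>F z * cone_const\<close>; the normalisation of
  \<open>adv\<close> divides by this constant.\<close>

lemma adv_wave_op:
  fixes F :: "spacetime \<Rightarrow> real"
  assumes F: "wbdd (Suc (Suc 0)) cone_wt F"
  shows "adv (wave_op F) z = - F z"
proof -
  have dF: "F differentiable (at w)" for w by (rule wcauchy_diff[OF F])
  have F1: "wbdd (Suc 0) cone_wt (ddir e F)" for e by (rule wcauchy_ddir[OF F])
  have ddF: "ddir e F differentiable (at w)" for e w by (rule wcauchy_diff[OF F1])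
  have F2: "wbdd 0 cone_wt (ddir e (ddir e' F))" for e e' by (rule wcauchy_ddir[OF F1])
  have ct: "continuous_on UNIV F" "continuous_on UNIV (ddir e F)" "continuous_on UNIV (ddir e (ddir e' F))" for e e'
    using wcauchy_imp_cauchy_wrt[OF F] wcauchy_imp_cauchy_wrt[OF F1] wcauchy_imp_cauchy_wrt[OF F2] unfolding cauchy_wrt_def by auto
  have bd: "\<exists>C. \<forall>z. \<bar>G z\<bar> \<le> C * cone_wt z" if "wbdd j cone_wt G" for j and G :: "spacetime \<Rightarrow> real"
    using wbdd_bound[OF that cone_wt_nonneg] by metis
  obtain C1 where C1: "C1 > 0" "\<And>w. \<bar>F w\<bar> \<le> C1 * cone_wt w" using wbdd_bound[OF F cone_wt_nonneg] by metis
  obtain C2 where C2: "C2 \<ge> 0" "\<And>e w. e \<in> Basis \<Longrightarrow> \<bar>ddir e F w\<bar> \<le> C2 * cone_wt w"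
    by (rule finite_uniform_bound[of "Basis :: spacetime set" cone_wt "\<lambda>e. ddir e F"]) (use cone_wt_nonneg bd[OF F1] in auto)
  obtain C3 where C3: "C3 \<ge> 0" "\<And>p w. p \<in> Basis \<times> Basis \<Longrightarrow> \<bar>ddir (fst p) (ddir (snd p) F) w\<bar> \<le> C3 * cone_wt w"
    by (rule finite_uniform_bound[of "(Basis \<times> Basis) :: (spacetime \<times> spacetime) set" cone_wt "\<lambda>p. ddir (fst p) (ddir (snd p) F)"])
      (use cone_wt_nonneg bd[OF F2] in auto)
  define C where "C = C1 + C2 + C3"
  have le: "C1 * cone_wt w \<le> C * cone_wt w" "C2 * cone_wt w \<le> C * cone_wt w" "C3 * cone_wt w \<le> C * cone_wt w" for w
    using C1(1) C2(1) C3(1) cone_wt_nonneg[of w] unfolding C_def by (auto intro!: mult_right_mono)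
  have C: "C \<ge> 0" "\<And>w. \<bar>F w\<bar> \<le> C * cone_wt w" "\<And>e w. e \<in> Basis \<Longrightarrow> \<bar>ddir e F w\<bar> \<le> C * cone_wt w"
     "\<And>e e' w. e \<in> Basis \<Longrightarrow> e' \<in> Basis \<Longrightarrow> \<bar>ddir e (ddir e' F) w\<bar> \<le> C * cone_wt w"
    subgoal using C1(1) C2(1) C3(1) unfolding C_def by simp
    subgoal for w using order_trans[OF C1(2) le(1)] .
    subgoal for e w using order_trans[OF C2(2) le(2)] .
    subgoal for e e' w using order_trans[OF C3(2)[of "(e, e')"] le(3)] by simp
    done
  define A where "A = C * (1 + norm (snd z)) ^ 3"
  have bounds: "\<bar>cone_field F z b y\<bar> \<le> 100 * A * cone_majorant y" "\<bar>cone_field' F z b y\<bar> \<le> 400 * A * cone_majorant y"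
    if "b \<in> Basis" for b y
    using cone_field_bounds[of F C A z b y] dF C A_def that by blast+
  have int: "integrable lborel (cone_field F z b)" "integrable lborel (cone_field' F z b)" if b: "b \<in> Basis" for b
  proof -
    have maj: "integrable lborel (\<lambda>y. K * cone_majorant y)" for K using integrable_cone_majorant by simp
    show "integrable lborel (cone_field F z b)"
    proof (rule Bochner_Integration.integrable_bound[OF maj])
      show "cone_field F z b \<in> borel_measurable lborel" using borel_measurable_cone_fields(1)[OF ct] by simp
      show "AE y in lborel. norm (cone_field F z b y) \<le> norm (100 * A * cone_majorant y)"
        by (rule AE_I2) (use bounds(1)[OF b] in \<open>auto intro: order_trans[OF _ abs_ge_self]\<close>)
    qed
    show "integrable lborel (cone_field' F z b)"
    proof (rule Bochner_Integration.integrable_bound[OF maj])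
      show "cone_field' F z b \<in> borel_measurable lborel" using borel_measurable_cone_fields(2)[OF ct] by simp
      show "AE y in lborel. norm (cone_field' F z b y) \<le> norm (400 * A * cone_majorant y)"
        by (rule AE_I2) (use bounds(2)[OF b] in \<open>auto intro: order_trans[OF _ abs_ge_self]\<close>)
    qed
  qed
  have zero: "(LINT y|lborel. cone_field' F z b y) = 0" if b: "b \<in> Basis" for b
  proof (rule integral_directional_derivative_zero[OF int[OF b]])
    show "AE y in lborel. \<forall>\<tau>. ((\<lambda>\<tau>. cone_field F z b (y + \<tau> *\<^sub>R b)) has_real_derivative cone_field' F z b (y + \<tau> *\<^sub>R b)) (at \<tau>)"
      using AE_off_axis[OF b] by eventually_elim (use DERIV_cone_field[OF dF ddF b] in blast)
    show "AE y in lborel. continuous_on UNIV (\<lambda>\<tau>. cone_field' F z b (y + \<tau> *\<^sub>R b))"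
      using AE_off_axis[OF b]
    proof eventually_elim
      case (elim y)
      have cw: "continuous_on UNIV (\<lambda>\<tau>. z + (norm (y + \<tau> *\<^sub>R b), y + \<tau> *\<^sub>R b))" by (intro continuous_intros)
      have cc: "continuous_on UNIV (\<lambda>\<tau>. G (z + (norm (y + \<tau> *\<^sub>R b), y + \<tau> *\<^sub>R b)))" if "continuous_on UNIV G" for G :: "spacetime \<Rightarrow> real"
        by (rule continuous_on_compose2[OF that cw]) simp
      have nz: "norm (y + \<tau> *\<^sub>R b) \<noteq> 0" "1 + norm (y + \<tau> *\<^sub>R b) \<noteq> 0" for \<tau>
        using elim by (auto simp: add_nonneg_eq_0_iff)
      show ?case unfolding cone_field'_def Let_def
        by (intro continuous_intros cc ct ballI power_not_zero nz)
    qed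
  qed
  have "(LINT y|lborel. (\<Sum>b\<in>Basis. cone_field' F z b y)) = (\<Sum>b\<in>Basis. (LINT y|lborel. cone_field' F z b y))"
    by (rule Bochner_Integration.integral_sum) (rule int(2))
  also have "\<dots> = 0" using zero by simp
  also have "(LINT y|lborel. (\<Sum>b\<in>Basis. cone_field' F z b y))
      = (LINT y|lborel. wave_op F (z + (norm y, y)) / norm y + F z * (3 / ((1 + norm y) ^ 4 * (norm y)\<^sup>2)))"
  proof (rule integral_cong_AE)
    have cw: "continuous_on UNIV (wave_op F)" unfolding wave_op_def[abs_def] by (intro continuous_intros ct)
    note [measurable] = borel_measurable_cone[OF cw]
    show "(\<lambda>y. wave_op F (z + (norm y, y)) / norm y + F z * (3 / ((1 + norm y) ^ 4 * (norm y)\<^sup>2))) \<in> borel_measurable lborel" by measurable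
    show "(\<lambda>y. \<Sum>b\<in>Basis. cone_field' F z b y) \<in> borel_measurable lborel"
      using borel_measurable_cone_fields(2)[OF ct] by (intro borel_measurable_sum) simp
    show "AE y in lborel. (\<Sum>b\<in>Basis. cone_field' F z b y) = wave_op F (z + (norm y, y)) / norm y + F z * (3 / ((1 + norm y) ^ 4 * (norm y)\<^sup>2))"
      using AE_lborel_singleton[of "0 :: real ^ 3"]
      by eventually_elim (rule sum_cone_field'[OF _ ddir_mixed[OF dF ddF ct(3)]])
  qed
  also have "\<dots> = (LINT y|lborel. wave_op F (z + (norm y, y)) / norm y) + F z * cone_const"
  proof (subst Bochner_Integration.integral_add)
    show "integrable lborel (\<lambda>y :: real ^ 3. F z * (3 / ((1 + norm y) ^ 4 * (norm y)\<^sup>2)))"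
      by (intro Bochner_Integration.integrable_mult_right integrable_cone_const)
    have cw: "continuous_on UNIV (wave_op F)" unfolding wave_op_def[abs_def] by (intro continuous_intros ct)
    show "integrable lborel (\<lambda>y. wave_op F (z + (norm y, y)) / norm y)"
    proof (rule integrable_cone[OF cw])
      fix w
      have "\<bar>wave_op F w\<bar> \<le> (\<Sum>e\<in>(Basis :: spacetime set). C * cone_wt w)"
        unfolding wave_op_Basis by (rule order_trans[OF sum_abs sum_mono]) (auto simp: abs_mult intro: C(4))
      then show "\<bar>wave_op F w\<bar> \<le> (4 * C) * cone_wt w" by simp
    qed (use C in simp)
    have "(LINT y|lborel. F z * (3 / ((1 + norm (y :: real ^ 3)) ^ 4 * (norm y)\<^sup>2))) = F z * cone_const"
      unfolding cone_const_def by (rule integral_mult_right_zero)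
    then show "(LINT y|lborel. wave_op F (z + (norm y, y)) / norm y) + (LINT y|lborel. F z * (3 / ((1 + norm (y :: real ^ 3)) ^ 4 * (norm y)\<^sup>2)))
       = (LINT y|lborel. wave_op F (z + (norm y, y)) / norm y) + F z * cone_const" by simp
  qed
  finally show ?thesis unfolding adv_def using cone_const_pos by (simp add: field_simps)
qed

text \<open>Since \<open>adv\<close> commutes with derivatives, \<open>wave_op (adv F)\<close>
  equals \<open>adv (wave_op F)\<close>, which the representation formula evaluates.\<close>

lemma wave_op_adv:
  fixes F :: "spacetime \<Rightarrow> real"
  assumes F: "wbdd (Suc (Suc 0)) w F" and w: "\<And>z. 0 \<le> w z" "\<And>z. w z \<le> cone_wt z"
  shows "wave_op (adv F) z = - F z"
proof -
  have Fc: "wbdd (Suc (Suc 0)) cone_wt F" by (rule wcauchy_mono[OF F w(1), of 1]) (use w in auto)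
  have F1: "wbdd (Suc 0) w (ddir e F)" for e by (rule wcauchy_ddir[OF F])
  have F2: "wbdd 0 cone_wt (ddir e (ddir e' F))" for e e' by (rule wcauchy_ddir[OF wcauchy_ddir[OF Fc]])
  have ct: "continuous_on UNIV (ddir e (ddir e' F))" for e e'
    using wcauchy_imp_cauchy_wrt[OF F2] unfolding cauchy_wrt_def by auto
  have bd: "\<exists>C. \<forall>z. \<bar>ddir e (ddir e' F) z\<bar> \<le> C * cone_wt z" for e e'
    using wbdd_bound[OF F2 cone_wt_nonneg] by metis
  obtain C where C: "C \<ge> 0" "\<And>e w. e \<in> Basis \<Longrightarrow> \<bar>ddir e (ddir e F) w\<bar> \<le> C * cone_wt w"
    by (rule finite_uniform_bound[of "Basis :: spacetime set" cone_wt "\<lambda>e. ddir e (ddir e F)"]) (use cone_wt_nonneg bd in auto)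
  have "wave_op (adv F) z = (\<Sum>e\<in>Basis. (if e = (1, 0) then -1 else 1) * adv (ddir e (ddir e F)) z)"
    unfolding wave_op_Basis adv_differentiable_ddir(2)[OF F w] adv_differentiable_ddir(2)[OF F1 w] ..
  also have "\<dots> = adv (\<lambda>w. \<Sum>e\<in>Basis. (if e = (1, 0) then -1 else 1) * ddir e (ddir e F) w) z"
    using C ct by (intro adv_sum[symmetric]) auto
  also have "\<dots> = adv (wave_op F) z" unfolding wave_op_Basis ..
  also have "\<dots> = - F z" by (rule adv_wave_op[OF Fc])
  finally show ?thesis .
qed

section \<open>Pointwise bounds and the radiation field of advanced potentials\<close>

definition adv_bound_const :: real where
  "adv_bound_const = 4 * pi * (1 + pi) / cone_const"

lemma adv_bound_const_pos: "adv_bound_const > 0"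
  unfolding adv_bound_const_def using cone_const_pos by (simp add: add_pos_pos)

definition decay :: "spacetime \<Rightarrow> real" where
  "decay z = 1 / (1 + norm (snd z))"

lemma decay_pos: "decay z > 0" unfolding decay_def by (simp add: add_pos_nonneg)
lemma decay_nonneg: "0 \<le> decay z" using decay_pos[of z] by simp
lemma decay_le_1: "decay z \<le> 1" unfolding decay_def by (simp add: divide_le_eq add_pos_nonneg)

lemma src_weight_le_cone_wt: "src_weight D w \<le> cone_wt w"
proof -
  have "(1 + norm (snd w)) ^ 3 * 1 \<le> (1 + norm (snd w)) ^ 3 * (1 + (ucoord w)\<^sup>2)" by (intro mult_left_mono) auto
  then show ?thesis unfolding src_weight_def cone_wt_def
    by (auto intro!: divide_left_mono mult_pos_pos simp: add_pos_nonneg)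
qed

lemma adv_abs_le_nn_integral:
  assumes F: "continuous_on UNIV F" "\<And>w. \<bar>F w\<bar> \<le> C * src_weight D w" "C \<ge> 0"
    and le: "(\<integral>\<^sup>+y. ennreal (src_weight D (z + (norm y, y))) * ennreal (1 / norm y) \<partial>lborel) \<le> ennreal B" and B: "B \<ge> 0"
  shows "\<bar>adv F z\<bar> \<le> C * B / cone_const"
proof -
  have Fc: "\<bar>F w\<bar> \<le> C * cone_wt w" for w
    using order_trans[OF F(2) mult_left_mono[OF src_weight_le_cone_wt F(3)]] .
  have "ennreal (norm (LINT y|lborel. F (z + (norm y, y)) / norm y)) \<le> (\<integral>\<^sup>+y. ennreal (norm (F (z + (norm y, y)) / norm y)) \<partial>lborel)"
    by (rule integral_norm_bound_ennreal[OF integrable_cone[OF F(1) Fc F(3)]])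
  also have "\<dots> \<le> (\<integral>\<^sup>+y. ennreal C * (ennreal (src_weight D (z + (norm y, y))) * ennreal (1 / norm y)) \<partial>lborel)"
  proof (rule nn_integral_mono)
    fix y :: "real ^ 3"
    have "norm (F (z + (norm y, y)) / norm y) \<le> C * (src_weight D (z + (norm y, y)) * (1 / norm y))"
      using divide_right_mono[OF F(2)[of "z + (norm y, y)"], of "norm y"] by simp
    then show "ennreal (norm (F (z + (norm y, y)) / norm y)) \<le> ennreal C * (ennreal (src_weight D (z + (norm y, y))) * ennreal (1 / norm y))"
      using F(3) src_weight_nonneg by (simp add: ennreal_mult[symmetric] ennreal_leI del: times_divide_eq_right)
  qed
  also have "\<dots> = ennreal C * (\<integral>\<^sup>+y. ennreal (src_weight D (z + (norm y, y))) * ennreal (1 / norm y) \<partial>lborel)"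
  proof (rule nn_integral_cmult)
    show "(\<lambda>y. ennreal (src_weight D (z + (norm y, y))) * ennreal (1 / norm y)) \<in> borel_measurable lborel"
      unfolding src_weight_def ucoord_def fst_add snd_add fst_conv snd_conv by measurable
  qed
  also have "\<dots> \<le> ennreal C * ennreal B" by (rule mult_left_mono[OF le]) simp
  also have "\<dots> = ennreal (C * B)" using F(3) B by (simp add: ennreal_mult)
  finally have "norm (LINT y|lborel. F (z + (norm y, y)) / norm y) \<le> C * B"
    using F(3) B by (subst (asm) ennreal_le_iff) auto
  then show ?thesis unfolding adv_def abs_divide using cone_const_pos by (simp add: divide_right_mono)
qed

text \<open>The factor \<open>1 / (1 + D)\<close> is the only source of smallness in the nonlinear
  construction: it comes from moving the support of the source far out, not from small data.\<close>

lemma adv_bound: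
  assumes F: "continuous_on UNIV F" "\<And>w. \<bar>F w\<bar> \<le> C * src_weight D w" "C \<ge> 0" and D: "D \<ge> 0"
  shows "\<bar>adv F z\<bar> \<le> C * (adv_bound_const / (1 + D)) * decay z"
proof -
  have Fc: "\<bar>F w\<bar> \<le> C * cone_wt w" for w
    using order_trans[OF F(2) mult_left_mono[OF src_weight_le_cone_wt F(3)]] .
  have main: "\<bar>adv F (t, x)\<bar> \<le> C * (adv_bound_const / (1 + D)) * decay (t, x)" if "x \<noteq> 0" for t x
  proof -
    have "\<bar>adv F (t, x)\<bar> \<le> C * (4 * pi * (1 + pi) / ((1 + D) * (1 + norm x))) / cone_const"
      by (rule adv_abs_le_nn_integral[OF F nn_integral_src_weight_le[OF that D]]) (use D in simp)
    also have "\<dots> = C * (adv_bound_const / (1 + D)) * decay (t, x)"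
      unfolding adv_bound_const_def decay_def by simp
    finally show ?thesis .
  qed
  show ?thesis
  proof (cases "snd z = 0")
    case False then show ?thesis using main[of "snd z" "fst z"] by simp
  next
    case True
    \<comment> \<open>The light cone estimate divides by the radius of the vertex, so points on the
      axis are reached as limits from outside it, by continuity of both sides.\<close>
    define Z where "Z n = (fst z, (1 / real (Suc n)) *\<^sub>R axis 1 1 :: real ^ 3)" for n
    have "(\<lambda>n. (1 / real (Suc n)) *\<^sub>R (axis 1 1 :: real ^ 3)) \<longlonglongrightarrow> 0 *\<^sub>R axis 1 1"
      by (intro tendsto_scaleR tendsto_const) (rule LIMSEQ_inverse_real_of_nat[unfolded inverse_eq_divide])
    then have Z: "Z \<longlonglongrightarrow> z" unfolding Z_def using True by (cases z) (auto intro!: tendsto_Pair)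
    have "(\<lambda>n. \<bar>adv F (Z n)\<bar>) \<longlonglongrightarrow> \<bar>adv F z\<bar>"
      by (intro tendsto_rabs continuous_on_tendsto_compose[OF continuous_on_adv[OF F(1) Fc F(3)] Z]) auto
    moreover have "(\<lambda>n. C * (adv_bound_const / (1 + D)) * decay (Z n)) \<longlonglongrightarrow> C * (adv_bound_const / (1 + D)) * decay z"
      unfolding decay_def by (intro tendsto_intros Z) (use norm_ge_zero[of "snd z"] in linarith)
    moreover have "\<bar>adv F (Z n)\<bar> \<le> C * (adv_bound_const / (1 + D)) * decay (Z n)" for n
      unfolding Z_def by (rule main) (simp add: axis_eq_0_iff)
    ultimately show ?thesis by (meson LIMSEQ_le)
  qed
qed

text \<open>Linearity turns the bound for a single source into one for differences, and commutation
  with derivatives raises the order by induction.\<close>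

lemma wcauchy_adv:
  fixes s :: "nat \<Rightarrow> spacetime \<Rightarrow> real"
  assumes "wcauchy k (src_weight 0) s"
  shows "wcauchy k decay (\<lambda>n. adv (s n))"
  using assms
proof (induction k arbitrary: s)
  case 0
  then have s: "cauchy_wrt (src_weight 0) s" by simp
  have ct: "continuous_on UNIV (s n)" for n using s unfolding cauchy_wrt_def by blast
  obtain C where C: "C > 0" "\<And>n w. \<bar>s n w\<bar> \<le> C * src_weight 0 w"
    using cauchy_wrt_bound[OF s src_weight_nonneg] by metis
  have Cc: "\<bar>s n w\<bar> \<le> C * cone_wt w" for n w
    using order_trans[OF C(2) mult_left_mono[OF src_weight_le_cone_wt]] C(1) by simp
  have "\<exists>N. \<forall>m\<ge>N. \<forall>n\<ge>N. \<forall>z. \<bar>adv (s m) z - adv (s n) z\<bar> \<le> e * decay z" if e: "e > 0" for e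
  proof -
    have "e / adv_bound_const > 0" using e adv_bound_const_pos by simp
    then obtain N where N: "\<forall>m\<ge>N. \<forall>n\<ge>N. \<forall>z. \<bar>s m z - s n z\<bar> \<le> e / adv_bound_const * src_weight 0 z"
      using s unfolding cauchy_wrt_def by blast
    show ?thesis
    proof (intro exI[of _ N] allI impI)
      fix m n z assume mn: "N \<le> m" "N \<le> n"
      have "adv (s m) z - adv (s n) z = adv (\<lambda>w. 1 * s m w + (-1) * s n w) z"
        using adv_add[of "s m" C "s n" C 1 "-1" z] C(1) Cc ct by simp
      also have "\<bar>\<dots>\<bar> \<le> e / adv_bound_const * (adv_bound_const / (1 + 0)) * decay z"
        using N mn \<open>e / adv_bound_const > 0\<close> by (intro adv_bound) (auto intro!: continuous_intros ct)
      finally show "\<bar>adv (s m) z - adv (s n) z\<bar> \<le> e * decay z" using adv_bound_const_pos by simp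
    qed
  qed
  moreover have "continuous_on UNIV (adv (s n))" for n by (rule continuous_on_adv[OF ct Cc]) (use C in simp)
  moreover have "\<bar>adv (s n) z\<bar> \<le> C * (adv_bound_const / (1 + 0)) * decay z" for n z
    by (rule adv_bound[OF ct C(2)]) (use C in auto)
  ultimately show ?case unfolding wcauchy.simps cauchy_wrt_def by blast
next
  case (Suc k)
  have s: "wbdd (Suc k) (src_weight 0) (s n)" for n by (rule wbdd_of_wcauchy[OF Suc.prems src_weight_nonneg])
  note ad = adv_differentiable_ddir[OF s src_weight_nonneg src_weight_le_cone_wt]
  have "wcauchy k decay (\<lambda>n. adv (s n))" by (rule Suc.IH[OF wcauchy_SucD[OF Suc.prems]])
  then have "cauchy_wrt decay (\<lambda>n. adv (s n))" by (rule wcauchy_imp_cauchy_wrt)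
  moreover have "wcauchy k decay (\<lambda>n. ddir e (adv (s n)))" for e
    unfolding ad(2) by (rule Suc.IH[OF wcauchy_ddir[OF Suc.prems]])
  ultimately show ?case unfolding wcauchy.simps using ad(1) by blast
qed

lemma adv_scri_bound:
  assumes F: "continuous_on UNIV F" "\<And>w. \<bar>F w\<bar> \<le> C * src_weight 0 w" "C \<ge> 0"
    and x: "x \<noteq> 0" and v: "v = (t + norm x) / 2" "v \<ge> 0"
  shows "\<bar>norm x * adv F (t, x)\<bar> \<le> C * (4 * pi * (2 * pi / (2 + v) + 4 * norm x / (4 + v\<^sup>2))) / cone_const"
proof -
  have "\<bar>adv F (t, x)\<bar> \<le> C * (4 * pi / norm x * (2 * pi / (2 + v) + 4 * norm x / (4 + v\<^sup>2))) / cone_const"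
    by (rule adv_abs_le_nn_integral[OF F nn_integral_src_weight_scri[OF x v]]) (use v(2) in simp)
  from mult_left_mono[OF this, of "norm x"] show ?thesis using x by (simp add: abs_mult)
qed

text \<open>As the vertex tends to future null infinity its forward cone leaves the bulk of the
  source behind. Advanced potentials therefore have zero radiation field, and adding them does not
  disturb prescribed data.\<close>

lemma adv_scri_limit:
  assumes F: "continuous_on UNIV F" "\<And>w. \<bar>F w\<bar> \<le> C * src_weight 0 w" "C \<ge> 0" and om: "norm om = 1"
  shows "((\<lambda>r. r * adv F (2 * u + r, r *\<^sub>R om)) \<longlongrightarrow> 0) at_top"
proof (rule Lim_null_comparison)
  show "\<forall>\<^sub>F r in at_top. norm (r * adv F (2 * u + r, r *\<^sub>R om)) \<le> C * (4 * pi * (2 * pi / (2 + (u + r)) + 4 * r / (4 + (u + r)\<^sup>2))) / cone_const"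
    using eventually_ge_at_top[of "\<bar>u\<bar> + 1"]
  proof eventually_elim
    case (elim r)
    have n: "norm (r *\<^sub>R om) = r" using om elim by simp
    have "r *\<^sub>R om \<noteq> 0" using om elim by auto
    from adv_scri_bound[OF F this, of "u + r" "2 * u + r"] show ?case unfolding n using elim by (simp add: field_simps)
  qed
  have "((\<lambda>r::real. 2 * pi / (2 + (u + r)) + 4 * r / (4 + (u + r)\<^sup>2)) \<longlongrightarrow> 0) at_top" by real_asymp
  then have "((\<lambda>r. C * (4 * pi * (2 * pi / (2 + (u + r)) + 4 * r / (4 + (u + r)\<^sup>2))) / cone_const) \<longlongrightarrow> C * (4 * pi * 0) / cone_const) at_top"
    by (intro tendsto_intros) (use cone_const_pos in auto)
  then show "((\<lambda>r. C * (4 * pi * (2 * pi / (2 + (u + r)) + 4 * r / (4 + (u + r)\<^sup>2))) / cone_const) \<longlongrightarrow> 0) at_top" by simp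
qed

section \<open>The nonlinear iteration\<close>

lemma ddir_power:
  assumes "\<And>z. f differentiable (at z)"
  shows "ddir e (\<lambda>z. f z ^ n) = (\<lambda>z. of_nat n * f z ^ (n - 1) * ddir e f z)"
proof
  fix z
  have "((\<lambda>z. f z ^ n) has_derivative (\<lambda>h. of_nat n * ddir h f z * f z ^ (n - 1))) (at z)"
    by (rule has_derivative_power[OF has_derivative_ddir[OF assms]])
  from ddir_eq[OF this] show "ddir e (\<lambda>z. f z ^ n) z = of_nat n * f z ^ (n - 1) * ddir e f z" by simp
qed

lemma wcauchy_power:
  assumes "wcauchy k w f" "\<And>z. 0 \<le> w z"
  shows "wcauchy k (\<lambda>z. w z ^ n) (\<lambda>m z. f m z ^ n)"
proof (induction n)
  case 0 show ?case using wbdd_const[of k 1] by simp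
next
  case (Suc n)
  have "wcauchy k (\<lambda>z. w z * w z ^ n) (\<lambda>m z. f m z * f m z ^ n)"
    by (rule wcauchy_mult[OF assms(1) Suc]) (use assms(2) in auto)
  then show ?case by simp
qed

lemma adv_plus:
  assumes "wbdd k (src_weight 0) F" "wbdd k (src_weight 0) G"
  shows "adv (\<lambda>w. F w + G w) z = adv F z + adv G z" "adv (\<lambda>w. F w - G w) z = adv F z - adv G z"
proof -
  obtain C where C: "C > 0" "\<And>w. \<bar>F w\<bar> \<le> C * src_weight 0 w" using wbdd_bound[OF assms(1) src_weight_nonneg] by metis
  obtain D where D: "D > 0" "\<And>w. \<bar>G w\<bar> \<le> D * src_weight 0 w" using wbdd_bound[OF assms(2) src_weight_nonneg] by metis
  have b: "\<bar>F w\<bar> \<le> C * cone_wt w" "\<bar>G w\<bar> \<le> D * cone_wt w" for w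
    using order_trans[OF C(2) mult_left_mono[OF src_weight_le_cone_wt]]
      order_trans[OF D(2) mult_left_mono[OF src_weight_le_cone_wt]] C(1) D(1) by simp_all
  have ct: "continuous_on UNIV F" "continuous_on UNIV G"
    using wcauchy_imp_cauchy_wrt[OF assms(1)] wcauchy_imp_cauchy_wrt[OF assms(2)] unfolding cauchy_wrt_def by auto
  show "adv (\<lambda>w. F w + G w) z = adv F z + adv G z" "adv (\<lambda>w. F w - G w) z = adv F z - adv G z"
    using adv_add[of F C G D 1 1 z] adv_add[of F C G D 1 "-1" z] ct b C(1) D(1) by simp_all
qed

text \<open>The condition on \<open>ucoord\<close> makes \<open>(1 + r) ^ 2\<close> at least
  \<open>1 + u ^ 2\<close>. Of the five powers of decay of a quintic source, two can then be traded
  for the factor in \<open>ucoord\<close> demanded by \<open>src_weight\<close>, which leaves the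
  three radial ones.\<close>

definition far_region :: "real \<Rightarrow> spacetime \<Rightarrow> real" where
  "far_region D z = (if D \<le> norm (snd z) \<and> \<bar>ucoord z\<bar> \<le> norm (snd z) then 1 else 0)"

lemma far_region_nonneg: "0 \<le> far_region D z" unfolding far_region_def by simp

lemma far_region_decay: "far_region D z * decay z ^ 5 \<le> src_weight D z"
proof (cases "D \<le> norm (snd z) \<and> \<bar>ucoord z\<bar> \<le> norm (snd z)")
  case True
  have "(ucoord z)\<^sup>2 \<le> (norm (snd z))\<^sup>2" using True by (metis abs_le_square_iff abs_norm_cancel)
  then have "1 + (ucoord z)\<^sup>2 \<le> (1 + norm (snd z))\<^sup>2"
    using norm_ge_zero[of "snd z"] unfolding power2_sum one_power2 by linarith
  then have "(1 + norm (snd z)) ^ 3 * (1 + (ucoord z)\<^sup>2) \<le> (1 + norm (snd z)) ^ 3 * (1 + norm (snd z))\<^sup>2"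
    by (intro mult_left_mono) auto
  also have "\<dots> = (1 + norm (snd z)) ^ 5" by (simp add: power_add[symmetric])
  finally have "1 / (1 + norm (snd z)) ^ 5 \<le> 1 / ((1 + norm (snd z)) ^ 3 * (1 + (ucoord z)\<^sup>2))"
    by (intro divide_left_mono mult_pos_pos) (auto simp: add_pos_nonneg)
  then show ?thesis using True unfolding far_region_def src_weight_def decay_def by (simp add: power_one_over)
qed (auto simp: far_region_def src_weight_nonneg)

lemma src_weight_mono: "0 \<le> D \<Longrightarrow> src_weight D z \<le> src_weight 0 z"
  unfolding src_weight_def by auto

lemma wcauchy_source:
  assumes b: "wcauchy k (\<lambda>z. far_region D z * decay z ^ 4) b" and f: "wcauchy k decay f" and D: "D \<ge> 0"
  shows "wcauchy k (src_weight 0) (\<lambda>n z. b n z * f n z)"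
proof (rule wcauchy_mono[where A = 1])
  show "wcauchy k (\<lambda>z. far_region D z * decay z ^ 4 * decay z) (\<lambda>n z. b n z * f n z)"
    by (rule wcauchy_mult[OF b f]) (use far_region_nonneg decay_nonneg in auto)
  show "far_region D z * decay z ^ 4 * decay z \<le> 1 * src_weight 0 z" for z
    using order_trans[OF far_region_decay src_weight_mono[OF D]] by (simp add: eval_nat_numeral mult.assoc)
qed (use far_region_nonneg decay_nonneg in auto)

lemma wcauchy_quintic_source:
  assumes c: "wcauchy k (far_region D) c" and p: "wcauchy k decay p" and D: "D \<ge> 0"
  shows "wcauchy k (src_weight 0) (\<lambda>n w. c n w * p n w ^ 5)"
proof (rule wcauchy_mono[where A = 1])
  show "wcauchy k (\<lambda>z. far_region D z * decay z ^ 5) (\<lambda>n w. c n w * p n w ^ 5)"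
    by (intro wcauchy_mult wcauchy_power c p far_region_nonneg decay_nonneg zero_le_power)
  show "far_region D z * decay z ^ 5 \<le> 1 * src_weight 0 z" for z
    using order_trans[OF far_region_decay src_weight_mono[OF D]] by simp
qed (use far_region_nonneg decay_nonneg in auto)

text \<open>The quantitative counterpart of \<open>wcauchy_source\<close>: constants and the radius
  \<open>D\<close> are kept, since the contraction factor depends on them.\<close>

lemma far_source_bound:
  assumes "\<bar>b\<bar> \<le> B * (far_region D z * decay z ^ 4)" "\<bar>f\<bar> \<le> M * decay z" "B \<ge> 0" "M \<ge> 0"
  shows "\<bar>b * f\<bar> \<le> B * M * src_weight D z"
proof -
  have "\<bar>b * f\<bar> \<le> (B * (far_region D z * decay z ^ 4)) * (M * decay z)"
    unfolding abs_mult using assms far_region_nonneg decay_nonneg by (intro mult_mono) auto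
  also have "\<dots> = B * M * (far_region D z * decay z ^ 5)" by (simp add: eval_nat_numeral)
  also have "\<dots> \<le> B * M * src_weight D z" using assms by (intro mult_left_mono far_region_decay) auto
  finally show ?thesis .
qed

text \<open>A contraction by one half up to an error that becomes small along the sequence. After
  \<open>j\<close> steps the initial discrepancy \<open>2 * M\<close> has been halved
  \<open>j\<close> times, and the errors \<open>\<epsilon> / 4\<close> have added up to at most
  \<open>\<epsilon> / 2\<close>.\<close>

lemma contraction_cauchy:
  fixes f :: "nat \<Rightarrow> 'a \<Rightarrow> real"
  assumes bd: "\<And>n z. \<bar>f n z\<bar> \<le> M * w z" and w: "\<And>z. 0 \<le> w z" and M: "M \<ge> 0"
    and step: "\<And>e. e > 0 \<Longrightarrow> \<exists>N. \<forall>m\<ge>N. \<forall>n\<ge>N. \<forall>c\<ge>0. (\<forall>z. \<bar>f m z - f n z\<bar> \<le> c * w z) \<longrightarrow>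
        (\<forall>z. \<bar>f (Suc m) z - f (Suc n) z\<bar> \<le> (e + c / 2) * w z)"
    and "\<epsilon> > 0"
  shows "\<exists>N. \<forall>m\<ge>N. \<forall>n\<ge>N. \<forall>z. \<bar>f m z - f n z\<bar> \<le> \<epsilon> * w z"
proof -
  obtain N where N0: "\<forall>m\<ge>N. \<forall>n\<ge>N. \<forall>c\<ge>0. (\<forall>z. \<bar>f m z - f n z\<bar> \<le> c * w z) \<longrightarrow>
        (\<forall>z. \<bar>f (Suc m) z - f (Suc n) z\<bar> \<le> (\<epsilon> / 4 + c / 2) * w z)"
    using step[of "\<epsilon> / 4"] \<open>\<epsilon> > 0\<close> by auto
  have N: "\<bar>f (Suc m) z - f (Suc n) z\<bar> \<le> (\<epsilon> / 4 + c / 2) * w z"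
    if "m \<ge> N" "n \<ge> N" "c \<ge> 0" "\<And>z. \<bar>f m z - f n z\<bar> \<le> c * w z" for m n c z
    using N0 that by blast
  have *: "\<bar>f m z - f n z\<bar> \<le> (2 * M / 2 ^ j + \<epsilon> / 2) * w z" if "m \<ge> N + j" "n \<ge> N + j" for j m n z
    using that
  proof (induction j arbitrary: m n z)
    case 0
    have "\<bar>f m z - f n z\<bar> \<le> 2 * M * w z" using bd[of m z] bd[of n z] by linarith
    also have "\<dots> \<le> (2 * M / 2 ^ 0 + \<epsilon> / 2) * w z" using \<open>\<epsilon> > 0\<close> w by (intro mult_right_mono) auto
    finally show ?case .
  next
    case (Suc j)
    then obtain m' n' where mn: "m = Suc m'" "n = Suc n'" "m' \<ge> N + j" "n' \<ge> N + j"
      by (metis Suc_le_D add_Suc_right Suc_le_mono)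
    have "\<bar>f (Suc m') z - f (Suc n') z\<bar> \<le> (\<epsilon> / 4 + (2 * M / 2 ^ j + \<epsilon> / 2) / 2) * w z"
      by (rule N) (use mn Suc.IH \<open>\<epsilon> > 0\<close> M in auto)
    also have "\<epsilon> / 4 + (2 * M / 2 ^ j + \<epsilon> / 2) / 2 = 2 * M / 2 ^ Suc j + \<epsilon> / 2" by (simp add: field_simps)
    finally show ?case using mn by simp
  qed
  have "(\<lambda>j. 2 * M * (1 / 2) ^ j) \<longlonglongrightarrow> 2 * M * 0" by (intro tendsto_mult tendsto_const LIMSEQ_power_zero) simp
  then have "\<forall>\<^sub>F j in sequentially. 2 * M * (1 / 2) ^ j < \<epsilon> / 2" using \<open>\<epsilon> > 0\<close> by (intro order_tendstoD) auto
  then obtain j where j: "2 * M * (1 / 2) ^ j < \<epsilon> / 2" unfolding eventually_sequentially by blast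
  show ?thesis
  proof (intro exI[of _ "N + j"] allI impI)
    fix m n z assume "N + j \<le> m" "N + j \<le> n"
    from *[OF this] have "\<bar>f m z - f n z\<bar> \<le> (2 * M / 2 ^ j + \<epsilon> / 2) * w z" .
    also have "\<dots> \<le> \<epsilon> * w z" using j w by (intro mult_right_mono) (auto simp: power_one_over)
    finally show "\<bar>f m z - f n z\<bar> \<le> \<epsilon> * w z" .
  qed
qed

text \<open>The derivatives of the iterates satisfy an iteration with the same coefficients \<open>b\<close>, so that
  smallness of \<open>b\<close> itself, independent of \<open>k\<close>, is sufficient.\<close>

lemma linear_iteration_wcauchy:
  assumes D: "D \<ge> 0" and B: "B \<ge> 0" "B * (adv_bound_const / (1 + D)) \<le> 1 / 2"
  shows "wcauchy k decay g \<Longrightarrow> wcauchy k (\<lambda>z. far_region D z * decay z ^ 4) b \<Longrightarrow> (\<And>n. wbdd k decay (f n)) \<Longrightarrow>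
    (\<And>n z. \<bar>b n z\<bar> \<le> B * (far_region D z * decay z ^ 4)) \<Longrightarrow>
    (\<And>n. f (Suc n) = (\<lambda>z. g n z + adv (\<lambda>w. b n w * f n w) z)) \<Longrightarrow> wcauchy k decay f"
proof (induction k arbitrary: g b f)
  case 0
  note g = "0.prems"(1)[simplified] and b = "0.prems"(2)[simplified] and f = "0.prems"(3)[simplified] and bB = "0.prems"(4) and rec = "0.prems"(5)
  define K where "K = adv_bound_const / (1 + D)"
  have K: "K > 0" unfolding K_def using adv_bound_const_pos D by simp
  have ctf: "continuous_on UNIV (f n)" for n using f unfolding cauchy_wrt_def by blast
  have ctb: "continuous_on UNIV (b n)" for n using b unfolding cauchy_wrt_def by blast
  have src: "wbdd 0 (src_weight 0) (\<lambda>w. b m w * f n w)" for m n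
    using wcauchy_source[OF wbdd_of_wcauchy[OF "0.prems"(2)] "0.prems"(3) D, of m n] far_region_nonneg decay_nonneg by simp
  obtain Cg where Cg: "Cg > 0" "\<And>n z. \<bar>g n z\<bar> \<le> Cg * decay z" using cauchy_wrt_bound[OF g decay_nonneg] by metis
  obtain C0 where C0: "C0 > 0" "\<And>z. \<bar>f 0 z\<bar> \<le> C0 * decay z" by (rule cauchy_wrt_const_bound[OF f decay_nonneg]) auto
  \<comment> \<open>Chosen so that \<open>Cg + M / 2 \<le> M\<close>, which makes the bound by
    \<open>M * decay\<close> invariant under the recursion.\<close>
  define M where "M = C0 + 2 * Cg"
  have M: "M > 0" "C0 \<le> M" "Cg \<le> M / 2" unfolding M_def using C0 Cg by auto
  have fM: "\<bar>f n z\<bar> \<le> M * decay z" for n z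
  proof (induction n arbitrary: z)
    case 0 show ?case using C0(2)[of z] mult_right_mono[OF M(2) decay_nonneg[of z]] by linarith
  next
    case (Suc n)
    have "\<bar>adv (\<lambda>w. b n w * f n w) z\<bar> \<le> (B * M) * (adv_bound_const / (1 + D)) * decay z"
      by (rule adv_bound) (use far_source_bound[OF bB Suc] B M D in \<open>auto intro!: continuous_intros ctf ctb\<close>)
    also have "\<dots> = (B * K) * (M * decay z)" unfolding K_def by simp
    also have "\<dots> \<le> 1 / 2 * (M * decay z)" using B M decay_nonneg unfolding K_def by (intro mult_right_mono) auto
    finally have "\<bar>f (Suc n) z\<bar> \<le> Cg * decay z + 1 / 2 * (M * decay z)" unfolding rec using Cg(2)[of n z] by linarith
    also have "\<dots> \<le> M / 2 * decay z + 1 / 2 * (M * decay z)" using M decay_nonneg by (intro add_right_mono mult_right_mono) auto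
    finally show ?case by simp
  qed
  have "\<exists>N. \<forall>m\<ge>N. \<forall>n\<ge>N. \<forall>z. \<bar>f m z - f n z\<bar> \<le> \<epsilon> * decay z" if "\<epsilon> > 0" for \<epsilon>
  proof (rule contraction_cauchy[OF fM decay_nonneg _ _ that])
    fix e :: real assume e: "e > 0"
    \<comment> \<open>The perturbations of \<open>g\<close> and of \<open>b\<close> together cost
      \<open>d + d * M * K\<close>, which is to equal \<open>e\<close>.\<close>
    define d where "d = e / (1 + M * K)"
    have MK: "1 + M * K > 0" using M K by (simp add: add_pos_pos)
    then have "d * (1 + M * K) = e" unfolding d_def by simp
    then have "d + d * M * K = e" by (simp only: ring_distribs mult.assoc mult_1_right)
    moreover have "d > 0" unfolding d_def using e MK by simp
    ultimately have d: "d > 0" "d + d * M * K = e" by auto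
    obtain N1 where N1: "\<forall>m\<ge>N1. \<forall>n\<ge>N1. \<forall>z. \<bar>g m z - g n z\<bar> \<le> d * decay z" using g d unfolding cauchy_wrt_def by blast
    obtain N2 where N2: "\<forall>m\<ge>N2. \<forall>n\<ge>N2. \<forall>z. \<bar>b m z - b n z\<bar> \<le> d * (far_region D z * decay z ^ 4)" using b d unfolding cauchy_wrt_def by blast
    show "\<exists>N. \<forall>m\<ge>N. \<forall>n\<ge>N. \<forall>c\<ge>0. (\<forall>z. \<bar>f m z - f n z\<bar> \<le> c * decay z) \<longrightarrow>
        (\<forall>z. \<bar>f (Suc m) z - f (Suc n) z\<bar> \<le> (e + c / 2) * decay z)"
    proof (intro exI[of _ "max N1 N2"] allI impI)
      fix m n c z assume mn: "max N1 N2 \<le> m" "max N1 N2 \<le> n" and c: "0 \<le> (c :: real)" "\<forall>z. \<bar>f m z - f n z\<bar> \<le> c * decay z"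
      have "\<bar>b m w * f m w - b n w * f n w\<bar> \<le> (B * c + d * M) * src_weight D w" for w
      proof -
        have "\<bar>b m w * (f m w - f n w)\<bar> \<le> B * c * src_weight D w" using far_source_bound[OF bB] c B by blast
        moreover have "\<bar>(b m w - b n w) * f n w\<bar> \<le> d * M * src_weight D w"
        proof (rule far_source_bound[OF _ fM])
          show "\<bar>b m w - b n w\<bar> \<le> d * (far_region D w * decay w ^ 4)" using N2 mn by (meson max.boundedE)
        qed (use d M in auto)
        moreover have "b m w * f m w - b n w * f n w = b m w * (f m w - f n w) + (b m w - b n w) * f n w" by (simp add: algebra_simps)
        ultimately show ?thesis by (simp add: ring_distribs)
      qed
      then have "\<bar>adv (\<lambda>w. b m w * f m w - b n w * f n w) z\<bar> \<le> (B * c + d * M) * (adv_bound_const / (1 + D)) * decay z"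
        by (intro adv_bound) (use c B d M D in \<open>auto intro!: continuous_intros ctf ctb\<close>)
      moreover have "adv (\<lambda>w. b m w * f m w - b n w * f n w) z = adv (\<lambda>w. b m w * f m w) z - adv (\<lambda>w. b n w * f n w) z"
        by (rule adv_plus(2)[OF src src])
      moreover have "\<bar>g m z - g n z\<bar> \<le> d * decay z" using N1 mn by (meson max.boundedE)
      ultimately have "\<bar>f (Suc m) z - f (Suc n) z\<bar> \<le> d * decay z + (B * c + d * M) * K * decay z" unfolding rec K_def by linarith
      also have "\<dots> = (d + d * M * K + (B * K) * c) * decay z" by (simp add: algebra_simps)
      also have "\<dots> \<le> (e + c / 2) * decay z"
        unfolding d using mult_right_mono[OF B(2), of c] c decay_nonneg unfolding K_def by (intro mult_right_mono) auto
      finally show "\<bar>f (Suc m) z - f (Suc n) z\<bar> \<le> (e + c / 2) * decay z" .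
    qed
  qed (use M in simp)
  then show ?case unfolding wcauchy.simps cauchy_wrt_def using ctf fM by blast
next
  case (Suc k)
  note g = Suc.prems(1) and b = Suc.prems(2) and f = Suc.prems(3) and bB = Suc.prems(4) and rec = Suc.prems(5)
  have wn: "0 \<le> far_region D z * decay z ^ 4" for z using far_region_nonneg decay_nonneg by simp
  \<comment> \<open>The undifferentiated sequence has to converge first, since it enters the
    inhomogeneity of the iteration for the derivatives.\<close>
  have fk: "wcauchy k decay f"
    by (rule Suc.IH[OF wcauchy_SucD[OF g] wcauchy_SucD[OF b] wcauchy_SucD[OF f] bB rec])
  have df: "f n differentiable (at z)" and db: "b n differentiable (at z)" and dg: "g n differentiable (at z)" for n z
    using wcauchy_diff[OF f] wcauchy_diff[OF b] wcauchy_diff[OF g] by auto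
  have "wcauchy k decay (\<lambda>n. ddir e (f n))" for e
  \<comment> \<open>A derivative falling on \<open>f n\<close> reproduces the same linear operator;
    one falling on \<open>b n\<close> gives a convergent inhomogeneity of the order already under
    control.\<close>
  proof (rule Suc.IH[where b = b and g = "\<lambda>n z. ddir e (g n) z + adv (\<lambda>w. ddir e (b n) w * f n w) z"])
    show "wcauchy k decay (\<lambda>n z. ddir e (g n) z + adv (\<lambda>w. ddir e (b n) w * f n w) z)"
      by (intro wcauchy_add wcauchy_ddir[OF g] wcauchy_adv wcauchy_source[OF wcauchy_ddir[OF b] fk D])
    show "ddir e (f (Suc n)) = (\<lambda>z. (ddir e (g n) z + adv (\<lambda>w. ddir e (b n) w * f n w) z) + adv (\<lambda>w. b n w * ddir e (f n) w) z)" for n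
    proof -
      have src: "wbdd (Suc k) (src_weight 0) (\<lambda>w. b n w * f n w)"
        by (rule wcauchy_source[OF wbdd_of_wcauchy[OF b wn] f D])
      note ad = adv_differentiable_ddir[OF src src_weight_nonneg src_weight_le_cone_wt]
      have s1: "wbdd k (src_weight 0) (\<lambda>w. ddir e (b n) w * f n w)"
        by (rule wcauchy_source[OF wcauchy_ddir[OF wbdd_of_wcauchy[OF b wn]] wcauchy_SucD[OF f] D])
      have s2: "wbdd k (src_weight 0) (\<lambda>w. b n w * ddir e (f n) w)"
        by (rule wcauchy_source[OF wcauchy_SucD[OF wbdd_of_wcauchy[OF b wn]] wcauchy_ddir[OF f] D])
      have "ddir e (f (Suc n)) = (\<lambda>z. ddir e (g n) z + ddir e (adv (\<lambda>w. b n w * f n w)) z)"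
        unfolding rec by (rule ddir_add[OF dg ad(1)])
      also have "\<dots> = (\<lambda>z. ddir e (g n) z + adv (\<lambda>w. b n w * ddir e (f n) w + ddir e (b n) w * f n w) z)"
        unfolding ad(2) ddir_mult[OF db df] ..
      also have "\<dots> = (\<lambda>z. ddir e (g n) z + (adv (\<lambda>w. b n w * ddir e (f n) w) z + adv (\<lambda>w. ddir e (b n) w * f n w) z))"
        unfolding adv_plus(1)[OF s2 s1] ..
      finally show ?thesis by (simp add: add_ac)
    qed
  qed (use wcauchy_SucD[OF b] wcauchy_ddir[OF f] bB in auto)
  then show ?case using wcauchy_imp_cauchy_wrt[OF fk] df unfolding wcauchy.simps by blast
qed

text \<open>Among fields bounded by \<open>2 * A * decay\<close> the quintic source has size
  \<open>32 * A ^ 5\<close> and Lipschitz constant \<open>80 * A ^ 4\<close>, which is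
  \<open>5 * (2 * A) ^ 4\<close>. The constant 160 makes the latter a contraction by one half, and
  the former then keeps the iterates within the bound. Derivatives are handled by
  \<open>linear_iteration_wcauchy\<close> under the same smallness.\<close>

lemma nonlinear_fixed_point:
  assumes lin: "\<And>k. wbdd k decay lin" and linA: "\<And>z. \<bar>lin z\<bar> \<le> A * decay z" and A: "A > 0"
    and chi: "\<And>k. wbdd k (far_region D) chi" and chi1: "\<And>z. \<bar>chi z\<bar> \<le> far_region D z" and D: "D \<ge> 0"
    and small: "160 * A ^ 4 * (adv_bound_const / (1 + D)) \<le> 1"
  obtains \<phi> where "\<And>k. wbdd k decay \<phi>" "\<And>z. \<phi> z = lin z + adv (\<lambda>w. chi w * \<phi> w ^ 5) z"
proof -
  define K where "K = adv_bound_const / (1 + D)"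
  have K: "K > 0" unfolding K_def using adv_bound_const_pos D by simp
  have sm: "160 * A ^ 4 * K \<le> 1" using small unfolding K_def .
  define \<phi> where "\<phi> = rec_nat lin (\<lambda>_ p z. lin z + adv (\<lambda>w. chi w * p w ^ 5) z)"
  have \<phi>0: "\<phi> 0 = lin" and \<phi>S: "\<phi> (Suc n) = (\<lambda>z. lin z + adv (\<lambda>w. chi w * \<phi> n w ^ 5) z)" for n
    unfolding \<phi>_def by auto
  note src5 = wcauchy_quintic_source[OF _ _ D]
  have \<phi>k: "wbdd k decay (\<phi> n)" for k n
  proof (induction n)
    case 0 show ?case unfolding \<phi>0 by (rule lin)
  next
    case (Suc n)
    show ?case unfolding \<phi>S by (intro wcauchy_add lin wcauchy_adv src5 chi Suc)
  qed
  have ct\<phi>: "continuous_on UNIV (\<phi> n)" for n using wcauchy_imp_cauchy_wrt[OF \<phi>k] unfolding cauchy_wrt_def by blast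
  have ctchi: "continuous_on UNIV chi" using wcauchy_imp_cauchy_wrt[OF chi] unfolding cauchy_wrt_def by blast
  have A4: "A ^ 4 * A = A ^ 5" by (simp add: eval_nat_numeral)
  have p5: "\<bar>chi w * p ^ 5\<bar> \<le> 32 * A ^ 5 * src_weight D w" if "\<bar>p\<bar> \<le> 2 * A * decay w" for w p
  proof -
    have "\<bar>p\<bar> ^ 5 \<le> (2 * A * decay w) ^ 5" using that by (intro power_mono) auto
    then have "\<bar>chi w * p ^ 5\<bar> \<le> far_region D w * (2 * A * decay w) ^ 5"
      unfolding abs_mult power_abs using chi1 by (intro mult_mono far_region_nonneg) auto
    also have "\<dots> = 32 * A ^ 5 * (far_region D w * decay w ^ 5)" by (simp add: power_mult_distrib)
    also have "\<dots> \<le> 32 * A ^ 5 * src_weight D w" using A by (intro mult_left_mono far_region_decay) auto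
    finally show ?thesis .
  qed
  have \<phi>A: "\<bar>\<phi> n z\<bar> \<le> 2 * A * decay z" for n z
  proof (induction n arbitrary: z)
    case 0 show ?case unfolding \<phi>0 using linA[of z] A decay_nonneg[of z] mult_nonneg_nonneg[of A "decay z"] by linarith
  next
    case (Suc n)
    have "\<bar>adv (\<lambda>w. chi w * \<phi> n w ^ 5) z\<bar> \<le> 32 * A ^ 5 * (adv_bound_const / (1 + D)) * decay z"
      by (rule adv_bound) (use p5[OF Suc] A D in \<open>auto intro!: continuous_intros ct\<phi> ctchi\<close>)
    also have "\<dots> = (160 * A ^ 4 * K) * (A * decay z) / 5" unfolding K_def[symmetric] A4[symmetric] by simp
    also have "\<dots> \<le> 1 * (A * decay z) / 5" using sm A decay_nonneg by (intro divide_right_mono mult_right_mono) auto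
    also have "\<dots> \<le> A * decay z" using A decay_nonneg[of z] by simp
    finally show ?case unfolding \<phi>S using linA[of z] by linarith
  qed
  have B: "80 * A ^ 4 * (adv_bound_const / (1 + D)) \<le> 1 / 2" using sm unfolding K_def by simp
  \<comment> \<open>The difference of fifth powers has the factor \<open>p - q\<close> and a
    cofactor of five monomials of degree four, each at most
    \<open>(2 * A * decay w) ^ 4\<close>.\<close>
  have diff5: "\<bar>chi w * p ^ 5 - chi w * q ^ 5\<bar> \<le> 80 * A ^ 4 * c * src_weight D w"
    if p: "\<bar>p\<bar> \<le> 2 * A * decay w" and q: "\<bar>q\<bar> \<le> 2 * A * decay w" and pq: "\<bar>p - q\<bar> \<le> c * decay w" and c: "c \<ge> 0" for w p q c
  proof -
    define X where "X = 2 * A * decay w"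
    have X: "X \<ge> 0" unfolding X_def using A decay_nonneg by simp
    have t: "\<bar>p ^ i * q ^ j\<bar> \<le> X ^ 4" if "i + j = 4" for i j
    proof -
      have "\<bar>p ^ i * q ^ j\<bar> \<le> X ^ i * X ^ j" unfolding abs_mult power_abs using p q X
        by (intro mult_mono power_mono) (auto simp: X_def)
      then show ?thesis using that by (simp add: power_add[symmetric])
    qed
    have "p ^ 5 - q ^ 5 = (p ^ 4 + p ^ 3 * q + p\<^sup>2 * q\<^sup>2 + p * q ^ 3 + q ^ 4) * (p - q)"
      by (simp add: eval_nat_numeral algebra_simps)
    then have e: "chi w * p ^ 5 - chi w * q ^ 5 = (chi w * (p ^ 4 + p ^ 3 * q + p\<^sup>2 * q\<^sup>2 + p * q ^ 3 + q ^ 4)) * (p - q)"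
      by (metis mult.assoc right_diff_distrib)
    have "\<bar>p ^ 4 + p ^ 3 * q + p\<^sup>2 * q\<^sup>2 + p * q ^ 3 + q ^ 4\<bar> \<le> 5 * X ^ 4"
    proof -
      have "\<bar>p ^ 4\<bar> \<le> X ^ 4" "\<bar>p ^ 3 * q\<bar> \<le> X ^ 4" "\<bar>p\<^sup>2 * q\<^sup>2\<bar> \<le> X ^ 4" "\<bar>p * q ^ 3\<bar> \<le> X ^ 4" "\<bar>q ^ 4\<bar> \<le> X ^ 4"
        using t[of 4 0] t[of 3 1] t[of 2 2] t[of 1 3] t[of 0 4] by simp_all
      then show ?thesis by linarith
    qed
    then have "\<bar>chi w * (p ^ 4 + p ^ 3 * q + p\<^sup>2 * q\<^sup>2 + p * q ^ 3 + q ^ 4)\<bar> \<le> far_region D w * (5 * X ^ 4)"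
      unfolding abs_mult using chi1 by (intro mult_mono far_region_nonneg) auto
    also have "\<dots> = 80 * A ^ 4 * (far_region D w * decay w ^ 4)" unfolding X_def by (simp add: power_mult_distrib)
    finally show ?thesis unfolding e by (rule far_source_bound[OF _ pq]) (use A c in auto)
  qed
  have base: "cauchy_wrt decay \<phi>"
  proof -
    have "\<exists>N. \<forall>m\<ge>N. \<forall>n\<ge>N. \<forall>z. \<bar>\<phi> m z - \<phi> n z\<bar> \<le> \<epsilon> * decay z" if "\<epsilon> > 0" for \<epsilon>
    proof (rule contraction_cauchy[OF \<phi>A decay_nonneg _ _ that])
      fix e :: real assume e: "e > 0"
      show "\<exists>N. \<forall>m\<ge>N. \<forall>n\<ge>N. \<forall>c\<ge>0. (\<forall>z. \<bar>\<phi> m z - \<phi> n z\<bar> \<le> c * decay z) \<longrightarrow>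
        (\<forall>z. \<bar>\<phi> (Suc m) z - \<phi> (Suc n) z\<bar> \<le> (e + c / 2) * decay z)"
      proof (intro exI[of _ 0] allI impI)
        fix m n c z assume c: "0 \<le> (c :: real)" "\<forall>z. \<bar>\<phi> m z - \<phi> n z\<bar> \<le> c * decay z"
        have "\<bar>adv (\<lambda>w. chi w * \<phi> m w ^ 5 - chi w * \<phi> n w ^ 5) z\<bar> \<le> 80 * A ^ 4 * c * (adv_bound_const / (1 + D)) * decay z"
          by (rule adv_bound) (use diff5[OF \<phi>A \<phi>A] c A D in \<open>auto intro!: continuous_intros ct\<phi> ctchi\<close>)
        also have "\<dots> = (80 * A ^ 4 * (adv_bound_const / (1 + D))) * (c * decay z)" by simp
        also have "\<dots> \<le> 1 / 2 * (c * decay z)" using B c decay_nonneg by (intro mult_right_mono) auto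
        also have "\<dots> \<le> (e + c / 2) * decay z" using e c decay_nonneg[of z] by (simp add: algebra_simps)
        finally show "\<bar>\<phi> (Suc m) z - \<phi> (Suc n) z\<bar> \<le> (e + c / 2) * decay z"
          unfolding \<phi>S adv_plus(2)[OF src5[OF chi \<phi>k] src5[OF chi \<phi>k]] by simp
      qed
    qed (use A in simp)
    then show ?thesis unfolding cauchy_wrt_def using ct\<phi> \<phi>A by blast
  qed
  have all: "wcauchy k decay \<phi>" for k
  proof (induction k)
    case 0 show ?case using base by simp
  next
    case (Suc k)
    have dchi: "chi differentiable (at z)" for z by (rule wcauchy_diff[OF chi])
    have d\<phi>: "\<phi> n differentiable (at z)" for n z by (rule wcauchy_diff[OF \<phi>k])
    have d\<phi>5: "(\<lambda>z. \<phi> n z ^ 5) differentiable (at z)" for n z by (intro differentiable_power d\<phi>)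
    have dlin: "lin differentiable (at z)" for z by (rule wcauchy_diff[OF lin])
    \<comment> \<open>The coefficient is the linearisation of the quintic term; its bound
      \<open>80 * A ^ 4\<close> below coincides with the Lipschitz constant. The statement covers
      arbitrary sequences because it is applied both to the iterates and to a single
      iterate.\<close>
    have b: "wcauchy k (\<lambda>z. far_region D z * decay z ^ 4) (\<lambda>n w. 5 * (chi w * \<phi> n w ^ 4))" if "wcauchy k decay \<phi>" for k \<phi>
      by (intro wcauchy_cmult wcauchy_mult wcauchy_power chi that far_region_nonneg decay_nonneg zero_le_power mult_nonneg_nonneg)
    have "wcauchy k decay (\<lambda>n. ddir e (\<phi> n))" for e
    proof (rule linear_iteration_wcauchy[OF D _ B, where b = "\<lambda>n w. 5 * (chi w * \<phi> n w ^ 4)"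
          and g = "\<lambda>n z. ddir e lin z + adv (\<lambda>w. ddir e chi w * \<phi> n w ^ 5) z"])
      show "wcauchy k decay (\<lambda>n z. ddir e lin z + adv (\<lambda>w. ddir e chi w * \<phi> n w ^ 5) z)"
        by (intro wcauchy_add wcauchy_adv src5 Suc wcauchy_ddir[OF lin] wcauchy_ddir[OF chi])
      show "\<bar>5 * (chi z * \<phi> n z ^ 4)\<bar> \<le> 80 * A ^ 4 * (far_region D z * decay z ^ 4)" for n z
      proof -
        have "\<bar>\<phi> n z\<bar> ^ 4 \<le> (2 * A * decay z) ^ 4" by (intro power_mono \<phi>A) auto
        then have "\<bar>chi z * \<phi> n z ^ 4\<bar> \<le> far_region D z * (2 * A * decay z) ^ 4"
          unfolding abs_mult power_abs using chi1 by (intro mult_mono far_region_nonneg) auto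
        also have "\<dots> = 16 * A ^ 4 * (far_region D z * decay z ^ 4)" by (simp add: power_mult_distrib)
        finally have "\<bar>chi z * \<phi> n z ^ 4\<bar> \<le> 16 * A ^ 4 * (far_region D z * decay z ^ 4)" .
        then show ?thesis by linarith
      qed
      show "ddir e (\<phi> (Suc n)) = (\<lambda>z. ddir e lin z + adv (\<lambda>w. ddir e chi w * \<phi> n w ^ 5) z + adv (\<lambda>w. 5 * (chi w * \<phi> n w ^ 4) * ddir e (\<phi> n) w) z)" for n
      proof -
        note ad = adv_differentiable_ddir[OF src5[OF chi \<phi>k] src_weight_nonneg src_weight_le_cone_wt]
        have s1: "wbdd k (src_weight 0) (\<lambda>w. ddir e chi w * \<phi> n w ^ 5)" by (intro src5 wcauchy_ddir[OF chi] \<phi>k)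
        have s2: "wbdd k (src_weight 0) (\<lambda>w. 5 * (chi w * \<phi> n w ^ 4) * ddir e (\<phi> n) w)"
          by (rule wcauchy_source[OF b[OF \<phi>k] wcauchy_ddir[OF \<phi>k] D])
        have "ddir e (\<phi> (Suc n)) = (\<lambda>z. ddir e lin z + ddir e (adv (\<lambda>w. chi w * \<phi> n w ^ 5)) z)"
          unfolding \<phi>S by (rule ddir_add[OF dlin ad(1)])
        also have "ddir e (adv (\<lambda>w. chi w * \<phi> n w ^ 5)) = adv (\<lambda>w. ddir e chi w * \<phi> n w ^ 5 + 5 * (chi w * \<phi> n w ^ 4) * ddir e (\<phi> n) w)"
          unfolding ad(2) ddir_mult[OF dchi d\<phi>5] ddir_power[OF d\<phi>] by (simp add: algebra_simps)
        finally show ?thesis unfolding adv_plus(1)[OF s1 s2] by (simp add: add_ac)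
      qed
    qed (use A b[OF Suc] wcauchy_ddir[OF \<phi>k] in auto)
    then show ?case using base d\<phi> unfolding wcauchy.simps by blast
  qed
  define p where "p z = lim (\<lambda>n. \<phi> n z)" for z
  have pk: "wbdd k decay p" for k unfolding p_def by (rule wcauchy_lim[OF all decay_nonneg decay_le_1])
  have ctp: "continuous_on UNIV p" using wcauchy_imp_cauchy_wrt[OF pk] unfolding cauchy_wrt_def by blast
  have tp: "(\<lambda>n. \<phi> n z) \<longlonglongrightarrow> p z" for z unfolding p_def by (rule wcauchy_tendsto[OF base])
  have "p z = lin z + adv (\<lambda>w. chi w * p w ^ 5) z" for z
  proof -
    \<comment> \<open>Pointwise convergence is enough here, as the uniform bound on the iterates
      supplies the majorant.\<close>
    have "(\<lambda>n. adv (\<lambda>w. chi w * \<phi> n w ^ 5) z) \<longlonglongrightarrow> adv (\<lambda>w. chi w * p w ^ 5) z"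
    proof (rule adv_tendsto[where C = "32 * A ^ 5" and R = "norm (snd z)"])
      show "\<bar>chi w * \<phi> n w ^ 5\<bar> \<le> 32 * A ^ 5 * cone_wt w" for n w
        using order_trans[OF p5[OF \<phi>A] mult_left_mono[OF src_weight_le_cone_wt]] A by simp
      show "(\<lambda>n. chi (z + (norm y, y)) * \<phi> n (z + (norm y, y)) ^ 5) \<longlonglongrightarrow> chi (z + (norm y, y)) * p (z + (norm y, y)) ^ 5" for y
        by (intro tendsto_intros tp)
    qed (use A in \<open>auto intro!: continuous_intros ct\<phi> ctchi ctp\<close>)
    then have "(\<lambda>n. \<phi> (Suc n) z) \<longlonglongrightarrow> lin z + adv (\<lambda>w. chi w * p w ^ 5) z" unfolding \<phi>S by (intro tendsto_intros)
    moreover have "(\<lambda>n. \<phi> (Suc n) z) \<longlonglongrightarrow> p z" using tp LIMSEQ_Suc by blast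
    ultimately show ?thesis using LIMSEQ_unique by blast
  qed
  then show ?thesis using that pk by blast
qed

section \<open>The approximate solution\<close>

text \<open>The Japanese bracket of the spatial variable, a substitute for the radius that is smooth
  on the axis and exceeds it by at most 1.\<close>

definition bracket :: "spacetime \<Rightarrow> real" where
  "bracket z = sqrt (1 + (norm (snd z))\<^sup>2)"

definition ibracket :: "spacetime \<Rightarrow> real" where
  "ibracket z = 1 / bracket z"

text \<open>A smooth substitute for the component along \<open>a\<close> of the unit vector
  \<open>x / norm x\<close>. It is also the derivative of \<open>bracket\<close> in the spatial
  direction \<open>a\<close>.\<close>

definition om :: "real ^ 3 \<Rightarrow> spacetime \<Rightarrow> real" where
  "om a z = (snd z \<bullet> a) * ibracket z"

lemma bracket_pos: "bracket z > 0" unfolding bracket_def by (simp add: add_pos_nonneg)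

lemma bracket_bounds: "norm (snd z) \<le> bracket z" "bracket z \<le> 1 + norm (snd z)" "1 \<le> bracket z"
proof -
  show "norm (snd z) \<le> bracket z" unfolding bracket_def by (rule real_le_rsqrt) simp
  show "bracket z \<le> 1 + norm (snd z)" unfolding bracket_def by (rule real_le_lsqrt) (auto simp: power2_sum)
  show "1 \<le> bracket z" unfolding bracket_def by simp
qed

lemma ibracket_pos: "ibracket z > 0" unfolding ibracket_def using bracket_pos by simp

lemma ibracket_le_decay: "ibracket z \<le> 2 * decay z"
  unfolding ibracket_def decay_def using bracket_bounds[of z] bracket_pos[of z] by (simp add: field_simps add_pos_nonneg)

lemma has_derivative_bracket: "(bracket has_derivative (\<lambda>h. om (snd h) z)) (at z)"
proof -
  have "((\<lambda>z. 1 + snd z \<bullet> snd z) has_derivative (\<lambda>h. 2 * (snd z \<bullet> snd h))) (at z)"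
    by (auto intro!: derivative_eq_intros simp: inner_commute)
  then have "((\<lambda>z. sqrt (1 + snd z \<bullet> snd z)) has_derivative (\<lambda>h. (2 * (snd z \<bullet> snd h)) * (inverse (sqrt (1 + snd z \<bullet> snd z)) / 2))) (at z)"
    by (intro has_derivative_real_sqrt) (auto simp: add_pos_nonneg mult.commute)
  moreover have j: "bracket = (\<lambda>z. sqrt (1 + snd z \<bullet> snd z))" unfolding bracket_def power2_norm_eq_inner ..
  ultimately show ?thesis unfolding om_def ibracket_def j by (simp add: inverse_eq_divide)
qed

lemma has_derivative_ibracket: "(ibracket has_derivative (\<lambda>h. - om (snd h) z * (ibracket z)\<^sup>2)) (at z)"
proof -
  have "((\<lambda>z. inverse (bracket z)) has_derivative (\<lambda>h. - (inverse (bracket z) * om (snd h) z * inverse (bracket z)))) (at z)"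
    by (rule Deriv.has_derivative_inverse[OF _ has_derivative_bracket]) (use bracket_pos[of z] in simp)
  moreover have "ibracket = (\<lambda>z. inverse (bracket z))" by (rule ext) (simp add: ibracket_def inverse_eq_divide)
  moreover have "inverse (bracket z) = ibracket z" by (simp add: ibracket_def inverse_eq_divide)
  ultimately show ?thesis by (simp add: power2_eq_square mult_ac)
qed

lemma ddir_ibracket: "ddir e ibracket z = - om (snd e) z * (ibracket z)\<^sup>2" by (rule ddir_eq[OF has_derivative_ibracket])

lemma ibracket_differentiable: "ibracket differentiable (at z)" using has_derivative_ibracket differentiable_def by blast

lemma has_derivative_om: "(om a has_derivative (\<lambda>h. ibracket z * (snd h \<bullet> a - om a z * om (snd h) z))) (at z)"
proof -
  have "((\<lambda>z. (snd z \<bullet> a) * ibracket z) has_derivative (\<lambda>h. (snd z \<bullet> a) * (- om (snd h) z * (ibracket z)\<^sup>2) + (snd h \<bullet> a) * ibracket z)) (at z)"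
    by (intro has_derivative_mult has_derivative_ibracket has_derivative_inner_left has_derivative_snd has_derivative_ident)
  then show ?thesis unfolding om_def[abs_def] by (simp add: power2_eq_square algebra_simps)
qed

lemma ddir_om: "ddir e (om a) z = ibracket z * (snd e \<bullet> a - om a z * om (snd e) z)" by (rule ddir_eq[OF has_derivative_om])

lemma om_differentiable: "om a differentiable (at z)" using has_derivative_om differentiable_def by blast

lemma om_abs_le: "\<bar>om a z\<bar> \<le> norm a"
proof -
  have "\<bar>snd z \<bullet> a\<bar> \<le> bracket z * norm a"
    using order_trans[OF Cauchy_Schwarz_ineq2 mult_right_mono[OF bracket_bounds(1)]] by simp
  then show ?thesis unfolding om_def ibracket_def using bracket_pos[of z] by (simp add: abs_mult field_simps)
qed

lemma continuous_ibracket: "continuous_on UNIV ibracket"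
  by (rule differentiable_imp_continuous_on) (simp add: ibracket_differentiable differentiable_at_imp_differentiable_on)

lemma continuous_om: "continuous_on UNIV (om a)"
  by (rule differentiable_imp_continuous_on) (simp add: om_differentiable differentiable_at_imp_differentiable_on)

text \<open>The induction has to treat both families together, because the derivatives of each are
  polynomials in the other as well.\<close>

lemma wbdd_ibracket_om: "wbdd k decay ibracket \<and> (\<forall>a. wbdd k (\<lambda>_. 1) (om a))"
proof (induction k)
  case 0
  have "cauchy_wrt decay (\<lambda>_. ibracket)"
    by (rule cauchy_wrt_const[of _ 2]) (use continuous_ibracket ibracket_le_decay ibracket_pos decay_nonneg in \<open>auto simp: abs_of_pos\<close>)
  moreover have "cauchy_wrt (\<lambda>_. 1) (\<lambda>_. om a)" for a
    by (rule cauchy_wrt_const[of _ "norm a"]) (use continuous_om om_abs_le in auto)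
  ultimately show ?case by simp
next
  case (Suc k)
  have i: "wbdd k decay ibracket" and o: "wbdd k (\<lambda>_. 1) (om a)" for a using Suc by auto
  have i1: "wbdd k (\<lambda>_. 1) ibracket" by (rule wcauchy_mono[OF i decay_nonneg, of 1]) (simp_all add: decay_le_1)
  have 1: "wbdd k decay (ddir e ibracket)" for e
  proof -
    have "wbdd k (\<lambda>z. 1 * (1 * decay z)) (\<lambda>z. (-1 * om (snd e) z) * (ibracket z * ibracket z))"
      by (intro wcauchy_mult wcauchy_cmult o i i1) (auto simp: decay_nonneg)
    moreover have "ddir e ibracket = (\<lambda>z. (-1 * om (snd e) z) * (ibracket z * ibracket z))"
      by (rule ext) (simp add: ddir_ibracket power2_eq_square)
    ultimately show ?thesis by simp
  qed
  have 2: "wbdd k (\<lambda>_. 1) (ddir e (om a))" for e a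
  proof -
    have "wbdd k (\<lambda>_. 1 * 1) (\<lambda>z. ibracket z * (snd e \<bullet> a - om a z * om (snd e) z))"
    proof (rule wcauchy_mult[OF i1])
      have "wbdd k (\<lambda>_. 1 * 1) (\<lambda>z. om a z * om (snd e) z)" by (intro wcauchy_mult o) auto
      then show "wbdd k (\<lambda>_. 1) (\<lambda>z. snd e \<bullet> a - om a z * om (snd e) z)" by (intro wcauchy_minus wbdd_const) auto
    qed auto
    moreover have "ddir e (om a) = (\<lambda>z. ibracket z * (snd e \<bullet> a - om a z * om (snd e) z))"
      by (rule ext) (simp add: ddir_om)
    ultimately show ?thesis by simp
  qed
  have "cauchy_wrt decay (\<lambda>_. ibracket)" "cauchy_wrt (\<lambda>_. 1) (\<lambda>_. om a)" for a
    using wcauchy_imp_cauchy_wrt i o by blast+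
  then show ?case using 1 2 ibracket_differentiable om_differentiable unfolding wcauchy.simps by blast
qed

lemmas wbdd_ibracket = wbdd_ibracket_om[THEN conjunct1]
lemmas wbdd_om = wbdd_ibracket_om[THEN conjunct2, rule_format]

text \<open>The defect from 1 is the price of the smooth substitute for the unit vector; being
  quadratic in \<open>ibracket\<close>, it only affects error terms of the wave operator.\<close>

lemma sum_om_square: "(\<Sum>b\<in>Basis. (om b z)\<^sup>2) = 1 - (ibracket z)\<^sup>2"
proof -
  have "(\<Sum>b\<in>Basis. (om b z)\<^sup>2) = (\<Sum>b\<in>Basis. (snd z \<bullet> b) * (snd z \<bullet> b)) * (ibracket z)\<^sup>2"
    unfolding om_def by (simp add: power2_eq_square sum_distrib_left mult_ac)
  also have "(\<Sum>b\<in>Basis. (snd z \<bullet> b) * (snd z \<bullet> b)) = (norm (snd z))\<^sup>2"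
    unfolding power2_norm_eq_inner by (subst euclidean_inner) simp
  also have "(norm (snd z))\<^sup>2 * (ibracket z)\<^sup>2 = 1 - (ibracket z)\<^sup>2"
  proof -
    have "(bracket z)\<^sup>2 = 1 + (norm (snd z))\<^sup>2" unfolding bracket_def by (simp add: add_nonneg_nonneg)
    moreover have "(bracket z)\<^sup>2 * (ibracket z)\<^sup>2 = 1" unfolding ibracket_def using bracket_pos[of z] by (simp add: power_one_over)
    ultimately show ?thesis by (simp add: algebra_simps)
  qed
  finally show ?thesis .
qed

text \<open>Smoothed coordinates \<open>(u, \<omega>)\<close> on all of spacetime. Along an outgoing
  cone they converge to the corresponding point of null infinity, so a function on the target space
  can be pulled back to an outgoing wave profile.\<close>

definition scri_map :: "spacetime \<Rightarrow> spacetime" where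
  "scri_map z = ((fst z - bracket z) / 2, ibracket z *\<^sub>R snd z)"

lemma scri_map_components: "scri_map z \<bullet> (1, 0) = (fst z - bracket z) / 2" "scri_map z \<bullet> (0, b) = om b z"
  unfolding scri_map_def om_def by auto

lemma scri_map_differentiable: "scri_map differentiable (at z)"
proof -
  have "((\<lambda>z. ((fst z - bracket z) / 2, ibracket z *\<^sub>R snd z)) has_derivative
     (\<lambda>h. ((fst h - om (snd h) z) / 2, ibracket z *\<^sub>R snd h + (- om (snd h) z * (ibracket z)\<^sup>2) *\<^sub>R snd z))) (at z)"
    by (intro has_derivative_Pair has_derivative_diff has_derivative_bracket has_derivative_fst
        has_derivative_ident has_derivative_scaleR has_derivative_ibracket has_derivative_snd bounded_linear.has_derivative[OF bounded_linear_divide])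
  then show ?thesis unfolding scri_map_def[abs_def] differentiable_def by blast
qed

lemma ddir_scri_map_0: "ddir e (\<lambda>z. scri_map z \<bullet> (1, 0)) = (\<lambda>z. (fst e - om (snd e) z) / 2)"
proof
  fix z
  have "((\<lambda>z. (fst z - bracket z) / 2) has_derivative (\<lambda>h. (fst h - om (snd h) z) / 2)) (at z)"
    by (intro has_derivative_diff has_derivative_bracket has_derivative_fst has_derivative_ident bounded_linear.has_derivative[OF bounded_linear_divide])
  from ddir_eq[OF this] show "ddir e (\<lambda>z. scri_map z \<bullet> (1, 0)) z = (fst e - om (snd e) z) / 2"
    unfolding scri_map_components .
qed

lemma wbdd_compose_scri_map:
  assumes "wbdd k w H" "\<And>z. 0 \<le> w z"
  shows "wbdd k (\<lambda>z. w (scri_map z)) (\<lambda>z. H (scri_map z))"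
proof (rule wbdd_compose[OF assms scri_map_differentiable])
  fix b e :: spacetime assume b: "b \<in> Basis"
  show "wbdd k (\<lambda>_. 1) (ddir e (\<lambda>z. scri_map z \<bullet> b))"
  proof (cases "b = (1, 0)")
    case True
    have "wbdd k (\<lambda>_. 1) (\<lambda>z. (1/2) * (fst e - om (snd e) z))"
      by (intro wcauchy_cmult wcauchy_minus wbdd_const wbdd_om) auto
    then show ?thesis unfolding True ddir_scri_map_0 by simp
  next
    case False
    then obtain b' where "b = (0, b')" using b unfolding Basis_spacetime by auto
    then show ?thesis using wcauchy_ddir[OF wbdd_om[of "Suc k"]] by (simp add: scri_map_components)
  qed
qed

lemma ddir_compose_scri_map:
  assumes "\<And>w. H differentiable (at w)"
  shows "ddir e (\<lambda>z. H (scri_map z)) z = ddir (1, 0) H (scri_map z) * ((fst e - om (snd e) z) / 2)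
     + (\<Sum>b\<in>Basis. ddir (0, b) H (scri_map z) * ddir e (om b) z)"
proof -
  have "ddir e (\<lambda>z. H (scri_map z)) z = (\<Sum>b\<in>Basis. ddir b H (scri_map z) * ddir e (\<lambda>z. scri_map z \<bullet> b) z)"
    by (rule ddir_compose_at[OF assms scri_map_differentiable])
  also have "\<dots> = ddir (1, 0) H (scri_map z) * ddir e (\<lambda>z. scri_map z \<bullet> (1, 0)) z
     + (\<Sum>b\<in>Pair 0 ` Basis. ddir b H (scri_map z) * ddir e (\<lambda>z. scri_map z \<bullet> b) z)"
    unfolding Basis_spacetime by (subst sum.insert) auto
  also have "(\<Sum>b\<in>Pair 0 ` Basis. ddir b H (scri_map z) * ddir e (\<lambda>z. scri_map z \<bullet> b) z)
      = (\<Sum>b\<in>Basis. ddir (0, b) H (scri_map z) * ddir e (om b) z)"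
    by (subst sum.reindex) (auto simp: inj_on_def scri_map_components)
  finally show ?thesis unfolding ddir_scri_map_0 .
qed

text \<open>Only the support in the first coordinate has to be recorded: the second component of
  \<open>scri_map\<close> always lies in the unit ball.\<close>

definition strip :: "real \<Rightarrow> spacetime \<Rightarrow> real" where
  "strip c w = (if \<bar>fst w\<bar> \<le> c then 1 else 0)"

lemma strip_nonneg: "0 \<le> strip c w" unfolding strip_def by simp

text \<open>The index \<open>j\<close> counts powers of decay. The derivations \<open>good i\<close> below annihilate \<open>t - bracket\<close>, hence
  raise the index by one, and the wave operator is a sum of products of two of them up to terms
  that can be computed explicitly.\<close>

inductive scri_symbol :: "real \<Rightarrow> nat \<Rightarrow> (spacetime \<Rightarrow> real) \<Rightarrow> bool" for c where
  compose: "(\<And>k. wbdd k (strip c) H) \<Longrightarrow> scri_symbol c 0 (\<lambda>z. H (scri_map z))"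
| ibracket: "scri_symbol c j f \<Longrightarrow> scri_symbol c (Suc j) (\<lambda>z. ibracket z * f z)"
| om: "scri_symbol c j f \<Longrightarrow> scri_symbol c j (\<lambda>z. om a z * f z)"
| add: "scri_symbol c j f \<Longrightarrow> scri_symbol c j g \<Longrightarrow> scri_symbol c j (\<lambda>z. f z + g z)"
| cmult: "scri_symbol c j f \<Longrightarrow> scri_symbol c j (\<lambda>z. r * f z)"

lemma scri_symbol_wbdd: "scri_symbol c j f \<Longrightarrow> wbdd k (\<lambda>z. strip c (scri_map z) * decay z ^ j) f"
proof (induction rule: scri_symbol.induct)
  case (compose H)
  then show ?case using wbdd_compose_scri_map[OF compose strip_nonneg] by simp
next
  case (ibracket j f)
  have "wbdd k (\<lambda>z. decay z * (strip c (scri_map z) * decay z ^ j)) (\<lambda>z. ibracket z * f z)"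
    by (intro wcauchy_mult wbdd_ibracket ibracket.IH) (auto simp: decay_nonneg strip_nonneg)
  then show ?case by (simp add: mult_ac)
next
  case (om j f a)
  have "wbdd k (\<lambda>z. 1 * (strip c (scri_map z) * decay z ^ j)) (\<lambda>z. om a z * f z)"
    by (intro wcauchy_mult wbdd_om om.IH) (auto simp: decay_nonneg strip_nonneg)
  then show ?case by simp
next
  case (add j f g)
  show ?case by (rule wcauchy_add[OF add.IH])
next
  case (cmult j f r)
  show ?case by (rule wcauchy_cmult[OF cmult.IH]) (auto simp: decay_nonneg strip_nonneg)
qed

lemma scri_symbol_differentiable: "scri_symbol c j f \<Longrightarrow> f differentiable (at z)"
  by (rule wcauchy_diff[OF scri_symbol_wbdd])

lemma scri_symbol_zero: "scri_symbol c j (\<lambda>_. 0)"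
proof (induction j)
  case 0 show ?case by (rule scri_symbol.compose[of c "\<lambda>_. 0"]) (rule wbdd_zero[OF strip_nonneg])
next
  case (Suc j) then show ?case using scri_symbol.ibracket[OF Suc] by simp
qed

lemma scri_symbol_sum: "(\<And>i. i \<in> I \<Longrightarrow> scri_symbol c j (f i)) \<Longrightarrow> scri_symbol c j (\<lambda>z. \<Sum>i\<in>I. f i z)"
proof (induction I rule: infinite_finite_induct)
  case (insert x F)
  then have "scri_symbol c j (\<lambda>z. f x z + (\<Sum>i\<in>F. f i z))" by (intro scri_symbol.add) auto
  then show ?case using insert by simp
qed (auto intro: scri_symbol_zero)

lemma scri_symbol_diff: "scri_symbol c j f \<Longrightarrow> scri_symbol c j g \<Longrightarrow> scri_symbol c j (\<lambda>z. f z - g z)"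
  using scri_symbol.add[OF _ scri_symbol.cmult[of c j g "-1"], of f] by simp

text \<open>Differentiation tangential to the outgoing cones on which \<open>t - bracket\<close> is
  constant, the good derivatives of wave equation theory.\<close>

definition good :: "real ^ 3 \<Rightarrow> (spacetime \<Rightarrow> real) \<Rightarrow> spacetime \<Rightarrow> real" where
  "good i f z = ddir (0, i) f z + om i z * ddir (1, 0) f z"

lemma om_zero [simp]: "om 0 z = 0" unfolding om_def by simp

text \<open>The derivative of \<open>H\<close> in its first slot drops out, and every derivative of
  \<open>om\<close> carries a factor \<open>ibracket\<close>; this is the gain of one power of
  decay.\<close>

lemma good_compose:
  assumes "\<And>w. H differentiable (at w)"
  shows "good i (\<lambda>z. H (scri_map z)) z = ibracket z * ((\<Sum>b\<in>Basis. (i \<bullet> b) * ddir (0, b) H (scri_map z))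
     - om i z * (\<Sum>b\<in>Basis. om b z * ddir (0, b) H (scri_map z)))"
proof -
  have "good i (\<lambda>z. H (scri_map z)) z = (\<Sum>b\<in>Basis. ddir (0, b) H (scri_map z) * (ibracket z * (i \<bullet> b - om b z * om i z)))"
    unfolding good_def ddir_compose_scri_map[OF assms] ddir_om by simp
  also have "\<dots> = ibracket z * ((\<Sum>b\<in>Basis. (i \<bullet> b) * ddir (0, b) H (scri_map z))
     - om i z * (\<Sum>b\<in>Basis. om b z * ddir (0, b) H (scri_map z)))"
    by (simp add: sum_distrib_left right_diff_distrib sum_subtractf mult_ac)
  finally show ?thesis .
qed

lemma good_mult:
  assumes "f differentiable (at z)" "g differentiable (at z)"
  shows "good i (\<lambda>z. f z * g z) z = f z * good i g z + good i f z * g z"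
  unfolding good_def ddir_mult_at[OF assms] by (simp add: algebra_simps)

lemma good_ibracket: "good i ibracket z = - om i z * (ibracket z)\<^sup>2"
  unfolding good_def ddir_ibracket by simp

lemma good_om: "good i (om a) z = ibracket z * (i \<bullet> a - om a z * om i z)"
  unfolding good_def ddir_om by simp

text \<open>Commuting \<open>good i\<close> past a factor \<open>ibracket\<close> or
  \<open>om a\<close> leaves a term with one more power of \<open>ibracket\<close>, so the gain seen
  for \<open>compose\<close> persists through all constructors.\<close>

lemma scri_symbol_good: "scri_symbol c j f \<Longrightarrow> scri_symbol c (Suc j) (good i f)"
proof (induction rule: scri_symbol.induct)
  case (compose H)
  have d: "H differentiable (at w)" for w by (rule wcauchy_diff[OF compose])
  have s: "scri_symbol c 0 (\<lambda>z. ddir (0, b) H (scri_map z))" for b by (intro scri_symbol.compose wcauchy_ddir compose)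
  show ?case unfolding good_compose[OF d, abs_def]
    by (intro scri_symbol.ibracket scri_symbol_diff scri_symbol_sum scri_symbol.om scri_symbol.cmult s)
next
  case (ibracket j f)
  have "good i (\<lambda>z. ibracket z * f z) = (\<lambda>z. ibracket z * good i f z + (-1) * (om i z * (ibracket z * (ibracket z * f z))))"
    by (rule ext, subst good_mult[OF ibracket_differentiable scri_symbol_differentiable[OF ibracket.hyps]])
      (simp add: good_ibracket power2_eq_square)
  then show ?case
    by (simp only:) (intro scri_symbol.add scri_symbol.ibracket[OF ibracket.IH] scri_symbol.cmult scri_symbol.om scri_symbol.ibracket ibracket.hyps)
next
  case (om j f a)
  have "good i (\<lambda>z. om a z * f z) = (\<lambda>z. om a z * good i f z + ibracket z * ((i \<bullet> a) * f z - om a z * (om i z * f z)))"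
    by (rule ext, subst good_mult[OF om_differentiable scri_symbol_differentiable[OF om.hyps]])
      (simp add: good_om algebra_simps)
  then show ?case
    by (simp only:) (intro scri_symbol.add scri_symbol.cmult scri_symbol.om[OF om.IH] scri_symbol.om scri_symbol.ibracket scri_symbol_diff om.hyps)
next
  case (add j f g)
  have "good i (\<lambda>z. f z + g z) = (\<lambda>z. good i f z + good i g z)"
    unfolding good_def ddir_add[OF scri_symbol_differentiable[OF add.hyps(1)] scri_symbol_differentiable[OF add.hyps(2)]]
    by (simp add: algebra_simps)
  then show ?case using add by (auto intro!: scri_symbol.add)
next
  case (cmult j f r)
  have "good i (\<lambda>z. r * f z) = (\<lambda>z. r * good i f z)"
    unfolding good_def ddir_cmult[OF scri_symbol_differentiable[OF cmult.hyps(1)]]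
    by (simp add: algebra_simps)
  then show ?case using cmult by (auto intro!: scri_symbol.cmult)
qed

text \<open>Spatial derivatives are replaced by \<open>good i f - om i * ddir (1, 0) f\<close>. The
  second time derivatives nearly cancel by \<open>sum_om_square\<close>, and the divergence of the
  \<open>om i\<close> accounts for \<open>ibracket * (2 + ibracket ^ 2)\<close>.\<close>

lemma wave_op_good:
  fixes f :: "spacetime \<Rightarrow> real"
  assumes d: "\<And>z. f differentiable (at z)" and dd: "\<And>e z. ddir e f differentiable (at z)"
    and comm: "\<And>a b z. ddir a (ddir b f) z = ddir b (ddir a f) z"
  shows "wave_op f z = - (ibracket z)\<^sup>2 * ddir (1, 0) (ddir (1, 0) f) z + (\<Sum>i\<in>Basis. good i (good i f) z)
     - ibracket z * (2 + (ibracket z)\<^sup>2) * ddir (1, 0) f z - 2 * (\<Sum>i\<in>Basis. om i z * good i (ddir (1, 0) f) z)"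
proof -
  define T where "T = ddir (1, 0) f"
  have each: "good i (good i f) z = ddir (0, i) (ddir (0, i) f) z + 2 * (om i z * good i T z) + ibracket z * (1 - (om i z)\<^sup>2) * T z
      - (om i z)\<^sup>2 * ddir (1, 0) T z" if i: "i \<in> Basis" for i
  proof -
    have g: "good i f = (\<lambda>z. ddir (0, i) f z + om i z * T z)" unfolding good_def T_def ..
    have dT: "T differentiable (at z)" for z unfolding T_def by (rule dd)
    have "ddir e (good i f) z = ddir e (ddir (0, i) f) z + (om i z * ddir e T z + ddir e (om i) z * T z)" for e
      unfolding g by (subst ddir_add[OF dd differentiable_mult[OF om_differentiable dT]]) (simp add: ddir_mult_at[OF om_differentiable dT])
    note 1 = this
    have 2: "ddir (1, 0) (ddir (0, i) f) z = ddir (0, i) T z" unfolding T_def by (rule comm)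
    show ?thesis unfolding good_def[of i "good i f"] good_def[of i T] 1 2 ddir_om
      using i by (simp add: inner_Basis power2_eq_square algebra_simps)
  qed
  have "(\<Sum>i\<in>Basis. good i (good i f) z) = (\<Sum>i\<in>Basis. ddir (0, i) (ddir (0, i) f) z) + 2 * (\<Sum>i\<in>Basis. om i z * good i T z)
      + (\<Sum>i\<in>Basis. ibracket z * (1 - (om i z)\<^sup>2) * T z) - (\<Sum>i\<in>Basis. (om i z)\<^sup>2 * ddir (1, 0) T z)"
    by (simp add: each sum.distrib sum_subtractf sum_distrib_left)
  also have "(\<Sum>i\<in>Basis. ibracket z * (1 - (om i z)\<^sup>2) * T z) = ibracket z * (3 - (\<Sum>i\<in>Basis. (om i z)\<^sup>2)) * T z"
    by (simp add: sum_distrib_right[symmetric] sum_distrib_left[symmetric] sum_subtractf)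
  also have "(\<Sum>i\<in>Basis. (om i z)\<^sup>2 * ddir (1, 0) T z) = (\<Sum>i\<in>Basis. (om i z)\<^sup>2) * ddir (1, 0) T z"
    by (simp add: sum_distrib_right)
  finally show ?thesis unfolding wave_op_def sum_om_square T_def by (simp add: algebra_simps)
qed

section \<open>The wave operator on the leading outgoing term\<close>

lemma sum_inner_Basis_mult:
  assumes "i \<in> Basis"
  shows "(\<Sum>b\<in>Basis. (i \<bullet> b) * g b) = (g i :: real)"
proof -
  have "(\<Sum>b\<in>Basis. (i \<bullet> b) * g b) = (\<Sum>b\<in>Basis. if b = i then g b else 0)"
    using assms by (intro sum.cong) (auto simp: inner_Basis)
  then show ?thesis using assms by simp
qed

text \<open>The amplitude \<open>ibracket\<close> is the one for which the terms of second order
  cancel: the first-order time derivative in \<open>wave_op_good\<close> against what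
  \<open>good i\<close> produces from \<open>ibracket\<close> in the last sum. This is the transport
  equation for outgoing waves; everything else is of third order or better.\<close>

lemma wave_op_approx:
  assumes G: "\<And>k. wbdd k (strip c) G"
  shows "wbdd k (\<lambda>z. strip c (scri_map z) * decay z ^ 3) (wave_op (\<lambda>z. ibracket z * G (scri_map z)))"
proof -
  define f where "f = (\<lambda>z. ibracket z * G (scri_map z))"
  have dG: "G differentiable (at w)" for w by (rule wcauchy_diff[OF G])
  have symf: "scri_symbol c (Suc 0) f" unfolding f_def by (intro scri_symbol.ibracket scri_symbol.compose G)
  have d: "f differentiable (at z)" for z by (rule scri_symbol_differentiable[OF symf])
  have w1: "wbdd k (\<lambda>z. strip c (scri_map z) * decay z ^ Suc 0) (ddir e f)" for k e
    by (rule wcauchy_ddir[OF scri_symbol_wbdd[OF symf]])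
  have dd: "ddir e f differentiable (at z)" for e z by (rule wcauchy_diff[OF w1])
  have ct: "continuous_on UNIV (ddir e (ddir e' f))" for e e'
    using wcauchy_imp_cauchy_wrt[OF wcauchy_ddir[OF w1]] unfolding cauchy_wrt_def by blast
  define Y where "Y z = ddir (1, 0) G (scri_map z) / 2" for z
  \<comment> \<open>Half the radial derivative of the derivative of \<open>G\<close> in its first
    slot. Projecting the good derivatives onto the radial direction multiplies it by
    \<open>1 - (1 - ibracket ^ 2)\<close>, so it enters only at fourth order.\<close>
  define R where "R z = (\<Sum>b\<in>Basis. om b z * ddir (0, b) (ddir (1, 0) G) (scri_map z)) / 2" for z
  have dGt: "ddir (1, 0) G differentiable (at w)" for w by (rule wcauchy_diff[OF wcauchy_ddir[OF G]])
  have Gt: "wbdd k (strip c) (ddir (1, 0) G)" for k by (rule wcauchy_ddir[OF G])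
  have symY: "scri_symbol c 0 Y"
    using scri_symbol.cmult[OF scri_symbol.compose[OF Gt], of "1/2"] unfolding Y_def by simp
  have dY: "Y differentiable (at z)" for z by (rule scri_symbol_differentiable[OF symY])
  have symR: "scri_symbol c 0 R"
  proof -
    have "scri_symbol c 0 (\<lambda>z. (1/2) * (\<Sum>b\<in>Basis. om b z * ddir (0, b) (ddir (1, 0) G) (scri_map z)))"
      by (intro scri_symbol.cmult scri_symbol_sum scri_symbol.om scri_symbol.compose wcauchy_ddir[OF Gt])
    then show ?thesis unfolding R_def by simp
  qed
  have ft: "ddir (1, 0) f = (\<lambda>z. ibracket z * Y z)"
  proof
    fix z
    have dGc: "(\<lambda>z. G (scri_map z)) differentiable (at z)" using differentiable_compose[OF dG scri_map_differentiable] .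
    show "ddir (1, 0) f z = ibracket z * Y z"
      unfolding f_def ddir_mult_at[OF ibracket_differentiable dGc] ddir_compose_scri_map[OF dG] Y_def
      by (simp add: ddir_ibracket ddir_om)
  qed
  have ftt: "ddir (1, 0) (ddir (1, 0) f) z = ibracket z * (ddir (1, 0) (ddir (1, 0) G) (scri_map z) / 4)" for z
  proof -
    have dGc: "(\<lambda>z. ddir (1, 0) G (scri_map z)) differentiable (at z)" using differentiable_compose[OF dGt scri_map_differentiable] .
    have "ddir (1, 0) Y z = ddir (1, 0) (ddir (1, 0) G) (scri_map z) / 4"
    proof -
      have "Y = (\<lambda>z. (1/2) * ddir (1, 0) G (scri_map z))" unfolding Y_def by simp
      moreover have "(\<lambda>z. ddir (1, 0) G (scri_map z)) differentiable (at z)" for z using differentiable_compose[OF dGt scri_map_differentiable] .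
      ultimately have "ddir (1, 0) Y z = (1/2) * ddir (1, 0) (\<lambda>z. ddir (1, 0) G (scri_map z)) z" using ddir_cmult by metis
      then show ?thesis unfolding ddir_compose_scri_map[OF dGt] by (simp add: ddir_om)
    qed
    then show ?thesis unfolding ft ddir_mult_at[OF ibracket_differentiable dY] by (simp add: ddir_ibracket)
  qed
  have goodY: "good i Y z = ibracket z * ((\<Sum>b\<in>Basis. (i \<bullet> b) * (ddir (0, b) (ddir (1, 0) G) (scri_map z) / 2)) - om i z * R z)" for i z
  proof -
    have dGc: "(\<lambda>z. ddir (1, 0) G (scri_map z)) differentiable (at z)" for z using differentiable_compose[OF dGt scri_map_differentiable] .
    have Y2: "Y = (\<lambda>z. (1/2) * ddir (1, 0) G (scri_map z))" unfolding Y_def by simp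
    have "good i Y z = (1/2) * good i (\<lambda>z. ddir (1, 0) G (scri_map z)) z"
      unfolding good_def Y2 ddir_cmult[OF dGc] by (simp only: ring_distribs mult_ac)
    moreover have "(\<Sum>b\<in>Basis. (i \<bullet> b) * (ddir (0, b) (ddir (1, 0) G) (scri_map z) / 2))
       = (\<Sum>b\<in>Basis. (i \<bullet> b) * ddir (0, b) (ddir (1, 0) G) (scri_map z)) / 2" by (simp add: sum_divide_distrib)
    ultimately show ?thesis unfolding good_compose[OF dGt] R_def by (simp add: right_diff_distrib)
  qed
  have sumgood: "(\<Sum>i\<in>Basis. om i z * good i (ddir (1, 0) f) z) = ibracket z ^ 4 * R z - (ibracket z)\<^sup>2 * (1 - (ibracket z)\<^sup>2) * Y z" for z
  proof -
    have "om i z * good i (ddir (1, 0) f) z = (ibracket z)\<^sup>2 * (om i z * (ddir (0, i) (ddir (1, 0) G) (scri_map z) / 2)) - (om i z)\<^sup>2 * ((ibracket z)\<^sup>2 * (R z + Y z))"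
      if i: "i \<in> Basis" for i
    proof -
      have "(\<Sum>b\<in>Basis. (i \<bullet> b) * (ddir (0, b) (ddir (1, 0) G) (scri_map z) / 2)) = ddir (0, i) (ddir (1, 0) G) (scri_map z) / 2"
        by (rule sum_inner_Basis_mult[OF i])
      then show ?thesis unfolding ft good_mult[OF ibracket_differentiable dY] goodY good_ibracket by (simp add: power2_eq_square algebra_simps)
    qed
    then have "(\<Sum>i\<in>Basis. om i z * good i (ddir (1, 0) f) z) = (ibracket z)\<^sup>2 * R z - (\<Sum>i\<in>Basis. (om i z)\<^sup>2) * ((ibracket z)\<^sup>2 * (R z + Y z))"
      unfolding R_def by (simp add: sum_subtractf sum_distrib_left sum_distrib_right sum_divide_distrib)
    then show ?thesis unfolding sum_om_square by (simp add: power2_eq_square power4_eq_xxxx algebra_simps)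
  qed
  \<comment> \<open>The last group is of fourth order. One factor \<open>ibracket\<close> is kept
    outside and later bounded by 1, so that third-order symbols suffice throughout.\<close>
  have eq: "wave_op f = (\<lambda>z. ((-1) * (ibracket z * (ibracket z * (ibracket z * ((1/4) * ddir (1, 0) (ddir (1, 0) G) (scri_map z))))) + (\<Sum>i\<in>Basis. good i (good i f) z))
      + ibracket z * ((-3) * (ibracket z * (ibracket z * (ibracket z * Y z))) + (-2) * (ibracket z * (ibracket z * (ibracket z * R z)))))"
    by (rule ext, subst wave_op_good[OF d dd ddir_mixed[OF d dd ct]], unfold ftt sumgood, simp only: ft)
      (simp add: power2_eq_square power4_eq_xxxx algebra_simps)
  have s3: "scri_symbol c 3 (\<lambda>z. (-1) * (ibracket z * (ibracket z * (ibracket z * ((1/4) * ddir (1, 0) (ddir (1, 0) G) (scri_map z))))) + (\<Sum>i\<in>Basis. good i (good i f) z))"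
    unfolding numeral_3_eq_3
    by (intro scri_symbol.add scri_symbol.cmult scri_symbol.ibracket scri_symbol.compose wcauchy_ddir[OF Gt] scri_symbol_sum scri_symbol_good symf)
  have s4: "scri_symbol c 3 (\<lambda>z. (-3) * (ibracket z * (ibracket z * (ibracket z * Y z))) + (-2) * (ibracket z * (ibracket z * (ibracket z * R z))))"
    unfolding numeral_3_eq_3
    by (intro scri_symbol.add scri_symbol.cmult scri_symbol.ibracket symY symR)
  have nn: "0 \<le> strip c (scri_map z) * decay z ^ 3" for z by (simp add: strip_nonneg decay_nonneg)
  have i1: "wbdd k (\<lambda>_. 1) ibracket" by (rule wcauchy_mono[OF wbdd_ibracket decay_nonneg, of 1]) (simp_all add: decay_le_1)
  have "wbdd k (\<lambda>z. 1 * (strip c (scri_map z) * decay z ^ 3)) (\<lambda>z. ibracket z * ((-3) * (ibracket z * (ibracket z * (ibracket z * Y z))) + (-2) * (ibracket z * (ibracket z * (ibracket z * R z)))))"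
    by (rule wcauchy_mult[OF i1 scri_symbol_wbdd[OF s4]]) (use nn in auto)
  then show ?thesis unfolding f_def[symmetric] eq by (intro wcauchy_add scri_symbol_wbdd[OF s3]) simp
qed

section \<open>Smooth cutoffs and extension\<close>

lemma diff_on_imp_continuous_on: "diff_on k f U \<Longrightarrow> continuous_on U f"
proof (cases k)
  case (Suc j)
  assume "diff_on k f U"
  then show ?thesis unfolding Suc
    by (auto intro!: continuous_at_imp_continuous_on differentiable_imp_continuous_within)
qed simp

lemma diff_on_SucD: "diff_on (Suc k) f U \<Longrightarrow> diff_on k f U"
proof (induction k arbitrary: f)
  case 0 then show ?case using diff_on_imp_continuous_on[of "Suc 0" f U] by simp
next
  case (Suc k) then show ?case by (metis diff_on.simps(2))
qed

lemma diff_on_subset: "diff_on k f U \<Longrightarrow> V \<subseteq> U \<Longrightarrow> diff_on k f V"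
  by (induction k arbitrary: f) (auto intro: continuous_on_subset)

lemma diff_on_cong:
  assumes "open U" "\<And>z. z \<in> U \<Longrightarrow> f z = g z" "diff_on k f U"
  shows "diff_on k g U"
  using assms(2,3)
proof (induction k arbitrary: f g)
  case 0 then show ?case using continuous_on_cong by (metis diff_on.simps(1))
next
  case (Suc k)
  have "g differentiable (at z)" if z: "z \<in> U" for z
  proof -
    obtain f' where "(f has_derivative f') (at z)" using Suc.prems(2) z unfolding diff_on.simps differentiable_def by blast
    then have "(g has_derivative f') (at z)"
      by (rule has_derivative_transform_within_open[OF _ assms(1) z Suc.prems(1)])
    then show ?thesis unfolding differentiable_def by blast
  qed
  moreover have "diff_on k (ddir e g) U" for e
  proof (rule Suc.IH[of "ddir e f"])
    show "ddir e f z = ddir e g z" if "z \<in> U" for z by (rule ddir_cong_open[OF assms(1) that Suc.prems(1)])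
  qed (use Suc.prems in simp)
  ultimately show ?case by simp
qed

lemma diff_on_local:
  assumes "\<And>z. z \<in> U \<Longrightarrow> \<exists>V. open V \<and> z \<in> V \<and> diff_on k f V"
  shows "diff_on k f U"
  using assms
proof (induction k arbitrary: f)
  case 0
  show ?case unfolding diff_on.simps
  proof (rule continuous_at_imp_continuous_on, rule ballI)
    fix z assume "z \<in> U"
    then obtain V where "open V" "z \<in> V" "continuous_on V f" using 0 by (metis diff_on.simps(1))
    then show "isCont f z" using continuous_on_eq_continuous_at by blast
  qed
next
  case (Suc k)
  have "diff_on k (ddir e f) U" for e
    by (rule Suc.IH) (use Suc.prems in \<open>fastforce\<close>)
  moreover have "f differentiable (at z)" if "z \<in> U" for z using Suc.prems[OF that] by auto
  ultimately show ?case by simp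
qed

lemma diff_on_const: "diff_on k (\<lambda>_. c) U"
  by (induction k arbitrary: c) auto

lemma diff_on_add:
  assumes "open U" "diff_on k f U" "diff_on k g U"
  shows "diff_on k (\<lambda>z. f z + g z) U"
  using assms(2,3)
proof (induction k arbitrary: f g)
  case 0 then show ?case by (simp add: continuous_on_add)
next
  case (Suc k)
  have "diff_on k (ddir e (\<lambda>z. f z + g z)) U" for e
  proof (rule diff_on_cong[OF assms(1)])
    show "diff_on k (\<lambda>z. ddir e f z + ddir e g z) U" using Suc by auto
    show "ddir e f z + ddir e g z = ddir e (\<lambda>z. f z + g z) z" if "z \<in> U" for z
      using Suc.prems that by (subst ddir_add_at) auto
  qed
  then show ?case using Suc.prems by auto
qed

lemma diff_on_mult:
  assumes "open U" "diff_on k f U" "diff_on k g U"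
  shows "diff_on k (\<lambda>z. f z * g z) U"
  using assms(2,3)
proof (induction k arbitrary: f g)
  case 0 then show ?case by (simp add: continuous_on_mult)
next
  case (Suc k)
  have fk: "diff_on k f U" "diff_on k g U" using Suc.prems diff_on_SucD by blast+
  have "diff_on k (ddir e (\<lambda>z. f z * g z)) U" for e
  proof (rule diff_on_cong[OF assms(1)])
    show "diff_on k (\<lambda>z. f z * ddir e g z + ddir e f z * g z) U"
      using Suc fk by (auto intro!: diff_on_add[OF assms(1)])
    show "f z * ddir e g z + ddir e f z * g z = ddir e (\<lambda>z. f z * g z) z" if "z \<in> U" for z
      using Suc.prems that by (subst ddir_mult_at) auto
  qed
  then show ?case using Suc.prems by auto
qed

lemma diff_on_cmult: "open U \<Longrightarrow> diff_on k f U \<Longrightarrow> diff_on k (\<lambda>z. c * f z) U"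
  by (rule diff_on_mult[OF _ diff_on_const])

lemma diff_on_sum:
  assumes "open U" "\<And>i. i \<in> I \<Longrightarrow> diff_on k (f i) U"
  shows "diff_on k (\<lambda>z. \<Sum>i\<in>I. f i z) U"
  using assms(2)
proof (induction I rule: infinite_finite_induct)
  case (insert x F) then show ?case by (auto intro!: diff_on_add[OF assms(1)])
qed (auto intro: diff_on_const)

lemma diff_on_inverse:
  assumes "open U" "diff_on k f U" "\<And>z. z \<in> U \<Longrightarrow> f z \<noteq> 0"
  shows "diff_on k (\<lambda>z. inverse (f z)) U"
  using assms(2)
proof (induction k)
  case 0 then show ?case using assms(3) by (auto intro!: continuous_intros)
next
  case (Suc k)
  have fk: "diff_on k f U" using Suc.prems diff_on_SucD by blast
  have hd: "((\<lambda>z. inverse (f z)) has_derivative (\<lambda>h. - (inverse (f z) * ddir h f z * inverse (f z)))) (at z)" if "z \<in> U" for z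
    using Suc.prems that assms(3) by (intro Deriv.has_derivative_inverse has_derivative_ddir) auto
  have "diff_on k (ddir e (\<lambda>z. inverse (f z))) U" for e
  proof (rule diff_on_cong[OF assms(1)])
    show "diff_on k (\<lambda>z. (-1) * ((inverse (f z) * ddir e f z) * inverse (f z))) U"
      using Suc fk by (intro diff_on_mult[OF assms(1)] diff_on_const) auto
    show "(-1) * ((inverse (f z) * ddir e f z) * inverse (f z)) = ddir e (\<lambda>z. inverse (f z)) z" if "z \<in> U" for z
      using ddir_eq[OF hd[OF that]] by simp
  qed
  then show ?case using hd unfolding diff_on.simps differentiable_def by blast
qed

lemma diff_on_real_compose:
  fixes h :: "real \<Rightarrow> real"
  assumes "open U" "diff_on k g U" "diff_on k h UNIV"
  shows "diff_on k (\<lambda>z. h (g z)) U"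
  using assms(2,3)
proof (induction k arbitrary: h)
  case 0 then show ?case by (auto intro: continuous_on_compose2)
next
  case (Suc k)
  have gk: "diff_on k g U" using Suc.prems diff_on_SucD by blast
  have hd: "((\<lambda>z. h (g z)) has_derivative (\<lambda>e. ddir (ddir e g z) h (g z))) (at z)" if "z \<in> U" for z
    using Suc.prems that by (intro has_derivative_compose[of g _ z UNIV h, simplified] has_derivative_ddir) auto
  have lin: "ddir s h x = ddir 1 h x * s" for s x
  proof -
    have "h differentiable (at x)" using Suc.prems by simp
    then interpret bounded_linear "\<lambda>s. ddir s h x"
      using has_derivative_ddir has_derivative_bounded_linear by blast
    show ?thesis using scaleR[of s 1] by simp
  qed
  have "diff_on k (ddir e (\<lambda>z. h (g z))) U" for e
  proof (rule diff_on_cong[OF assms(1)])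
    show "diff_on k (\<lambda>z. ddir 1 h (g z) * ddir e g z) U"
      using Suc gk by (intro diff_on_mult[OF assms(1)]) auto
    show "ddir 1 h (g z) * ddir e g z = ddir e (\<lambda>z. h (g z)) z" if "z \<in> U" for z
      using ddir_eq[OF hd[OF that]] lin[of "ddir e g z" "g z"] by simp
  qed
  then show ?case using hd unfolding diff_on.simps differentiable_def by blast
qed

lemma diff_on_linear:
  assumes "bounded_linear f"
  shows "diff_on k (\<lambda>z. f z + c) U"
proof (cases k)
  case 0 then show ?thesis using continuous_on_add[OF linear_continuous_on[OF assms] continuous_on_const] by simp
next
  case (Suc j)
  have hd: "((\<lambda>z. f z + c) has_derivative f) (at z)" for z
    using bounded_linear.has_derivative[OF assms has_derivative_ident] by (auto intro!: derivative_eq_intros)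
  have "ddir e (\<lambda>z. f z + c) = (\<lambda>_. f e)" for e by (rule ext, rule ddir_eq[OF hd])
  moreover have "(\<lambda>z. f z + c) differentiable (at z)" for z using hd differentiable_def by blast
  ultimately show ?thesis unfolding Suc by (simp add: diff_on_const)
qed

lemma diff_on_dist_square:
  fixes p :: "'a::euclidean_space"
  assumes "open U"
  shows "diff_on k (\<lambda>z. (dist z p)\<^sup>2) U"
proof -
  have "diff_on k (\<lambda>z. \<Sum>b\<in>Basis. (z \<bullet> b + (- (p \<bullet> b))) * (z \<bullet> b + (- (p \<bullet> b)))) U"
    by (intro diff_on_sum diff_on_mult assms diff_on_linear bounded_linear_inner_left)
  moreover have "(\<lambda>z. (dist z p)\<^sup>2) = (\<lambda>z. \<Sum>b\<in>Basis. (z \<bullet> b + (- (p \<bullet> b))) * (z \<bullet> b + (- (p \<bullet> b))))"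
    unfolding dist_norm power2_norm_eq_inner by (subst euclidean_inner) (simp add: inner_diff_left)
  ultimately show ?thesis by simp
qed

text \<open>The power in front of the exponential makes the family closed under differentiation, up
  to linear combinations, so one induction proves all members smooth.\<close>

definition flat_exp :: "nat \<Rightarrow> real \<Rightarrow> real" where
  "flat_exp n x = (if x > 0 then (1 / x) ^ n * exp (- (1 / x)) else 0)"

lemma flat_exp_has_derivative:
  "(flat_exp n has_real_derivative - real n * flat_exp (Suc n) x + flat_exp (Suc (Suc n)) x) (at x)"
proof -
  consider "x > 0" | "x < 0" | "x = 0" by linarith
  then show ?thesis
  proof cases
    case 1
    define i where "i = 1 / x"
    have di: "((\<lambda>x. 1 / x) has_real_derivative - (i ^ 2)) (at x)"
      using 1 unfolding i_def by (auto intro!: derivative_eq_intros simp: power2_eq_square)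
    have "((\<lambda>x. (1 / x) ^ n * exp (- (1 / x))) has_real_derivative
        (real n * ((- (i ^ 2)) * i ^ (n - 1))) * exp (- i) + (exp (- i) * - (- (i ^ 2))) * i ^ n) (at x)"
      using DERIV_mult[OF DERIV_power[OF di, of n] DERIV_fun_exp[OF DERIV_minus[OF di]]] unfolding i_def by (simp add: mult_ac)
    moreover have "(real n * ((- (i ^ 2)) * i ^ (n - 1))) * exp (- i) + (exp (- i) * - (- (i ^ 2))) * i ^ n
        = - real n * flat_exp (Suc n) x + flat_exp (Suc (Suc n)) x"
      using 1 unfolding flat_exp_def i_def[symmetric] by (cases n) (simp_all add: power2_eq_square algebra_simps)
    ultimately have "((\<lambda>x. (1 / x) ^ n * exp (- (1 / x))) has_real_derivative - real n * flat_exp (Suc n) x + flat_exp (Suc (Suc n)) x) (at x)"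
      by simp
    then show ?thesis
      by (rule has_field_derivative_transform_within_open[where S = "{0<..}"]) (use 1 in \<open>auto simp: flat_exp_def\<close>)
  next
    case 2
    have "((\<lambda>_. 0) has_real_derivative 0) (at x)" by simp
    then have "(flat_exp n has_real_derivative 0) (at x)"
      by (rule has_field_derivative_transform_within_open[where S = "{..<0}"]) (use 2 in \<open>auto simp: flat_exp_def\<close>)
    then show ?thesis using 2 by (simp add: flat_exp_def)
  next
    case 3
    \<comment> \<open>The difference quotient at the origin has the same form with one more power;
      in the variable \<open>inverse y\<close> the exponential beats every power.\<close>
    have "((\<lambda>y. flat_exp n y / y) \<longlongrightarrow> 0) (at_right 0)"
    proof (rule Lim_transform_eventually)
      have "((\<lambda>y. (inverse y) ^ Suc n / exp (inverse y)) \<longlongrightarrow> 0) (at_right (0::real))"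
        by (rule filterlim_compose[OF tendsto_power_div_exp_0 filterlim_inverse_at_top_right])
      then show "((\<lambda>y. (inverse y) ^ Suc n / exp (inverse y)) \<longlongrightarrow> 0) (at_right (0::real))" .
      show "\<forall>\<^sub>F y in at_right 0. (inverse y) ^ Suc n / exp (inverse y) = flat_exp n y / y"
        using eventually_at_right_less[of 0]
        by eventually_elim (simp add: flat_exp_def exp_minus inverse_eq_divide field_simps)
    qed
    moreover have "((\<lambda>y. flat_exp n y / y) \<longlongrightarrow> 0) (at_left 0)"
    proof (rule Lim_transform_eventually)
      show "\<forall>\<^sub>F y in at_left 0. 0 = flat_exp n y / y"
        unfolding eventually_at_left_field by (auto simp: flat_exp_def intro!: exI[of _ "-1"])
    qed simp
    ultimately have "((\<lambda>y. flat_exp n y / y) \<longlongrightarrow> 0) (at 0)" by (simp add: filterlim_split_at)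
    then have "(flat_exp n has_real_derivative 0) (at 0)"
      unfolding has_field_derivative_iff by (simp add: flat_exp_def[of n 0])
    then show ?thesis using 3 by (simp add: flat_exp_def)
  qed
qed

lemma diff_on_flat_exp: "diff_on k (flat_exp n) U"
proof -
  have "diff_on k (flat_exp n) UNIV"
  proof (induction k arbitrary: n)
    case 0
    show ?case unfolding diff_on.simps
      by (rule continuous_at_imp_continuous_on) (use flat_exp_has_derivative DERIV_isCont in blast)
  next
    case (Suc k)
    have hd: "(flat_exp n has_derivative (\<lambda>h. (- real n * flat_exp (Suc n) x + flat_exp (Suc (Suc n)) x) * h)) (at x)" for x
      using flat_exp_has_derivative[of n x] unfolding has_field_derivative_def .
    have "ddir e (flat_exp n) = (\<lambda>x. e * ((- real n) * flat_exp (Suc n) x + flat_exp (Suc (Suc n)) x))" for e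
      by (rule ext, subst ddir_eq[OF hd]) simp
    moreover have "diff_on k (\<lambda>x. e * ((- real n) * flat_exp (Suc n) x + flat_exp (Suc (Suc n)) x)) UNIV" for e
      by (intro diff_on_cmult diff_on_add Suc open_UNIV)
    moreover have "flat_exp n differentiable (at x)" for x using hd differentiable_def by blast
    ultimately show ?case by simp
  qed
  then show ?thesis using diff_on_subset by blast
qed

lemma flat_exp_pos: "x > 0 \<Longrightarrow> flat_exp 0 x > 0" and flat_exp_nonpos: "x \<le> 0 \<Longrightarrow> flat_exp n x = 0"
  and flat_exp_nonneg: "flat_exp 0 x \<ge> 0"
  unfolding flat_exp_def by auto

text \<open>The complement of \<open>K\<close> is open, so the derivatives vanish there too, and
  continuity bounds them on \<open>K\<close>.\<close>

lemma wbdd_of_compact_support: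
  fixes f :: "'a::euclidean_space \<Rightarrow> real"
  assumes f: "diff_on k f UNIV" and K: "compact K" and supp: "\<And>z. z \<notin> K \<Longrightarrow> f z = 0"
  shows "wbdd k (\<lambda>z. if z \<in> K then 1 else 0) f"
proof -
  have base: "cauchy_wrt (\<lambda>z. if z \<in> K then 1 else 0) (\<lambda>_. f)"
    if "continuous_on UNIV f" "\<And>z. z \<notin> K \<Longrightarrow> f z = 0" for f
  proof -
    have "compact (f ` K)" by (rule compact_continuous_image[OF continuous_on_subset[OF that(1)] K]) simp
    then have "bounded (f ` K)" by (rule compact_imp_bounded)
    then obtain B where B: "\<And>z. z \<in> K \<Longrightarrow> \<bar>f z\<bar> \<le> B" unfolding bounded_iff by auto
    show ?thesis by (rule cauchy_wrt_const[of _ B]) (use that B in auto)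
  qed
  show ?thesis using f supp
  proof (induction k arbitrary: f)
    case 0 then show ?case using base by auto
  next
    case (Suc k)
    have "open (- K)" using K compact_imp_closed by auto
    then have "ddir e f z = 0" if "z \<notin> K" for e z
      using ddir_cong_open[of "- K" z f "\<lambda>_. 0" e] that Suc.prems(2) by simp
    then have "wbdd k (\<lambda>z. if z \<in> K then 1 else 0) (ddir e f)" for e using Suc by auto
    moreover have "cauchy_wrt (\<lambda>z. if z \<in> K then 1 else 0) (\<lambda>_. f)"
      by (rule base[OF diff_on_imp_continuous_on[OF Suc.prems(1)] Suc.prems(2)])
    ultimately show ?case using Suc.prems(1) by simp
  qed
qed

lemma diff_on_of_wbdd: "wbdd k w f \<Longrightarrow> diff_on k f UNIV"
proof (induction k arbitrary: f)
  case 0 then show ?case unfolding wcauchy.simps cauchy_wrt_def by auto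
next
  case (Suc k) then show ?case using wcauchy_diff[OF Suc.prems] wcauchy_ddir[OF Suc.prems] by simp
qed

section \<open>Smooth steps and products with bump functions\<close>

definition smooth_step :: "real \<Rightarrow> real" where
  "smooth_step x = flat_exp 0 x * inverse (flat_exp 0 x + flat_exp 0 (1 - x))"

lemma smooth_step_denom: "flat_exp 0 x + flat_exp 0 (1 - x) > 0"
  using flat_exp_pos[of x] flat_exp_pos[of "1 - x"] flat_exp_nonneg[of x] flat_exp_nonneg[of "1 - x"]
  by (cases "x > 0") (auto intro: add_pos_nonneg add_nonneg_pos)

lemma smooth_step_values: "x \<le> 0 \<Longrightarrow> smooth_step x = 0" "x \<ge> 1 \<Longrightarrow> smooth_step x = 1" "0 \<le> smooth_step x" "smooth_step x \<le> 1"
proof -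
  show "smooth_step x = 0" if "x \<le> 0" using flat_exp_nonpos[OF that] unfolding smooth_step_def by simp
  show "smooth_step x = 1" if "x \<ge> 1"
    using flat_exp_nonpos[of "1 - x" 0] flat_exp_pos[of x] that unfolding smooth_step_def by simp
  show "0 \<le> smooth_step x" unfolding smooth_step_def using flat_exp_nonneg smooth_step_denom[of x] by simp
  show "smooth_step x \<le> 1" unfolding smooth_step_def using flat_exp_nonneg[of "1 - x"] smooth_step_denom[of x]
    by (simp add: divide_inverse[symmetric])
qed

lemma diff_on_smooth_step: "diff_on k smooth_step UNIV"
proof -
  have 1: "diff_on k (\<lambda>x. flat_exp 0 (- x + 1)) UNIV"
    by (rule diff_on_real_compose[OF open_UNIV diff_on_linear[OF bounded_linear_minus[OF bounded_linear_ident]] diff_on_flat_exp])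
  have "diff_on k (\<lambda>x. flat_exp 0 x * inverse (flat_exp 0 x + flat_exp 0 (- x + 1))) UNIV"
    by (intro diff_on_mult diff_on_inverse diff_on_add open_UNIV diff_on_flat_exp 1)
      (use smooth_step_denom in \<open>auto simp: less_imp_neq[symmetric] add.commute\<close>)
  moreover have "smooth_step = (\<lambda>x. flat_exp 0 x * inverse (flat_exp 0 x + flat_exp 0 (- x + 1)))"
    unfolding smooth_step_def by (simp add: add.commute)
  ultimately show ?thesis by simp
qed

text \<open>The step itself is not compactly supported, but all its derivatives vanish outside
  \<open>{0..1}\<close>, where compactness bounds them.\<close>

lemma wbdd_smooth_step: "wbdd k (\<lambda>x. if 0 \<le> x then 1 else 0) smooth_step"
proof -
  have base: "cauchy_wrt (\<lambda>x. if 0 \<le> x then 1 else 0) (\<lambda>_. smooth_step)"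
    by (rule cauchy_wrt_const[of _ 1]) (use diff_on_imp_continuous_on[OF diff_on_smooth_step[of 0]] smooth_step_values in auto)
  show ?thesis
  proof (cases k)
    case 0 then show ?thesis using base by simp
  next
    case (Suc j)
    have s: "diff_on (Suc j) smooth_step UNIV" by (rule diff_on_smooth_step)
    have "wbdd j (\<lambda>x. if x \<in> {0..1} then 1 else 0) (ddir e smooth_step)" for e
    proof (rule wbdd_of_compact_support)
      show "diff_on j (ddir e smooth_step) UNIV" using s by simp
      show "ddir e smooth_step x = 0" if "x \<notin> {0..1}" for x
      proof (cases "x < 0")
        case True
        then show ?thesis using ddir_cong_open[of "{..<0}" x smooth_step "\<lambda>_. 0" e] smooth_step_values(1) by simp
      next
        case False
        then show ?thesis using ddir_cong_open[of "{1<..}" x smooth_step "\<lambda>_. 1" e] smooth_step_values(2) that by simp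
      qed
    qed simp
    then have "wbdd j (\<lambda>x. if 0 \<le> x then 1 else 0) (ddir e smooth_step)" for e
      by (rule wcauchy_mono[where A = 1]) auto
    then show ?thesis unfolding Suc wcauchy.simps using base s by simp
  qed
qed

text \<open>Nothing is known about \<open>F\<close> outside \<open>U\<close>, but the bump vanishes
  outside \<open>cball p e\<close>. The set \<open>U\<close> and the complement of this ball cover
  the space, and the product is smooth on each of them.\<close>

lemma smooth_bump_product:
  fixes F :: "'a::euclidean_space \<Rightarrow> real"
  assumes F: "smooth_on_open F U" and e: "e > 0" "cball p (2 * e) \<subseteq> U"
  shows "diff_on k (\<lambda>z. flat_exp 0 (e\<^sup>2 - (dist z p)\<^sup>2) * F z) UNIV"
proof (rule diff_on_local)
  have bump: "diff_on k (\<lambda>z. flat_exp 0 ((-1) * (dist z p)\<^sup>2 + e\<^sup>2)) V" if "open V" for V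
    by (rule diff_on_real_compose[OF that _ diff_on_flat_exp]) (intro diff_on_add diff_on_cmult diff_on_dist_square diff_on_const that)
  fix z :: 'a
  show "\<exists>V. open V \<and> z \<in> V \<and> diff_on k (\<lambda>z. flat_exp 0 (e\<^sup>2 - (dist z p)\<^sup>2) * F z) V"
  proof (cases "z \<in> U")
    case True
    have U: "open U" "diff_on k F U" using F unfolding smooth_on_open_def by auto
    have "diff_on k (\<lambda>z. flat_exp 0 ((-1) * (dist z p)\<^sup>2 + e\<^sup>2) * F z) U"
      by (intro diff_on_mult U bump)
    then show ?thesis using True U by (intro exI[of _ U]) simp
  next
    case False
    then have "z \<notin> cball p (2 * e)" using e by blast
    then have z: "z \<in> - cball p e" using e by auto
    have "diff_on k (\<lambda>z. flat_exp 0 (e\<^sup>2 - (dist z p)\<^sup>2) * F z) (- cball p e)"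
    proof (rule diff_on_cong[OF _ _ diff_on_const[of k 0]])
      fix y assume "y \<in> - cball p e"
      then have "e\<^sup>2 \<le> (dist y p)\<^sup>2" using e by (intro power_mono) (auto simp: dist_commute)
      then show "0 = flat_exp 0 (e\<^sup>2 - (dist y p)\<^sup>2) * F y" by (simp add: flat_exp_nonpos)
    qed auto
    then show ?thesis using z by (intro exI[of _ "- cball p e"]) auto
  qed
qed

text \<open>The extension is a quotient of bump function sums \<open>N / (S + flat_exp 0 (m - S))\<close>, where \<open>m\<close> is the
  minimum of \<open>S\<close> on \<open>A\<close>: the correction of the denominator vanishes on \<open>A\<close> and makes it positive
  everywhere.\<close>

lemma smooth_on_compact_extension:
  fixes f :: "'a::euclidean_space \<Rightarrow> real"
  assumes A: "compact A" "A \<noteq> {}" and f: "smooth_on f A"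
  obtains G R where "\<And>k. diff_on k G UNIV" "\<And>z. z \<in> A \<Longrightarrow> G z = f z" "\<And>z. z \<notin> cball 0 R \<Longrightarrow> G z = 0"
proof -
  have "\<forall>p\<in>A. \<exists>U F. p \<in> U \<and> smooth_on_open F U \<and> (\<forall>q\<in>U \<inter> A. F q = f q)" using f unfolding smooth_on_def .
  then obtain U F where UF: "\<And>p. p \<in> A \<Longrightarrow> p \<in> U p \<and> smooth_on_open (F p) (U p) \<and> (\<forall>q\<in>U p \<inter> A. F p q = f q)" by metis
  have "\<exists>e>0. cball p (2 * e) \<subseteq> U p" if "p \<in> A" for p
  proof -
    have "open (U p)" "p \<in> U p" using UF[OF that] unfolding smooth_on_open_def by auto
    then obtain d where "d > 0" "cball p d \<subseteq> U p" using open_contains_cball by blast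
    then show ?thesis by (intro exI[of _ "d / 2"]) auto
  qed
  then obtain e where e: "\<And>p. p \<in> A \<Longrightarrow> e p > 0" "\<And>p. p \<in> A \<Longrightarrow> cball p (2 * e p) \<subseteq> U p" by metis
  have cover: "A \<subseteq> (\<Union>p\<in>A. ball p (e p))"
  proof
    fix z assume "z \<in> A"
    then show "z \<in> (\<Union>p\<in>A. ball p (e p))" using e(1) by (intro UN_I[of z]) auto
  qed
  obtain I where I: "I \<subseteq> A" "finite I" "A \<subseteq> (\<Union>p\<in>I. ball p (e p))"
    by (rule compactE_image[OF A(1), of A "\<lambda>p. ball p (e p)"]) (use cover in auto)
  define \<beta> where "\<beta> p z = flat_exp 0 ((e p)\<^sup>2 - (dist z p)\<^sup>2)" for p z
  define S where "S z = (\<Sum>p\<in>I. \<beta> p z)" for z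
  define N where "N z = (\<Sum>p\<in>I. \<beta> p z * F p z)" for z
  have \<beta>0: "\<beta> p z \<ge> 0" for p z unfolding \<beta>_def by (rule flat_exp_nonneg)
  have dN: "diff_on k N UNIV" for k unfolding N_def \<beta>_def
  proof (rule diff_on_sum[OF open_UNIV])
    fix p assume "p \<in> I"
    then have p: "p \<in> A" using I(1) by blast
    show "diff_on k (\<lambda>z. flat_exp 0 ((e p)\<^sup>2 - (dist z p)\<^sup>2) * F p z) UNIV"
      by (rule smooth_bump_product[of _ "U p"]) (use UF[OF p] e[OF p] in auto)
  qed
  have dS: "diff_on k S UNIV" for k
  proof -
    have "diff_on k (\<lambda>z. flat_exp 0 ((e p)\<^sup>2 - (dist z p)\<^sup>2) * 1) UNIV" if "p \<in> I" for p
      by (rule smooth_bump_product[of _ UNIV]) (use that e I in \<open>auto simp: smooth_on_open_def diff_on_const\<close>)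
    then show ?thesis unfolding S_def \<beta>_def by (intro diff_on_sum) auto
  qed
  have Spos: "S z > 0" if z: "z \<in> A" for z
  proof -
    obtain p where p: "p \<in> I" "dist z p < e p" using I(3) z by (auto simp: dist_commute)
    have "(dist z p)\<^sup>2 < (e p)\<^sup>2" using p by (intro power_strict_mono) auto
    then have "\<beta> p z > 0" unfolding \<beta>_def by (intro flat_exp_pos) simp
    then show ?thesis unfolding S_def using p(1) I(2) \<beta>0 by (intro sum_pos2[of I p]) auto
  qed
  obtain z0 where z0: "z0 \<in> A" "\<And>z. z \<in> A \<Longrightarrow> S z0 \<le> S z"
    using continuous_attains_inf[OF A continuous_on_subset[OF diff_on_imp_continuous_on[OF dS[of 0]]]] by blast
  define m where "m = S z0"
  have m: "m > 0" unfolding m_def by (rule Spos[OF z0(1)])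
  have S0: "S z \<ge> 0" for z unfolding S_def using \<beta>0 by (intro sum_nonneg) auto
  define Q where "Q z = S z + flat_exp 0 ((-1) * S z + m)" for z
  have Qpos: "Q z > 0" for z
  proof (cases "S z < m")
    case True then show ?thesis unfolding Q_def using S0[of z] flat_exp_pos[of "(-1) * S z + m"] by simp
  next
    case False then show ?thesis unfolding Q_def using m flat_exp_nonneg[of "(-1) * S z + m"] by linarith
  qed
  have dQ: "diff_on k Q UNIV" for k unfolding Q_def
    by (intro diff_on_add open_UNIV dS diff_on_real_compose[OF open_UNIV _ diff_on_flat_exp] diff_on_cmult diff_on_const)
  define G where "G z = N z * inverse (Q z)" for z
  have dG: "diff_on k G UNIV" for k unfolding G_def
    by (intro diff_on_mult diff_on_inverse open_UNIV dN dQ) (use Qpos less_imp_neq in metis)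
  have GA: "G z = f z" if z: "z \<in> A" for z
  proof -
    \<comment> \<open>Wherever a bump is nonzero its local extension is valid, and on
      \<open>A\<close> all local extensions agree with \<open>f\<close>; the weighted sum thus
      factors.\<close>
    have "\<beta> p z * F p z = \<beta> p z * f z" if "p \<in> I" for p
    proof (cases "z \<in> U p")
      case True then show ?thesis using UF[of p] that I(1) z by auto
    next
      case False
      then have "z \<notin> cball p (2 * e p)" using e(2) that I(1) by blast
      then have "e p \<le> dist z p" using e(1)[of p] that I(1) by (auto simp: dist_commute)
      then have "(e p)\<^sup>2 \<le> (dist z p)\<^sup>2" using e(1)[of p] that I(1) by (intro power_mono) auto
      then show ?thesis unfolding \<beta>_def by (simp add: flat_exp_nonpos)
    qed
    then have "N z = S z * f z" unfolding N_def S_def sum_distrib_right by (intro sum.cong refl)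
    moreover have "Q z = S z" unfolding Q_def using z0(2)[OF z] by (simp add: flat_exp_nonpos m_def)
    ultimately show ?thesis unfolding G_def using Spos[OF z] by simp
  qed
  define R where "R = (\<Sum>p\<in>I. norm p + e p)"
  have "G z = 0" if z: "z \<notin> cball 0 R" for z
  proof -
    have "\<beta> p z = 0" if p: "p \<in> I" for p
    proof -
      have "norm p + e p \<le> R" unfolding R_def
      proof (rule member_le_sum[OF p])
        show "0 \<le> norm q + e q" if "q \<in> I - {p}" for q
          using e(1)[of q] that I(1) by (intro add_nonneg_nonneg) auto
      qed (rule I(2))
      moreover have "norm z \<le> dist z p + norm p" by (metis dist_norm norm_triangle_sub add.commute)
      ultimately have "e p \<le> dist z p" using z by auto
      then have "(e p)\<^sup>2 \<le> (dist z p)\<^sup>2" using e(1)[of p] p I(1) by (intro power_mono) auto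
      then show ?thesis unfolding \<beta>_def by (simp add: flat_exp_nonpos)
    qed
    then show ?thesis unfolding G_def N_def by simp
  qed
  then show ?thesis using that dG GA by blast
qed

section \<open>The scattering solution\<close>

text \<open>On the support \<open>ucoord\<close> is at most \<open>c + 1\<close> in modulus, because
  radius and bracket differ by at most 1. The factor in \<open>ucoord\<close> of the source weight
  is then bounded below.\<close>

lemma strip_decay_le:
  assumes "c \<ge> 0"
  shows "strip c (scri_map z) * decay z ^ 3 \<le> (1 + (c + 1)\<^sup>2) * src_weight 0 z"
proof (cases "\<bar>fst (scri_map z)\<bar> \<le> c")
  case True
  have "\<bar>ucoord z\<bar> \<le> c + 1"
    using True bracket_bounds[of z] unfolding scri_map_def ucoord_def by auto
  then have "(ucoord z)\<^sup>2 \<le> (c + 1)\<^sup>2" using assms by (simp add: abs_le_square_iff[symmetric])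
  then have "1 \<le> (1 + (c + 1)\<^sup>2) * (1 / (1 + (ucoord z)\<^sup>2))" by (simp add: add_pos_nonneg)
  then have "decay z ^ 3 * 1 \<le> decay z ^ 3 * ((1 + (c + 1)\<^sup>2) * (1 / (1 + (ucoord z)\<^sup>2)))"
    by (intro mult_left_mono) (simp_all add: decay_nonneg)
  also have "\<dots> = (1 + (c + 1)\<^sup>2) * src_weight 0 z"
    unfolding src_weight_def decay_def by (simp add: power_one_over)
  finally show ?thesis using True unfolding strip_def by simp
next
  case False
  then show ?thesis unfolding strip_def using src_weight_nonneg[of 0 z] by simp
qed

lemma wave_op_add:
  assumes "wbdd (Suc (Suc 0)) w f" "wbdd (Suc (Suc 0)) v g"
  shows "wave_op (\<lambda>z. f z + g z) z = wave_op f z + wave_op g z"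
proof -
  have d: "f differentiable (at z)" "g differentiable (at z)" for z using wcauchy_diff[OF assms(1)] wcauchy_diff[OF assms(2)] by auto
  have dd: "ddir e f differentiable (at z)" "ddir e g differentiable (at z)" for e z
    using wcauchy_diff[OF wcauchy_ddir[OF assms(1)]] wcauchy_diff[OF wcauchy_ddir[OF assms(2)]] by auto
  show ?thesis unfolding wave_op_def ddir_add[OF d] ddir_add[OF dd] by (simp add: sum.distrib)
qed

text \<open>The bracket replaces the radius for smoothness on the axis. The shifts 1 and 3 place
  both arguments above 1, where the step is constant, on the region \<open>vcoord z > d\<close>,
  \<open>ucoord z < a + 1\<close>.\<close>

definition cutoff :: "real \<Rightarrow> real \<Rightarrow> spacetime \<Rightarrow> real" where
  "cutoff a d z = smooth_step (1 * fst z + bracket z + (1 - 2 * d)) * smooth_step ((-1) * fst z + bracket z + (2 * a + 3))"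

lemma wbdd_step_compose:
  assumes s: "\<bar>s\<bar> = 1"
  shows "wbdd k (\<lambda>z. if 0 \<le> s * fst z + bracket z + c then 1 else 0) (\<lambda>z. smooth_step (s * fst z + bracket z + c))"
proof -
  have hd: "((\<lambda>z. s * fst z + bracket z + c) has_derivative (\<lambda>h. s * fst h + om (snd h) z)) (at z)" for z
    by (auto intro!: derivative_eq_intros has_derivative_bracket)
  have "wbdd k (\<lambda>z. if 0 \<le> s * fst z + bracket z + c then 1 else 0) (\<lambda>z. smooth_step (s * fst z + bracket z + c))"
  proof (rule wbdd_compose[OF wbdd_smooth_step, where L = "\<lambda>z. s * fst z + bracket z + c"])
    show "(\<lambda>z. s * fst z + bracket z + c) differentiable (at z)" for z using hd differentiable_def by blast
    fix b :: real and e :: spacetime assume "b \<in> Basis"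
    then have "b = 1" by simp
    then have "ddir e (\<lambda>z. (s * fst z + bracket z + c) \<bullet> b) = (\<lambda>z. s * fst e + om (snd e) z)"
      by (intro ext) (simp add: ddir_eq[OF hd])
    moreover have "wbdd k (\<lambda>_. 1) (\<lambda>z. s * fst e + om (snd e) z)" by (intro wcauchy_add wbdd_const wbdd_om)
    ultimately show "wbdd k (\<lambda>_. 1) (ddir e (\<lambda>z. (s * fst z + bracket z + c) \<bullet> b))" by simp
  qed auto
  then show ?thesis .
qed

lemma cutoff_eq_1:
  assumes "vcoord z > d" "ucoord z < a + 1"
  shows "cutoff a d z = 1"
proof -
  have "1 * fst z + bracket z + (1 - 2 * d) \<ge> 1" "(-1) * fst z + bracket z + (2 * a + 3) \<ge> 1"
    using assms bracket_bounds(1)[of z] unfolding vcoord_def ucoord_def by auto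
  then show ?thesis unfolding cutoff_def by (simp add: smooth_step_values)
qed

text \<open>Adding the two support conditions of the steps gives
  \<open>bracket z \<ge> d - a - 2\<close>; passing to the radius costs another 1 and leads to
  \<open>D\<close>.\<close>

lemma cutoff_far_region:
  assumes "d \<ge> 1" "D = d - a - 3" "D \<ge> a + 2"
  shows "wbdd k (far_region D) (cutoff a d)" "\<bar>cutoff a d z\<bar> \<le> far_region D z"
proof -
  have far: "far_region D z = 1" if "0 \<le> 1 * fst z + bracket z + (1 - 2 * d)" "0 \<le> (-1) * fst z + bracket z + (2 * a + 3)" for z
  proof -
    have "D \<le> norm (snd z)" using that bracket_bounds(2)[of z] assms(2) by linarith
    \<comment> \<open>With \<open>r\<close> the radius, the second condition gives
      \<open>t \<le> r + 2 * a + 4\<close>, which is at most \<open>3 * r\<close> because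
      \<open>r \<ge> D \<ge> a + 2\<close>. The lower bound amounts to \<open>- t \<le> r\<close>
      and uses \<open>d \<ge> 1\<close>.\<close>
    moreover have "\<bar>ucoord z\<bar> \<le> norm (snd z)"
      using that bracket_bounds(2)[of z] assms \<open>D \<le> norm (snd z)\<close> unfolding ucoord_def by (auto simp: abs_le_iff field_simps)
    ultimately show ?thesis unfolding far_region_def by simp
  qed
  have "wbdd k (\<lambda>z. (if 0 \<le> 1 * fst z + bracket z + (1 - 2 * d) then 1 else 0) * (if 0 \<le> (-1) * fst z + bracket z + (2 * a + 3) then 1 else 0)) (cutoff a d)"
    unfolding cutoff_def[abs_def] by (intro wcauchy_mult wbdd_step_compose) auto
  then show "wbdd k (far_region D) (cutoff a d)"
    by (rule wcauchy_mono[where A = 1]) (use far far_region_nonneg in auto)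
  show "\<bar>cutoff a d z\<bar> \<le> far_region D z"
  proof (cases "0 \<le> 1 * fst z + bracket z + (1 - 2 * d) \<and> 0 \<le> (-1) * fst z + bracket z + (2 * a + 3)")
    case True
    then have "far_region D z = 1" using far by blast
    moreover have "\<bar>cutoff a d z\<bar> \<le> 1" unfolding cutoff_def abs_mult using smooth_step_values(3,4) by (intro mult_le_one) auto
    ultimately show ?thesis by simp
  next
    case False
    then have "cutoff a d z = 0" unfolding cutoff_def using smooth_step_values(1) by auto
    then show ?thesis using far_region_nonneg by simp
  qed
qed

text \<open>The radiation field of the static soliton. This constant is the difference between the
  data of the full field and those of the perturbation.\<close>

lemma soliton_limit:
  assumes "norm \<omega> = 1"
  shows "((\<lambda>r. r * soliton (r *\<^sub>R \<omega>)) \<longlongrightarrow> sqrt 3) at_top"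
proof -
  have "(1 / 3) powr - (1 / 2) = sqrt (3 :: real)"
    by (simp add: powr_minus powr_half_sqrt real_sqrt_divide)
  moreover have "((\<lambda>r::real. r * (1 + r\<^sup>2 / 3) powr (- 1 / 2)) \<longlongrightarrow> (1 / 3) powr - (1 / 2)) at_top" by real_asymp
  ultimately have "((\<lambda>r::real. r * (1 + r\<^sup>2 / 3) powr (- 1 / 2)) \<longlongrightarrow> sqrt 3) at_top" by simp
  then show ?thesis unfolding soliton_def using assms by simp
qed

text \<open>Along the cone \<open>scri_map\<close> tends to \<open>(u, \<omega>)\<close> and
  \<open>r * ibracket\<close> tends to 1, so every continuous extension of the data serves as an
  outgoing profile.\<close>

lemma approx_limit:
  assumes G: "continuous_on UNIV G" and \<omega>: "norm \<omega> = 1"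
  shows "((\<lambda>r. r * (ibracket (2 * u + r, r *\<^sub>R \<omega>) * G (scri_map (2 * u + r, r *\<^sub>R \<omega>)))) \<longlongrightarrow> G (u, \<omega>)) at_top"
proof -
  have j: "bracket (2 * u + r, r *\<^sub>R \<omega>) = sqrt (1 + r\<^sup>2)" for r unfolding bracket_def using \<omega> by simp
  have "((\<lambda>r. ((2 * u + r - sqrt (1 + r\<^sup>2)) / 2, (1 / sqrt (1 + r\<^sup>2)) *\<^sub>R (r *\<^sub>R \<omega>))) \<longlongrightarrow> (u, \<omega>)) at_top"
  proof (rule tendsto_Pair)
    have "((\<lambda>r::real. r - sqrt (1 + r\<^sup>2)) \<longlongrightarrow> 0) at_top" by real_asymp
    then have "((\<lambda>r. (2 * u + (r - sqrt (1 + r\<^sup>2))) / 2) \<longlongrightarrow> (2 * u + 0) / 2) at_top" by (intro tendsto_intros) auto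
    then show "((\<lambda>r. (2 * u + r - sqrt (1 + r\<^sup>2)) / 2) \<longlongrightarrow> u) at_top" by (simp add: add_diff_eq)
    have "((\<lambda>r::real. 1 / sqrt (1 + r\<^sup>2) * r) \<longlongrightarrow> 1) at_top" by real_asymp
    then have "((\<lambda>r. (1 / sqrt (1 + r\<^sup>2) * r) *\<^sub>R \<omega>) \<longlongrightarrow> 1 *\<^sub>R \<omega>) at_top" by (intro tendsto_intros)
    then show "((\<lambda>r. (1 / sqrt (1 + r\<^sup>2)) *\<^sub>R (r *\<^sub>R \<omega>)) \<longlongrightarrow> \<omega>) at_top" by simp
  qed
  then have "((\<lambda>r. scri_map (2 * u + r, r *\<^sub>R \<omega>)) \<longlongrightarrow> (u, \<omega>)) at_top"
    unfolding scri_map_def ibracket_def j by simp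
  then have "((\<lambda>r. G (scri_map (2 * u + r, r *\<^sub>R \<omega>))) \<longlongrightarrow> G (u, \<omega>)) at_top"
    by (rule continuous_on_tendsto_compose[OF G]) auto
  moreover have "((\<lambda>r::real. r * (1 / sqrt (1 + r\<^sup>2))) \<longlongrightarrow> 1) at_top" by real_asymp
  ultimately have "((\<lambda>r. r * (1 / sqrt (1 + r\<^sup>2)) * G (scri_map (2 * u + r, r *\<^sub>R \<omega>))) \<longlongrightarrow> 1 * G (u, \<omega>)) at_top"
    by (intro tendsto_mult)
  then show ?thesis unfolding ibracket_def j by (simp add: mult.assoc)
qed

theorem theorem1p8:
  fixes u1 u2 :: real and psidat :: "real \<times> (real ^ 3) \<Rightarrow> real"
  assumes "u1 < u2"
    and "smooth_up_to_endpoints u1 u2 psidat"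
  shows "\<exists>(d::real) (\<phi> :: spacetime \<Rightarrow> real) (\<psi> :: spacetime \<Rightarrow> real).
    solves_quintic_on \<phi> {z. vcoord z > d \<and> ucoord z < u2 + 1} \<and>
    (\<forall>z. vcoord z > d \<and> ucoord z < u2 + 1 \<longrightarrow> \<phi> z = soliton (snd z) + \<psi> z) \<and>
    (\<forall>u\<in>{u1<..<u2}. \<forall>\<omega>\<in>sphere 0 1.
      ((\<lambda>r. r * \<psi> (2 * u + r, r *\<^sub>R \<omega>)) \<longlongrightarrow> psidat (u, \<omega>)) at_top)"
proof -
  obtain F where F: "smooth_on F ({u1..u2} \<times> sphere 0 1)" "\<And>u \<omega>. u \<in> {u1<..<u2} \<Longrightarrow> \<omega> \<in> sphere 0 1 \<Longrightarrow> F (u, \<omega>) = psidat (u, \<omega>)"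
    using assms(2) unfolding smooth_up_to_endpoints_def by blast
  \<comment> \<open>The full field has to radiate the data for the perturbation plus the limit
    \<open>sqrt 3\<close> of \<open>r * soliton\<close>, so the extension is made for this
    sum.\<close>
  have sF: "smooth_on (\<lambda>q. F q + sqrt 3) ({u1..u2} \<times> sphere 0 1)"
    unfolding smooth_on_def
  proof
    fix p assume "p \<in> {u1..u2} \<times> (sphere 0 1 :: (real ^ 3) set)"
    then obtain U H where "p \<in> U" "smooth_on_open H U" "\<forall>q\<in>U \<inter> {u1..u2} \<times> sphere 0 1. H q = F q"
      using F(1) unfolding smooth_on_def by meson
    then show "\<exists>U H. p \<in> U \<and> smooth_on_open H U \<and> (\<forall>q\<in>U \<inter> {u1..u2} \<times> sphere 0 1. H q = F q + sqrt 3)"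
      by (intro exI[of _ U] exI[of _ "\<lambda>q. H q + sqrt 3"]) (auto simp: smooth_on_open_def intro!: diff_on_add diff_on_const)
  qed
  have "axis 1 1 \<in> sphere (0 :: real ^ 3) 1" by simp
  then have "(u1, axis 1 1) \<in> {u1..u2} \<times> sphere (0 :: real ^ 3) 1" using assms(1) by auto
  then have ne: "{u1..u2} \<times> sphere (0 :: real ^ 3) 1 \<noteq> {}" by blast
  obtain G R where G: "\<And>k. diff_on k G UNIV" "\<And>z. z \<in> {u1..u2} \<times> sphere 0 1 \<Longrightarrow> G z = F z + sqrt 3" "\<And>z. z \<notin> cball 0 R \<Longrightarrow> G z = 0"
    by (rule smooth_on_compact_extension[OF compact_Times[OF compact_Icc compact_sphere] ne sF]) blast
  define c where "c = \<bar>R\<bar>"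
  have wG: "wbdd k (strip c) G" for k
  proof (rule wcauchy_mono[OF wbdd_of_compact_support[OF G(1) compact_cball G(3)], where A = 1])
    show "(if z \<in> cball 0 R then 1 else 0) \<le> 1 * strip c z" for z :: spacetime
      using norm_fst_le[of "fst z" "snd z"] unfolding strip_def c_def by auto
  qed auto
  define app where "app z = ibracket z * G (scri_map z)" for z
  have wapp: "wbdd k decay app" for k
  proof -
    have "wbdd k (\<lambda>z. strip c (scri_map z) * decay z ^ Suc 0) app"
      unfolding app_def[abs_def] by (intro scri_symbol_wbdd scri_symbol.ibracket scri_symbol.compose wG)
    then show ?thesis by (rule wcauchy_mono[where A = 1]) (auto simp: strip_def decay_nonneg)
  qed
  define s where "s = wave_op app"
  have ws: "wbdd k (src_weight 0) s" for k
    using wave_op_approx[OF wG, of k] unfolding s_def app_def[abs_def]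
  proof (rule wcauchy_mono[where A = "1 + (c + 1)\<^sup>2"])
    show "strip c (scri_map z) * decay z ^ 3 \<le> (1 + (c + 1)\<^sup>2) * src_weight 0 z" for z
      by (rule strip_decay_le) (simp add: c_def)
  qed (auto simp: strip_nonneg decay_nonneg add_pos_nonneg)
  \<comment> \<open>The potential removes the error \<open>s\<close> of \<open>app\<close>, so
    \<open>lin\<close> solves the free wave equation, while \<open>adv_scri_limit\<close> keeps the
    radiation field of \<open>app\<close>.\<close>
  define lin where "lin z = app z + adv s z" for z
  have wlin: "wbdd k decay lin" for k unfolding lin_def[abs_def] by (intro wcauchy_add wapp wcauchy_adv ws)
  obtain A where A: "A > 0" "\<And>z. \<bar>lin z\<bar> \<le> A * decay z" using wbdd_bound[OF wlin[of 0] decay_nonneg] by metis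
  \<comment> \<open>The size \<open>A\<close> of the free wave was fixed without reference to
    \<open>d\<close>, so \<open>D\<close> can now be taken large enough for the contraction. The
    remaining summands of \<open>D\<close> secure \<open>D \<ge> u2 + 2\<close> and
    \<open>d \<ge> 1\<close>, and \<open>d\<close> is offset from \<open>D\<close> as in
    \<open>cutoff_far_region\<close>.\<close>
  define P where "P = 160 * A ^ 4 * adv_bound_const"
  define D where "D = \<bar>u2\<bar> + 2 + P"
  define d where "d = D + u2 + 3"
  have pos: "P \<ge> 0" unfolding P_def using A adv_bound_const_pos by simp
  have D: "D \<ge> 0" "D \<ge> u2 + 2" "d \<ge> 1" "D = d - u2 - 3" using pos unfolding D_def d_def by auto
  have "P / (1 + D) \<le> 1" using pos unfolding D_def by (simp add: divide_le_eq)
  then have small: "160 * A ^ 4 * (adv_bound_const / (1 + D)) \<le> 1" unfolding P_def by simp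
  define chi where "chi = cutoff u2 d"
  have wchi: "wbdd k (far_region D) chi" and chi1: "\<bar>chi z\<bar> \<le> far_region D z" for k z
    unfolding chi_def using cutoff_far_region[OF D(3,4,2)] by auto
  obtain \<phi> where \<phi>: "\<And>k. wbdd k decay \<phi>" "\<And>z. \<phi> z = lin z + adv (\<lambda>w. chi w * \<phi> w ^ 5) z"
    by (rule nonlinear_fixed_point[OF wlin A(2,1) wchi chi1 D(1) small]) blast
  define n where "n w = chi w * \<phi> w ^ 5" for w
  have wn: "wbdd k (src_weight 0) n" for k
    unfolding n_def[abs_def] by (rule wcauchy_quintic_source[OF wchi \<phi>(1) D(1)])
  have \<phi>eq: "\<phi> = (\<lambda>z. lin z + adv n z)" using \<phi>(2) unfolding n_def[abs_def] by blast
  have wave: "wave_op \<phi> z = - (chi z * \<phi> z ^ 5)" for z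
  proof -
    have "wave_op \<phi> z = wave_op lin z + wave_op (adv n) z"
      unfolding \<phi>eq by (rule wave_op_add[OF wlin wcauchy_adv[OF wn]])
    also have "wave_op lin z = wave_op app z + wave_op (adv s) z"
      unfolding lin_def[abs_def] by (rule wave_op_add[OF wapp wcauchy_adv[OF ws]])
    also have "wave_op (adv s) z = - s z" by (rule wave_op_adv[OF ws src_weight_nonneg src_weight_le_cone_wt])
    also have "wave_op (adv n) z = - n z" by (rule wave_op_adv[OF wn src_weight_nonneg src_weight_le_cone_wt])
    finally show ?thesis unfolding s_def n_def by simp
  qed
  define U where "U = {z :: spacetime. vcoord z > d \<and> ucoord z < u2 + 1}"
  have "open U"
  proof -
    have "open {z :: spacetime. d < (fst z + norm (snd z)) / 2}" "open {z :: spacetime. (fst z - norm (snd z)) / 2 < u2 + 1}"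
      by (intro open_Collect_less continuous_intros; simp)+
    then have "open ({z :: spacetime. d < (fst z + norm (snd z)) / 2} \<inter> {z. (fst z - norm (snd z)) / 2 < u2 + 1})" by (rule open_Int)
    moreover have "U = {z. d < (fst z + norm (snd z)) / 2} \<inter> {z. (fst z - norm (snd z)) / 2 < u2 + 1}"
      unfolding U_def vcoord_def ucoord_def by auto
    ultimately show ?thesis by simp
  qed
  then have "smooth_on_open \<phi> U"
    unfolding smooth_on_open_def using diff_on_subset[OF diff_on_of_wbdd[OF \<phi>(1)]] by blast
  moreover have "wave_op \<phi> z = - (\<phi> z ^ 5)" if "z \<in> U" for z
    using cutoff_eq_1[of d z u2] that unfolding wave chi_def U_def by simp
  ultimately have solves: "solves_quintic_on \<phi> U" unfolding solves_quintic_on_def by blast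
  \<comment> \<open>The soliton is subtracted only now, and on all of spacetime, so the limits can
    be taken along whole rays. The \<open>sqrt 3\<close> built into \<open>G\<close> then
    cancels.\<close>
  define \<psi> where "\<psi> z = \<phi> z - soliton (snd z)" for z
  have lim: "((\<lambda>r. r * \<psi> (2 * u + r, r *\<^sub>R \<omega>)) \<longlongrightarrow> psidat (u, \<omega>)) at_top"
    if u: "u \<in> {u1<..<u2}" and om: "\<omega> \<in> sphere 0 1" for u \<omega>
  proof -
    have \<omega>: "norm \<omega> = 1" using om by simp
    have adv0: "((\<lambda>r. r * adv f (2 * u + r, r *\<^sub>R \<omega>)) \<longlongrightarrow> 0) at_top" if f: "wbdd 0 (src_weight 0) f" for f
    proof -
      obtain C where C: "C > 0" "\<And>w. \<bar>f w\<bar> \<le> C * src_weight 0 w" using wbdd_bound[OF f src_weight_nonneg] by metis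
      have "continuous_on UNIV f" using f by (simp add: cauchy_wrt_def)
      then show ?thesis by (rule adv_scri_limit[OF _ C(2) _ \<omega>]) (use C(1) in simp)
    qed
    have "((\<lambda>r. r * (ibracket (2 * u + r, r *\<^sub>R \<omega>) * G (scri_map (2 * u + r, r *\<^sub>R \<omega>)))
        + r * adv s (2 * u + r, r *\<^sub>R \<omega>) + r * adv n (2 * u + r, r *\<^sub>R \<omega>) - r * soliton (r *\<^sub>R \<omega>))
        \<longlongrightarrow> G (u, \<omega>) + 0 + 0 - sqrt 3) at_top"
      by (intro tendsto_diff tendsto_add approx_limit adv0 ws wn soliton_limit \<omega> diff_on_imp_continuous_on[OF G(1)])
    moreover have "G (u, \<omega>) + 0 + 0 - sqrt 3 = psidat (u, \<omega>)" using G(2)[of "(u, \<omega>)"] F(2)[OF u om] u om by simp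
    moreover have "\<psi> (2 * u + r, r *\<^sub>R \<omega>) = ibracket (2 * u + r, r *\<^sub>R \<omega>) * G (scri_map (2 * u + r, r *\<^sub>R \<omega>))
        + adv s (2 * u + r, r *\<^sub>R \<omega>) + adv n (2 * u + r, r *\<^sub>R \<omega>) - soliton (r *\<^sub>R \<omega>)" for r
      unfolding \<psi>_def by (subst \<phi>eq) (simp add: lin_def app_def)
    ultimately show ?thesis by (simp only: ring_distribs)
  qed
  show ?thesis
    by (rule exI[of _ d], rule exI[of _ \<phi>], rule exI[of _ \<psi>])
      (use solves lim in \<open>simp add: U_def \<psi>_def\<close>)
qed

end
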